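(* Let $\mathcal X=[0,1]^d$. (i) Let $(\mu,\nu)\in\mathcal P^2_{\mathsf H^2}(\mathcal X)$ be such that $f_{\mathsf H^2}=1-\big(\frac{d\mu}{d\nu}\big)^{-1/2}\in\mathsf C(\mathcal X)$ and such that $\big\|\frac{d\mu}{d\nu}\big\|_{\infty,\eta}\le M$ for some $M>0$. Let $\phi\in\{\phi_{\mathsf S},\phi_{\mathsf R}\}$ and $0<\rho<1$. For any sequence $(k_n)_{n\in\mathbb N}$ with $k_n\to\infty$ and $k_n=O(n^{(1-\rho)/3})$, with $\mathcal G_n=\tilde{\mathcal G}^*_{k_n,M^{-1/2}}(\phi)$, $$\hat{\mathsf H}^2_{\mathcal G_n}(X^n,Y^n)\xrightarrow[n\to\infty]{}\mathsf H^2(\mu,\nu)\quad\mathbb P\text{-a.s.}$$ (ii) For every $M\ge0$ there is a constant $C_M$ depending only on $M$ such that, with $m_k=\log k$, $t_k=(\log k)^{-1}$ and $\mathcal G_k=\tilde{\mathcal G}^{\mathsf R}_{k,t_k}(m_k)$, for all integers $k\ge2$ and $n\ge1$, $$\sup_{(\mu,\nu)\in\mathcal P^2_{\mathsf H^2}(M,\mathcal X)}\mathbb E\Big[\big|\hat{\mathsf H}^2_{\mathcal G_k}(X^n,Y^n)-\mathsf H^2(\mu,\nu)\big|\Big]\le C_M\Big(d^{1/2}k^{-1/2}\log k+d^{3/2}(\log k)^3n^{-1/2}\Big).$$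
   Context: For $\mu\ll\nu$, $\mathsf H^2(\mu,\nu)=\mathbb E_\nu\big[(\sqrt{d\mu/d\nu}-1)^2\big]$ (no factor $1/2$). $\mathcal P^2_{\mathsf H^2}(\mathcal X)$ is the set of pairs of Borel probability measures on $\mathcal X$ with $\mu\ll\nu$. $\eta$ denotes a probability measure dominating $\mu$ and $\nu$, e.g. $\eta=(\mu+\nu)/2$, and $\|\cdot\|_{\infty,\eta}$ is the $\eta$-essential supremum norm. $\mathcal P^2_{\mathsf H^2}(M,\mathcal X)$ is the set of $(\mu,\nu)\in\mathcal P^2_{\mathsf H^2}(\mathcal X)$ with $c^\star_{\mathsf{KB}}(f_{\mathsf H^2},\mathcal X)\vee\|\frac{d\mu}{d\nu}\|_{\infty,\eta}\le M$ (pointwise conditions on $f_{\mathsf H^2}$ refer to a suitable version of the density). $\mathsf C(\mathcal X)$: continuous real functions on $\mathcal X$. Klusowski–Barron coefficient: $\|\mathcal X\|:=\sup_{x\in\mathcal X}\|x\|_\infty$. For $\tilde f:\mathbb R^d\to\mathbb R$ with a Fourier representation $\tilde f(x)=\int_{\mathbb R^d}e^{i\omega\cdot x}F(d\omega)$, $F$ a complex Borel measure with magnitude $|F|$, let $S_m(\tilde f)=\int_{\mathbb R^d}\|\omega\|_1^m|F|(d\omega)$. For $f:\mathcal X\to\mathbb R$, $c^\star_{\mathsf{KB}}(f,\mathcal X)$ is the infimum of $c\ge0$ such that some such $\tilde f$ satisfies $\tilde f|_{\mathcal X}=f$, $\|\mathcal X\|S_2(\tilde f)\le c$, $|\tilde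 f(0)|\le c$ and $\|\nabla\tilde f(0)\|_1\le c$. Neural networks: $\mathcal G_k(a_1,a_2,a_3,a_4,\phi)$ is the set of $g(x)=\sum_{i=1}^k\beta_i\phi(w_i\cdot x+b_i)+w_0\cdot x+b_0$ on $\mathbb R^d$ with $\|w_i\|_1\vee|b_i|\le a_1$, $|\beta_i|\le a_2$ ($1\le i\le k$), $|b_0|\le a_3$, $\|w_0\|_1\le a_4$. $\phi_{\mathsf S}(z)=(1+e^{-z})^{-1}$, $\phi_{\mathsf R}(z)=\max\{z,0\}$. For $t>0$, $\tilde{\mathcal G}_{k,t}(\mathbf a,\phi)=\{x\mapsto\min\{1-t,\tilde g(x)\}:\tilde g\in\mathcal G_k(\mathbf a,\phi)\}$; $\tilde{\mathcal G}^*_{k,t}(\phi)=\tilde{\mathcal G}_{k,t}(1,1,1,0,\phi)$; $\tilde{\mathcal G}^{\mathsf R}_{k,t}(a)=\tilde{\mathcal G}_{k,t}(1,2k^{-1}a,a,a,\phi_{\mathsf R})$. Estimator: $\hat{\mathsf H}^2_{\mathcal G}(X^n,Y^n)=\sup_{g\in\mathcal G}\frac1n\sum_{i=1}^n\Big[g(X_i)-\frac{g(Y_i)}{1-g(Y_i)}\Big]$, where $(X_i)$ are i.i.d. from $\mu$ and $(Y_i)$ i.i.d. from $\nu$ (independent samples). *)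

theory Defs
  imports "HOL-Probability.Probability" "HOL-Library.Landau_Symbols"
begin

section \<open>Euclidean space of varying dimension\<close>

text \<open>
  The dimension d has to be quantified inside the statement, because the constant of the risk bound
  must not depend on it. Points of d-dimensional space are therefore the extensional functions
  from {..<d} to the reals, i.e. the points of the library's product space over {..<d}.
\<close>

definition Rd :: "nat \<Rightarrow> (nat \<Rightarrow> real) measure" where
  "Rd d = Pi\<^sub>M {..<d} (\<lambda>_. borel)"

definition cube :: "nat \<Rightarrow> (nat \<Rightarrow> real) set" where
  "cube d = {..<d} \<rightarrow>\<^sub>E {0..1}"

definition cube_borel :: "nat \<Rightarrow> (nat \<Rightarrow> real) measure" where
  "cube_borel d = restrict_space (Rd d) (cube d)"

text \<open>The product sigma-algebra is the Borel sigma-algebra of the topology that the library puts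
  on functions from nat to the reals; continuity on the cube refers to the same topology.\<close>

lemma sets_Rd_eq_borel:
  "sets (Rd d) = sets (restrict_space borel ({..<d} \<rightarrow>\<^sub>E (UNIV :: real set)))"
proof -
  let ?E = "{..<d} \<rightarrow>\<^sub>E (UNIV :: real set)"
  have sp: "space (Rd d) = ?E"
    by (simp add: Rd_def space_PiM)
  have "(\<lambda>x. x) \<in> restrict_space borel ?E \<rightarrow>\<^sub>M Pi\<^sub>M {..<d} (\<lambda>_. borel)"
  proof (rule measurable_PiM_single')
    fix j assume "j \<in> {..<d}"
    have "(\<lambda>x::nat \<Rightarrow> real. x j) \<in> borel_measurable (Pi\<^sub>M UNIV (\<lambda>_. borel))"
      by simp
    then have "(\<lambda>x::nat \<Rightarrow> real. x j) \<in> borel_measurable borel"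
      using measurable_cong_sets[OF sets_PiM_equal_borel refl] by blast
    then show "(\<lambda>x. x j) \<in> borel_measurable (restrict_space borel ?E)"
      by (rule measurable_restrict_space1)
  qed (auto simp: space_restrict_space)
  then have 1: "(\<lambda>x. x) \<in> restrict_space borel ?E \<rightarrow>\<^sub>M Rd d"
    by (simp add: Rd_def)
  have "(\<lambda>x. x) \<in> Rd d \<rightarrow>\<^sub>M Pi\<^sub>M UNIV (\<lambda>_. borel)"
  proof (rule measurable_PiM_single')
    fix j :: nat
    show "(\<lambda>x. x j) \<in> borel_measurable (Rd d)"
    proof (cases "j < d")
      case True
      then show ?thesis unfolding Rd_def by (intro measurable_component_singleton) simp
    next
      case False
      then have "x j = undefined" if "x \<in> space (Rd d)" for x
        using that PiE_arb[of x "{..<d}" "\<lambda>_. UNIV" j] by (simp add: sp)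
      then have "(\<lambda>x. x j) \<in> borel_measurable (Rd d) \<longleftrightarrow>
          (\<lambda>_. undefined :: real) \<in> borel_measurable (Rd d)"
        by (rule measurable_cong)
      then show ?thesis by simp
    qed
  qed auto
  then have "(\<lambda>x. x) \<in> Rd d \<rightarrow>\<^sub>M borel"
    using measurable_cong_sets[OF refl sets_PiM_equal_borel] by blast
  then have 2: "(\<lambda>x. x) \<in> Rd d \<rightarrow>\<^sub>M restrict_space borel ?E"
    by (intro measurable_restrict_space2) (auto simp: sp)
  show ?thesis
  proof (rule antisym)
    show "sets (Rd d) \<subseteq> sets (restrict_space borel ?E)"
    proof
      fix A assume A: "A \<in> sets (Rd d)"
      then have "A \<subseteq> ?E" using sets.sets_into_space sp by blast
      with measurable_sets[OF 1 A] show "A \<in> sets (restrict_space borel ?E)"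
        by (simp add: space_restrict_space Int_absorb2)
    qed
    show "sets (restrict_space borel ?E) \<subseteq> sets (Rd d)"
    proof
      fix A assume A: "A \<in> sets (restrict_space borel ?E)"
      then have "A \<subseteq> ?E" using sets.sets_into_space by (fastforce simp: space_restrict_space)
      with measurable_sets[OF 2 A] show "A \<in> sets (Rd d)"
        by (simp add: sp Int_absorb2)
    qed
  qed
qed

definition dot :: "nat \<Rightarrow> (nat \<Rightarrow> real) \<Rightarrow> (nat \<Rightarrow> real) \<Rightarrow> real" where
  "dot d w x = (\<Sum>j<d. w j * x j)"

definition l1_norm :: "nat \<Rightarrow> (nat \<Rightarrow> real) \<Rightarrow> real" where
  "l1_norm d w = (\<Sum>j<d. \<bar>w j\<bar>)"

definition zero_vec :: "nat \<Rightarrow> nat \<Rightarrow> real" where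
  "zero_vec d = (\<lambda>j\<in>{..<d}. 0)"

definition set_sup_norm :: "nat \<Rightarrow> (nat \<Rightarrow> real) set \<Rightarrow> ennreal" where
  "set_sup_norm d S = (SUP x\<in>S. SUP j\<in>{..<d}. ennreal \<bar>x j\<bar>)"

section \<open>Complex measures\<close>

definition complex_measure :: "'a measure \<Rightarrow> ('a set \<Rightarrow> complex) \<Rightarrow> bool" where
  "complex_measure M F \<longleftrightarrow> F {} = 0 \<and>
     (\<forall>A. range A \<subseteq> sets M \<longrightarrow> disjoint_family A \<longrightarrow>
        (\<lambda>i. F (A i)) sums F (\<Union>i::nat. A i))"

definition total_variation :: "'a measure \<Rightarrow> ('a set \<Rightarrow> complex) \<Rightarrow> 'a measure" where
  "total_variation M F = measure_of (space M) (sets M)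
     (\<lambda>E. SUP A\<in>{A :: nat \<Rightarrow> 'a set. range A \<subseteq> sets M \<and> disjoint_family A \<and> (\<Union>i. A i) = E}.
            \<Sum>i. ennreal (cmod (F (A i))))"

text \<open>The polar decomposition dF = h d|F|. It exists for every complex measure, and h is unique up
  to |F|-null sets; as usual, the integral with respect to F is that of g h with respect to |F|.\<close>

definition polar_density :: "'a measure \<Rightarrow> ('a set \<Rightarrow> complex) \<Rightarrow> ('a \<Rightarrow> complex) \<Rightarrow> bool" where
  "polar_density M F h \<longleftrightarrow> integrable (total_variation M F) h \<and>
     (AE \<omega> in total_variation M F. cmod (h \<omega>) = 1) \<and>
     (\<forall>A\<in>sets M. F A = (\<integral>\<omega>. indicator A \<omega> * h \<omega> \<partial>total_variation M F))"

definition has_complex_measure_integral ::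
    "'a measure \<Rightarrow> ('a set \<Rightarrow> complex) \<Rightarrow> ('a \<Rightarrow> complex) \<Rightarrow> complex \<Rightarrow> bool" where
  "has_complex_measure_integral M F g I \<longleftrightarrow> (\<exists>h. polar_density M F h \<and>
     integrable (total_variation M F) (\<lambda>\<omega>. g \<omega> * h \<omega>) \<and>
     I = (\<integral>\<omega>. g \<omega> * h \<omega> \<partial>total_variation M F))"

section \<open>The Klusowski-Barron coefficient\<close>

definition fourier_rep :: "nat \<Rightarrow> ((nat \<Rightarrow> real) \<Rightarrow> real) \<Rightarrow> ((nat \<Rightarrow> real) set \<Rightarrow> complex) \<Rightarrow> bool" where
  "fourier_rep d f F \<longleftrightarrow> complex_measure (Rd d) F \<and>
     (\<forall>x\<in>space (Rd d). has_complex_measure_integral (Rd d) F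
        (\<lambda>\<omega>. exp (\<i> * complex_of_real (dot d \<omega> x))) (complex_of_real (f x)))"

definition spectral_moment :: "nat \<Rightarrow> nat \<Rightarrow> ((nat \<Rightarrow> real) set \<Rightarrow> complex) \<Rightarrow> ennreal" where
  "spectral_moment d m F = (\<integral>\<^sup>+\<omega>. ennreal (l1_norm d \<omega> ^ m) \<partial>total_variation (Rd d) F)"

definition gradient_at_zero :: "nat \<Rightarrow> ((nat \<Rightarrow> real) \<Rightarrow> real) \<Rightarrow> (nat \<Rightarrow> real) \<Rightarrow> bool" where
  "gradient_at_zero d f v \<longleftrightarrow>
     (\<forall>j<d. ((\<lambda>s. f ((zero_vec d)(j := s))) has_real_derivative v j) (at 0))"

definition kb_coeff :: "nat \<Rightarrow> (nat \<Rightarrow> real) set \<Rightarrow> ((nat \<Rightarrow> real) \<Rightarrow> real) \<Rightarrow> ereal" where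
  "kb_coeff d S f = Inf {ereal c | c. 0 \<le> c \<and>
     (\<exists>ft F v. fourier_rep d ft F \<and> (\<forall>x\<in>S. ft x = f x) \<and>
        set_sup_norm d S * spectral_moment d 2 F \<le> ennreal c \<and>
        \<bar>ft (zero_vec d)\<bar> \<le> c \<and>
        gradient_at_zero d ft v \<and> l1_norm d v \<le> c)}"

section \<open>Squared Hellinger distance\<close>

definition hellinger2 :: "'a measure \<Rightarrow> 'a measure \<Rightarrow> real" where
  "hellinger2 \<mu> \<nu> = (\<integral>x. (sqrt (enn2real (RN_deriv \<nu> \<mu> x)) - 1)\<^sup>2 \<partial>\<nu>)"

definition prob_pairs :: "nat \<Rightarrow> ((nat \<Rightarrow> real) measure \<times> (nat \<Rightarrow> real) measure) set" where
  "prob_pairs d = {(\<mu>, \<nu>). prob_space \<mu> \<and> sets \<mu> = sets (cube_borel d) \<and>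
     prob_space \<nu> \<and> sets \<nu> = sets (cube_borel d) \<and> absolutely_continuous \<nu> \<mu>}"

text \<open>A version p of the density of \<mu> with respect to \<nu> for which 1 - p powr (-1/2) is real-valued
  at every point. Positivity must be demanded, as HOL sets 0 powr (-1/2) = 0.\<close>

definition density_version :: "'a measure \<Rightarrow> 'a measure \<Rightarrow> ('a \<Rightarrow> real) \<Rightarrow> bool" where
  "density_version \<mu> \<nu> p \<longleftrightarrow> p \<in> borel_measurable \<nu> \<and> (\<forall>x\<in>space \<nu>. 0 < p x) \<and>
     density \<nu> (\<lambda>x. ennreal (p x)) = \<mu>"

definition f_H2 :: "('a \<Rightarrow> real) \<Rightarrow> 'a \<Rightarrow> real" where
  "f_H2 p x = 1 - p x powr (-1/2)"

definition dominating :: "'a measure \<Rightarrow> 'a measure \<Rightarrow> 'a measure \<Rightarrow> bool" where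
  "dominating \<eta> \<mu> \<nu> \<longleftrightarrow> prob_space \<eta> \<and> sets \<eta> = sets \<mu> \<and> sets \<eta> = sets \<nu> \<and>
     absolutely_continuous \<eta> \<mu> \<and> absolutely_continuous \<eta> \<nu>"

definition ess_sup_norm :: "'a measure \<Rightarrow> ('a \<Rightarrow> real) \<Rightarrow> ereal" where
  "ess_sup_norm \<eta> p = esssup \<eta> (\<lambda>x. ereal \<bar>p x\<bar>)"

text \<open>The choice of \<eta> is immaterial: the mean of \<mu> and \<nu> gives the smallest norm, and any
  dominating measure that meets the bound can be replaced by it.\<close>

definition prob_pairs_bounded ::
    "real \<Rightarrow> nat \<Rightarrow> ((nat \<Rightarrow> real) measure \<times> (nat \<Rightarrow> real) measure) set" where
  "prob_pairs_bounded M d = {(\<mu>, \<nu>) \<in> prob_pairs d. \<exists>p \<eta>. density_version \<mu> \<nu> p \<and>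
     dominating \<eta> \<mu> \<nu> \<and>
     max (kb_coeff d (cube d) (f_H2 p)) (ess_sup_norm \<eta> p) \<le> ereal M}"

section \<open>Neural network classes and the estimator\<close>

definition sigmoid :: "real \<Rightarrow> real" where
  "sigmoid z = 1 / (1 + exp (- z))"

definition relu :: "real \<Rightarrow> real" where
  "relu z = max z 0"

definition nn_class :: "nat \<Rightarrow> nat \<Rightarrow> real \<Rightarrow> real \<Rightarrow> real \<Rightarrow> real \<Rightarrow> (real \<Rightarrow> real) \<Rightarrow>
    ((nat \<Rightarrow> real) \<Rightarrow> real) set" where
  "nn_class d k a1 a2 a3 a4 \<phi> =
     {g. \<exists>(\<beta> :: nat \<Rightarrow> real) (w :: nat \<Rightarrow> nat \<Rightarrow> real) (b :: nat \<Rightarrow> real) w0 b0.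
        (\<forall>i<k. max (l1_norm d (w i)) \<bar>b i\<bar> \<le> a1 \<and> \<bar>\<beta> i\<bar> \<le> a2) \<and>
        \<bar>b0\<bar> \<le> a3 \<and> l1_norm d w0 \<le> a4 \<and>
        g = (\<lambda>x. (\<Sum>i<k. \<beta> i * \<phi> (dot d (w i) x + b i)) + dot d w0 x + b0)}"

definition clipped_nn_class :: "nat \<Rightarrow> nat \<Rightarrow> real \<Rightarrow> real \<Rightarrow> real \<Rightarrow> real \<Rightarrow> real \<Rightarrow> (real \<Rightarrow> real) \<Rightarrow>
    ((nat \<Rightarrow> real) \<Rightarrow> real) set" where
  "clipped_nn_class d k t a1 a2 a3 a4 \<phi> =
     (\<lambda>g x. min (1 - t) (g x)) ` nn_class d k a1 a2 a3 a4 \<phi>"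

definition nn_star :: "nat \<Rightarrow> nat \<Rightarrow> real \<Rightarrow> (real \<Rightarrow> real) \<Rightarrow> ((nat \<Rightarrow> real) \<Rightarrow> real) set" where
  "nn_star d k t \<phi> = clipped_nn_class d k t 1 1 1 0 \<phi>"

definition nn_relu :: "nat \<Rightarrow> nat \<Rightarrow> real \<Rightarrow> real \<Rightarrow> ((nat \<Rightarrow> real) \<Rightarrow> real) set" where
  "nn_relu d k t a = clipped_nn_class d k t 1 (2 * a / real k) a a relu"

text \<open>Samples are indexed from 0 to n - 1.\<close>

definition hellinger2_est :: "('a \<Rightarrow> real) set \<Rightarrow> nat \<Rightarrow> (nat \<Rightarrow> 'a) \<Rightarrow> (nat \<Rightarrow> 'a) \<Rightarrow> real" where
  "hellinger2_est G n x y =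
     (SUP g\<in>G. (\<Sum>i<n. g (x i) - g (y i) / (1 - g (y i))) / real n)"

definition iid_samples ::
    "'w measure \<Rightarrow> 'a measure \<Rightarrow> 'a measure \<Rightarrow> (nat \<Rightarrow> 'w \<Rightarrow> 'a) \<Rightarrow> (nat \<Rightarrow> 'w \<Rightarrow> 'a) \<Rightarrow> bool" where
  "iid_samples P \<mu> \<nu> X Y \<longleftrightarrow> prob_space P \<and>
     prob_space.indep_vars P (case_sum (\<lambda>_. \<mu>) (\<lambda>_. \<nu>)) (case_sum X Y) UNIV \<and>
     (\<forall>i. distr P \<mu> (X i) = \<mu>) \<and> (\<forall>i. distr P \<nu> (Y i) = \<nu>)"

text \<open>The expected absolute error depends only on the joint law of the two samples, which is the
  product measure below. The nonnegative integral avoids any integrability convention.\<close>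

definition expected_error :: "('a \<Rightarrow> real) set \<Rightarrow> nat \<Rightarrow> 'a measure \<Rightarrow> 'a measure \<Rightarrow> ennreal" where
  "expected_error G n \<mu> \<nu> =
     (\<integral>\<^sup>+z. ennreal \<bar>hellinger2_est G n (fst z) (snd z) - hellinger2 \<mu> \<nu>\<bar>
        \<partial>(Pi\<^sub>M {..<n} (\<lambda>_. \<mu>) \<Otimes>\<^sub>M Pi\<^sub>M {..<n} (\<lambda>_. \<nu>)))"

end

theory Submission
  imports Defs "HOL-Real_Asymp.Real_Asymp"
begin

text \<open>The objective of the estimator is the empirical version of the functional
  \<open>J g = E\<^sub>\<mu> g - E\<^sub>\<nu> (g / (1 - g))\<close>. For functions below 1 this functional falls short of the squared
  Hellinger distance by exactly \<open>E\<^sub>\<mu> ((g - f)\<^sup>2 / (1 - g))\<close>, where \<open>f = f_H2 p\<close> (lemma \<open>hellinger_gap\<close>).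
  Hence \<open>f\<close> is the maximiser, the loss is quadratic around it, and clipping at a level above \<open>f\<close>
  can only help. The estimator therefore errs by at most the squared \<open>L\<^sup>2(\<mu>)\<close> distance from \<open>f\<close> to the
  class, divided by the clipping margin, plus the uniform deviation of the empirical objective from
  \<open>J\<close> over the class; by rounding parameters it suffices to control the deviation over a finite net
  (\<open>nn_class_finite_net\<close>, \<open>estimator_error\<close>).

  For consistency, networks with bounded weights are dense in the continuous functions on the cube:
  they approximate all exponentials of linear forms, and these span an algebra
  (\<open>universal_approximation\<close>). The deviations are handled by Hoeffding's inequality and a union bound
  over the net. With \<open>k\<close> neurons the logarithm of the size of the net is of order \<open>k log k\<close> and the summands are
  of order \<open>k\<close>, so up to constants the failure probabilities are \<open>exp (k log k - n / k\<^sup>2)\<close>; they are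
  summable when \<open>k\<close> is at most of order \<open>n\<close> to the power \<open>(1 - \<rho>) / 3\<close>. The Borel-Cantelli lemma concludes.

  For the risk bound, a function with finite Klusowski-Barron coefficient is, up to an affine part,
  a mixture of rectifiers: Taylor's formula with integral remainder writes each Fourier mode as an
  integral of ramps (\<open>exp_taylor_ramp\<close>, \<open>fourier_mixture\<close>). A greedy choice of \<open>k\<close> neurons reproduces a
  mixture up to a squared \<open>L\<^sup>2\<close> error of order \<open>1 / k\<close> (\<open>greedy_mixture\<close>). The expected uniform deviation
  is bounded independently of \<open>k\<close> by symmetrisation and contraction (\<open>expected_deviation_le\<close>): Lipschitz
  maps do not increase the complexity, and a network is a combination of neurons of total outer
  weight at most \<open>2 log k\<close>, so only signed sums of affine functions on the cube remain. The clipping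
  margin \<open>1 / log k\<close> makes the second summand of the objective Lipschitz with constant \<open>(log k)\<^sup>2\<close>, which
  together with the weight bound accounts for \<open>(log k)\<^sup>3\<close>.\<close>

section \<open>Comparison of expected maxima\<close>

abbreviation fmax :: "'i set \<Rightarrow> ('i \<Rightarrow> real) \<Rightarrow> real" where
  "fmax I f \<equiv> Max (f ` I)"

lemma fmax_le_iff: "finite I \<Longrightarrow> I \<noteq> {} \<Longrightarrow> fmax I f \<le> c \<longleftrightarrow> (\<forall>i\<in>I. f i \<le> c)"
  by simp

lemma fmax_ge: "finite I \<Longrightarrow> i \<in> I \<Longrightarrow> f i \<le> fmax I f"
  by simp

lemma fmax_attained: "finite I \<Longrightarrow> I \<noteq> {} \<Longrightarrow> \<exists>i\<in>I. fmax I f = f i"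
proof -
  assume "finite I" "I \<noteq> {}"
  then have "fmax I f \<in> f ` I" by (intro Max_in) auto
  then show ?thesis by (rule imageE) blast
qed

lemma abs_fmax_le:
  assumes "finite I" "I \<noteq> {}" "\<And>i. i \<in> I \<Longrightarrow> \<bar>f i\<bar> \<le> B"
  shows "\<bar>fmax I f\<bar> \<le> B"
  using fmax_attained[OF assms(1,2), of f] assms(3) by auto

text \<open>An index at which \<open>f\<close> vanishes makes both one-sided maxima nonnegative.\<close>

lemma fmax_abs_le:
  assumes "finite I" "I \<noteq> {}" "i0 \<in> I" "f i0 = 0"
  shows "fmax I (\<lambda>i. \<bar>f i\<bar>) \<le> fmax I f + fmax I (\<lambda>i. - f i)"
proof -
  have "0 \<le> fmax I f" "0 \<le> fmax I (\<lambda>i. - f i)"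
    using fmax_ge[OF assms(1,3), of f] fmax_ge[OF assms(1,3), of "\<lambda>i. - f i"] assms(4) by auto
  moreover have "f i \<le> fmax I f" "- f i \<le> fmax I (\<lambda>i. - f i)" if "i \<in> I" for i
    using fmax_ge[OF assms(1) that, of f] fmax_ge[OF assms(1) that, of "\<lambda>i. - f i"] by auto
  ultimately show ?thesis
    unfolding fmax_le_iff[OF assms(1,2)] by (fastforce simp: abs_le_iff)
qed

text \<open>The two-point form of the contraction principle. The maximisers of the two terms on the left are
  used on the right in whichever order makes the difference of \<open>u\<close> nonnegative.\<close>

lemma fmax_contraction:
  assumes I: "finite I" "I \<noteq> {}" and L: "\<And>i j. i \<in> I \<Longrightarrow> j \<in> I \<Longrightarrow> \<bar>v i - v j\<bar> \<le> \<bar>u i - u j\<bar>"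
  shows "fmax I (\<lambda>i. A i + v i) + fmax I (\<lambda>i. A i - v i)
       \<le> fmax I (\<lambda>i. A i + u i) + fmax I (\<lambda>i. A i - u i)"
proof -
  obtain i where i: "i \<in> I" "fmax I (\<lambda>i. A i + v i) = A i + v i"
    using fmax_attained[OF I, of "\<lambda>i. A i + v i"] by auto
  obtain j where j: "j \<in> I" "fmax I (\<lambda>i. A i - v i) = A j - v j"
    using fmax_attained[OF I, of "\<lambda>i. A i - v i"] by auto
  have "A i + u i \<le> fmax I (\<lambda>i. A i + u i)" "A j + u j \<le> fmax I (\<lambda>i. A i + u i)"
    "A i - u i \<le> fmax I (\<lambda>i. A i - u i)" "A j - u j \<le> fmax I (\<lambda>i. A i - u i)"
    using fmax_ge[OF I(1) i(1), of "\<lambda>i. A i + u i"] fmax_ge[OF I(1) j(1), of "\<lambda>i. A i + u i"]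
      fmax_ge[OF I(1) i(1), of "\<lambda>i. A i - u i"] fmax_ge[OF I(1) j(1), of "\<lambda>i. A i - u i"] by auto
  then show ?thesis using L[OF i(1) j(1)] unfolding i(2) j(2) by linarith
qed

lemma abs_sum_lessThan_le:
  fixes f :: "nat \<Rightarrow> real"
  assumes "\<And>j. j < m \<Longrightarrow> \<bar>f j\<bar> \<le> B"
  shows "\<bar>\<Sum>j<m. f j\<bar> \<le> real m * B"
  using sum_bounded_above[of "{..<m}" "\<lambda>j. \<bar>f j\<bar>" B] assms
  by (intro order_trans[OF sum_abs]) simp

lemma (in prob_space) integrable_bounded:
  fixes f :: "'a \<Rightarrow> real"
  assumes "f \<in> borel_measurable M" "\<And>x. x \<in> space M \<Longrightarrow> \<bar>f x\<bar> \<le> B"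
  shows "integrable M f"
  using assms by (intro integrable_const_bound[of _ B]) auto

lemma (in prob_space) abs_expectation_le:
  fixes f :: "'a \<Rightarrow> real"
  assumes "f \<in> borel_measurable M" "\<And>x. x \<in> space M \<Longrightarrow> \<bar>f x\<bar> \<le> B"
  shows "\<bar>integral\<^sup>L M f\<bar> \<le> B"
proof -
  have "integrable M f" using assms by (rule integrable_bounded)
  have "\<bar>integral\<^sup>L M f\<bar> \<le> integral\<^sup>L M (\<lambda>x. \<bar>f x\<bar>)" by simp
  also have "\<dots> \<le> integral\<^sup>L M (\<lambda>_. B)"
    using assms \<open>integrable M f\<close> by (intro integral_mono) auto
  finally show ?thesis by (simp add: prob_space)
qed

lemma integrable_pair_bounded:
  fixes f :: "'a \<Rightarrow> 'b \<Rightarrow> real"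
  assumes "prob_space N" "prob_space M" and f: "(\<lambda>(x, y). f x y) \<in> borel_measurable (N \<Otimes>\<^sub>M M)"
    and C: "\<And>x y. y \<in> space M \<Longrightarrow> x \<in> space N \<Longrightarrow> \<bar>f x y\<bar> \<le> C"
  shows "integrable (N \<Otimes>\<^sub>M M) (\<lambda>(x, y). f x y)"
proof -
  interpret NM: prob_space "N \<Otimes>\<^sub>M M" using assms(1,2) by (rule prob_space_pair)
  show ?thesis using f C by (intro NM.integrable_bounded[of _ C]) (auto simp: space_pair_measure)
qed

lemma integrable_inner_integral:
  fixes f :: "'a \<Rightarrow> 'b \<Rightarrow> real"
  assumes "prob_space N" "prob_space M" and "(\<lambda>(x, y). f x y) \<in> borel_measurable (N \<Otimes>\<^sub>M M)"
    and "\<And>x y. y \<in> space M \<Longrightarrow> x \<in> space N \<Longrightarrow> \<bar>f x y\<bar> \<le> C"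
  shows "integrable N (\<lambda>x. \<integral>y. f x y \<partial>M)"
proof -
  interpret N: prob_space N by fact
  interpret M: prob_space M by fact
  interpret P: pair_prob_space N M ..
  show ?thesis
    using P.integrable_fst'[OF integrable_pair_bounded[OF assms]] by simp
qed

lemma (in prob_space) fmax_expectation_le:
  assumes I: "finite I" "I \<noteq> {}" and f: "\<And>i. i \<in> I \<Longrightarrow> f i \<in> borel_measurable M"
    "\<And>i x. i \<in> I \<Longrightarrow> x \<in> space M \<Longrightarrow> \<bar>f i x\<bar> \<le> B"
  shows "fmax I (\<lambda>i. A i + expectation (f i)) \<le> expectation (\<lambda>x. fmax I (\<lambda>i. A i + f i x))"
proof (subst fmax_le_iff[OF I], rule)
  fix i assume i: "i \<in> I"
  obtain C where C: "\<And>i. i \<in> I \<Longrightarrow> \<bar>A i\<bar> \<le> C"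
    using that[of "fmax I (\<lambda>i. \<bar>A i\<bar>)"] fmax_ge[OF I(1), of _ "\<lambda>i. \<bar>A i\<bar>"] by simp
  have int: "integrable M (f i)" using f i by (intro integrable_bounded[of _ B]) auto
  have "A i + expectation (f i) = expectation (\<lambda>x. A i + f i x)"
    using int by (simp add: prob_space)
  also have "\<dots> \<le> expectation (\<lambda>x. fmax I (\<lambda>i. A i + f i x))"
  proof (rule integral_mono)
    show "integrable M (\<lambda>x. A i + f i x)" using int by simp
    show "integrable M (\<lambda>x. fmax I (\<lambda>i. A i + f i x))"
      using I f C by (intro integrable_bounded[of _ "C + B"] borel_measurable_Max abs_fmax_le)
        (auto intro!: order_trans[OF abs_triangle_ineq] add_mono)
    show "A i + f i x \<le> fmax I (\<lambda>i. A i + f i x)" for x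
      using fmax_ge[OF I(1) i, of "\<lambda>i. A i + f i x"] by simp
  qed
  finally show "A i + expectation (f i) \<le> expectation (\<lambda>x. fmax I (\<lambda>i. A i + f i x))" .
qed

text \<open>A uniform random sign. Its carrier is all of the reals; the sign is read off with \<open>sgn\<close>, which
  keeps integrands bounded off the support.\<close>

definition coin :: "real measure" where
  "coin = measure_pmf (pmf_of_set {-1, 1})"

lemma space_coin [simp]: "space coin = UNIV" and sets_coin [simp]: "sets coin = UNIV"
  by (simp_all add: coin_def)

lemma prob_space_coin: "prob_space coin"
  by (simp add: coin_def measure_pmf.prob_space_axioms)

lemma integral_coin: "(\<integral>s. f s \<partial>coin) = (f 1 + f (-1)) / (2::real)"
  by (simp add: coin_def integral_pmf_of_set)

lemma borel_measurable_coin: "f \<in> borel_measurable coin"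
  by (simp add: measurable_def)

lemma prob_space_coin_pair: "prob_space \<mu> \<Longrightarrow> prob_space (coin \<Otimes>\<^sub>M \<mu>)"
  by (intro prob_space_pair prob_space_coin)

lemma integral_coin_pair:
  fixes f :: "real \<times> 'a \<Rightarrow> real"
  assumes \<mu>: "prob_space \<mu>" and f: "f \<in> borel_measurable (coin \<Otimes>\<^sub>M \<mu>)"
    and B: "\<And>s x. x \<in> space \<mu> \<Longrightarrow> \<bar>f (s, x)\<bar> \<le> B"
  shows "(\<integral>z. f z \<partial>(coin \<Otimes>\<^sub>M \<mu>)) = (\<integral>x. (f (1, x) + f (-1, x)) / 2 \<partial>\<mu>)"
proof -
  interpret \<mu>: prob_space \<mu> by fact
  interpret c: prob_space coin by (rule prob_space_coin)
  interpret P: pair_prob_space coin \<mu> ..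
  have int: "integrable (coin \<Otimes>\<^sub>M \<mu>) f"
    using f B by (intro P.P.integrable_bounded[of _ B]) (auto simp: space_pair_measure)
  have "(\<integral>z. f z \<partial>(coin \<Otimes>\<^sub>M \<mu>)) = (\<integral>s. \<integral>x. f (s, x) \<partial>\<mu> \<partial>coin)"
    using P.integral_fst'[OF int] by simp
  also have "\<dots> = ((\<integral>x. f (1, x) \<partial>\<mu>) + (\<integral>x. f (-1, x) \<partial>\<mu>)) / 2"
    by (rule integral_coin)
  also have "\<dots> = (\<integral>x. (f (1, x) + f (-1, x)) / 2 \<partial>\<mu>)"
  proof -
    have "integrable \<mu> (\<lambda>x. f (s, x))" for s
      using measurable_Pair2[OF f, of s] B by (intro \<mu>.integrable_bounded[of _ B]) simp_all
    then show ?thesis by simp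
  qed
  finally show ?thesis .
qed

text \<open>Integrating out one coordinate at a time turns an inequality between single steps that is
  uniform in the offset \<open>A\<close> into one between sums: the offset absorbs the other coordinates.\<close>

lemma iid_fmax_comparison:
  fixes U :: "'i \<Rightarrow> 'a \<Rightarrow> real" and V :: "'i \<Rightarrow> 'b \<Rightarrow> real" and n :: nat
  assumes M: "prob_space M" and N: "prob_space N" and I: "finite I" "I \<noteq> {}"
    and U: "\<And>i. i \<in> I \<Longrightarrow> U i \<in> borel_measurable M" "\<And>i x. i \<in> I \<Longrightarrow> x \<in> space M \<Longrightarrow> \<bar>U i x\<bar> \<le> B"
    and V: "\<And>i. i \<in> I \<Longrightarrow> V i \<in> borel_measurable N" "\<And>i x. i \<in> I \<Longrightarrow> x \<in> space N \<Longrightarrow> \<bar>V i x\<bar> \<le> B"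
    and step: "\<And>A. (\<integral>x. fmax I (\<lambda>i. A i + U i x) \<partial>M) \<le> (\<integral>y. fmax I (\<lambda>i. A i + V i y) \<partial>N)"
  shows "(\<integral>x. fmax I (\<lambda>i. A i + (\<Sum>j<n. U i (x j))) \<partial>Pi\<^sub>M {..<n} (\<lambda>_. M))
       \<le> (\<integral>y. fmax I (\<lambda>i. A i + (\<Sum>j<n. V i (y j))) \<partial>Pi\<^sub>M {..<n} (\<lambda>_. N))"
proof (induction n arbitrary: A)
  case 0
  interpret M: prob_space M by fact
  interpret N: prob_space N by fact
  interpret PM: product_prob_space "\<lambda>_. M" UNIV ..
  interpret PN: product_prob_space "\<lambda>_. N" UNIV ..
  show ?case by (simp add: PiM_empty lebesgue_integral_count_space_finite)
next
  case (Suc n)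
  interpret M: prob_space M by fact
  interpret N: prob_space N by fact
  interpret PM: product_prob_space "\<lambda>_. M" UNIV ..
  interpret PN: product_prob_space "\<lambda>_. N" UNIV ..
  let ?M = "Pi\<^sub>M {..<n} (\<lambda>_. M)" and ?N = "Pi\<^sub>M {..<n} (\<lambda>_. N)"
  interpret Mn: prob_space ?M by (intro prob_space_PiM M)
  interpret Nn: prob_space ?N by (intro prob_space_PiM N)
  interpret MS: prob_space "Pi\<^sub>M (insert n {..<n}) (\<lambda>_. M)" by (intro prob_space_PiM M)
  interpret NS: prob_space "Pi\<^sub>M (insert n {..<n}) (\<lambda>_. N)" by (intro prob_space_PiM N)
  interpret NM: pair_prob_space N ?M ..
  obtain C0 where C0: "\<And>i. i \<in> I \<Longrightarrow> \<bar>A i\<bar> \<le> C0"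
    using that[of "fmax I (\<lambda>i. \<bar>A i\<bar>)"] fmax_ge[OF I(1), of _ "\<lambda>i. \<bar>A i\<bar>"] by simp
  define C where "C = C0 + real (Suc n) * B"
  have Usum: "\<bar>\<Sum>j<m. U i (x j)\<bar> \<le> real m * B" if "i \<in> I" "\<And>j. j < m \<Longrightarrow> x j \<in> space M" for i m x
    by (intro abs_sum_lessThan_le U(2) that)
  have Vsum: "\<bar>\<Sum>j<m. V i (x j)\<bar> \<le> real m * B" if "i \<in> I" "\<And>j. j < m \<Longrightarrow> x j \<in> space N" for i m x
    by (intro abs_sum_lessThan_le V(2) that)
  have Suc_eq: "{..<Suc n} = insert n {..<n}" by auto
  have mU: "(\<lambda>x. U i (x j)) \<in> borel_measurable (Pi\<^sub>M J (\<lambda>_. M))" if "i \<in> I" "j \<in> J" for i j J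
    using measurable_compose[OF measurable_component_singleton[OF that(2)] U(1)[OF that(1)]] .
  have mV: "(\<lambda>x. V i (x j)) \<in> borel_measurable (Pi\<^sub>M J (\<lambda>_. N))" if "i \<in> I" "j \<in> J" for i j J
    using measurable_compose[OF measurable_component_singleton[OF that(2)] V(1)[OF that(1)]] .
  have intS: "integrable (Pi\<^sub>M (insert n {..<n}) (\<lambda>_. M)) (\<lambda>x. fmax I (\<lambda>i. A i + (\<Sum>j<Suc n. U i (x j))))"
  proof (rule MS.integrable_bounded[of _ C])
    show "(\<lambda>x. fmax I (\<lambda>i. A i + (\<Sum>j<Suc n. U i (x j)))) \<in> borel_measurable (Pi\<^sub>M (insert n {..<n}) (\<lambda>_. M))"
      using I by (intro borel_measurable_Max borel_measurable_add borel_measurable_sum mU) auto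
    fix x assume x: "x \<in> space (Pi\<^sub>M (insert n {..<n}) (\<lambda>_. M))"
    then have "x j \<in> space M" if "j < Suc n" for j
      using that by (auto simp: space_PiM PiE_iff less_Suc_eq)
    then show "\<bar>fmax I (\<lambda>i. A i + (\<Sum>j<Suc n. U i (x j)))\<bar> \<le> C"
      using I C0 Usum unfolding C_def
      by (intro abs_fmax_le order_trans[OF abs_triangle_ineq] add_mono) blast+
  qed
  have intT: "integrable (Pi\<^sub>M (insert n {..<n}) (\<lambda>_. N)) (\<lambda>x. fmax I (\<lambda>i. A i + (\<Sum>j<Suc n. V i (x j))))"
  proof (rule NS.integrable_bounded[of _ C])
    show "(\<lambda>x. fmax I (\<lambda>i. A i + (\<Sum>j<Suc n. V i (x j)))) \<in> borel_measurable (Pi\<^sub>M (insert n {..<n}) (\<lambda>_. N))"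
      using I by (intro borel_measurable_Max borel_measurable_add borel_measurable_sum mV) auto
    fix x assume x: "x \<in> space (Pi\<^sub>M (insert n {..<n}) (\<lambda>_. N))"
    then have "x j \<in> space N" if "j < Suc n" for j
      using that by (auto simp: space_PiM PiE_iff less_Suc_eq)
    then show "\<bar>fmax I (\<lambda>i. A i + (\<Sum>j<Suc n. V i (x j)))\<bar> \<le> C"
      using I C0 Vsum unfolding C_def
      by (intro abs_fmax_le order_trans[OF abs_triangle_ineq] add_mono) blast+
  qed
  define W where "W y x = fmax I (\<lambda>i. (A i + V i y) + (\<Sum>j<n. U i (x j)))" for y x
  have W_alt: "W y x = fmax I (\<lambda>i. (A i + (\<Sum>j<n. U i (x j))) + V i y)" for y x
    unfolding W_def by (intro arg_cong[where f = Max] image_cong refl) simp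
  have updU: "(\<Sum>j<Suc n. U i ((x(n := y)) j)) = (\<Sum>j<n. U i (x j)) + U i y" for i x y
    by simp
  have updV: "(\<Sum>j<Suc n. V i ((x(n := y)) j)) = V i y + (\<Sum>j<n. V i (x j))" for i x y
    by simp
  have mW: "(\<lambda>(y, x). W y x) \<in> borel_measurable (N \<Otimes>\<^sub>M ?M)"
    unfolding W_def split_beta'
    using I by (intro borel_measurable_Max borel_measurable_add borel_measurable_sum
        measurable_compose[OF measurable_fst V(1)] measurable_compose[OF measurable_snd mU]) auto
  have bW: "\<bar>W y x\<bar> \<le> C" if "y \<in> space N" "x \<in> space ?M" for y x
  proof -
    have x: "x j \<in> space M" if "j < n" for j using \<open>x \<in> space ?M\<close> that by (auto simp: space_PiM PiE_iff)
    have "\<bar>(A i + V i y) + (\<Sum>j<n. U i (x j))\<bar> \<le> C" if i: "i \<in> I" for i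
      using C0[OF i] V(2)[OF i \<open>y \<in> space N\<close>] Usum[OF i, of n x, OF x] unfolding C_def of_nat_Suc distrib_right mult_1
      by linarith
    then show ?thesis unfolding W_def using I by (intro abs_fmax_le) auto
  qed
  have intW: "integrable (N \<Otimes>\<^sub>M ?M) (\<lambda>(y, x). W y x)"
    using mW bW by (intro NM.P.integrable_bounded[of _ C]) (auto simp: space_pair_measure)
  have "(\<integral>x. fmax I (\<lambda>i. A i + (\<Sum>j<Suc n. U i (x j))) \<partial>Pi\<^sub>M {..<Suc n} (\<lambda>_. M))
      = (\<integral>x. \<integral>y. fmax I (\<lambda>i. A i + (\<Sum>j<Suc n. U i ((x(n := y)) j))) \<partial>M \<partial>?M)"
    using intS unfolding Suc_eq by (intro PM.product_integral_insert) (rule finite_lessThan, simp, assumption)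
  also have "\<dots> = (\<integral>x. \<integral>y. fmax I (\<lambda>i. (A i + (\<Sum>j<n. U i (x j))) + U i y) \<partial>M \<partial>?M)"
    by (simp only: updU add.assoc)
  also have "\<dots> \<le> (\<integral>x. \<integral>y. W y x \<partial>N \<partial>?M)"
  proof (rule integral_mono)
    show "integrable ?M (\<lambda>x. \<integral>y. W y x \<partial>N)"
      using NM.integrable_snd[OF intW] by simp
    have "(\<lambda>(x, y). fmax I (\<lambda>i. (A i + (\<Sum>j<n. U i (x j))) + U i y)) \<in> borel_measurable (?M \<Otimes>\<^sub>M M)"
      unfolding split_beta'
      using I by (intro borel_measurable_Max borel_measurable_add borel_measurable_sum
          measurable_compose[OF measurable_snd U(1)] measurable_compose[OF measurable_fst mU]) auto
    moreover have "\<bar>fmax I (\<lambda>i. (A i + (\<Sum>j<n. U i (x j))) + U i y)\<bar> \<le> C"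
      if "y \<in> space M" "x \<in> space ?M" for y x
    proof -
      have x: "x j \<in> space M" if "j < n" for j using \<open>x \<in> space ?M\<close> that by (auto simp: space_PiM PiE_iff)
      have "\<bar>(A i + (\<Sum>j<n. U i (x j))) + U i y\<bar> \<le> C" if i: "i \<in> I" for i
        using C0[OF i] U(2)[OF i \<open>y \<in> space M\<close>] Usum[OF i, of n x, OF x] unfolding C_def of_nat_Suc distrib_right mult_1
        by linarith
      then show ?thesis using I by (intro abs_fmax_le) auto
    qed
    ultimately show "integrable ?M (\<lambda>x. \<integral>y. fmax I (\<lambda>i. (A i + (\<Sum>j<n. U i (x j))) + U i y) \<partial>M)"
      by (rule integrable_inner_integral[OF Mn.prob_space_axioms M])
    show "(\<integral>y. fmax I (\<lambda>i. (A i + (\<Sum>j<n. U i (x j))) + U i y) \<partial>M) \<le> (\<integral>y. W y x \<partial>N)" for x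
      using step[of "\<lambda>i. A i + (\<Sum>j<n. U i (x j))"] unfolding W_alt .
  qed
  also have "\<dots> = (\<integral>y. \<integral>x. W y x \<partial>?M \<partial>N)"
    using NM.Fubini_integral[OF intW] by simp
  also have "\<dots> \<le> (\<integral>y. \<integral>x. fmax I (\<lambda>i. (A i + V i y) + (\<Sum>j<n. V i (x j))) \<partial>?N \<partial>N)"
  proof (rule integral_mono)
    show "integrable N (\<lambda>y. \<integral>x. W y x \<partial>?M)" using NM.integrable_fst[OF intW] by simp
    have "(\<lambda>(y, x). fmax I (\<lambda>i. (A i + V i y) + (\<Sum>j<n. V i (x j)))) \<in> borel_measurable (N \<Otimes>\<^sub>M ?N)"
      unfolding split_beta'
      using I by (intro borel_measurable_Max borel_measurable_add borel_measurable_sum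
          measurable_compose[OF measurable_fst V(1)] measurable_compose[OF measurable_snd mV]) auto
    moreover have "\<bar>fmax I (\<lambda>i. (A i + V i y) + (\<Sum>j<n. V i (x j)))\<bar> \<le> C"
      if "x \<in> space ?N" "y \<in> space N" for y x
    proof -
      have x: "x j \<in> space N" if "j < n" for j using \<open>x \<in> space ?N\<close> that by (auto simp: space_PiM PiE_iff)
      have "\<bar>(A i + V i y) + (\<Sum>j<n. V i (x j))\<bar> \<le> C" if i: "i \<in> I" for i
        using C0[OF i] V(2)[OF i \<open>y \<in> space N\<close>] Vsum[OF i, of n x, OF x] unfolding C_def of_nat_Suc distrib_right mult_1
        by linarith
      then show ?thesis using I by (intro abs_fmax_le) auto
    qed
    ultimately show "integrable N (\<lambda>y. \<integral>x. fmax I (\<lambda>i. (A i + V i y) + (\<Sum>j<n. V i (x j))) \<partial>?N)"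
      by (rule integrable_inner_integral[OF N Nn.prob_space_axioms])
    show "(\<integral>x. W y x \<partial>?M) \<le> (\<integral>x. fmax I (\<lambda>i. (A i + V i y) + (\<Sum>j<n. V i (x j))) \<partial>?N)" for y
      unfolding W_def by (rule Suc.IH)
  qed
  also have "\<dots> = (\<integral>x. \<integral>y. fmax I (\<lambda>i. (A i + V i y) + (\<Sum>j<n. V i (x j))) \<partial>N \<partial>?N)"
  proof -
    interpret NN: pair_prob_space N ?N ..
    have "integrable (N \<Otimes>\<^sub>M ?N) (\<lambda>(y, x). fmax I (\<lambda>i. (A i + V i y) + (\<Sum>j<n. V i (x j))))"
    proof (rule NN.P.integrable_bounded[of _ C])
      show "(\<lambda>(y, x). fmax I (\<lambda>i. (A i + V i y) + (\<Sum>j<n. V i (x j)))) \<in> borel_measurable (N \<Otimes>\<^sub>M ?N)"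
        unfolding split_beta'
        using I by (intro borel_measurable_Max borel_measurable_add borel_measurable_sum
            measurable_compose[OF measurable_fst V(1)] measurable_compose[OF measurable_snd mV]) auto
      fix z assume z: "z \<in> space (N \<Otimes>\<^sub>M ?N)"
      then have y: "fst z \<in> space N" by (auto simp: space_pair_measure)
      from z have "snd z \<in> space ?N" by (auto simp: space_pair_measure)
      then have x: "snd z j \<in> space N" if "j < n" for j
        using that by (auto simp: space_PiM PiE_iff)
      have "\<bar>(A i + V i (fst z)) + (\<Sum>j<n. V i (snd z j))\<bar> \<le> C" if i: "i \<in> I" for i
        using C0[OF i] V(2)[OF i y] Vsum[OF i, of n "snd z", OF x] unfolding C_def of_nat_Suc distrib_right mult_1
        by linarith
      then show "\<bar>case z of (y, x) \<Rightarrow> fmax I (\<lambda>i. (A i + V i y) + (\<Sum>j<n. V i (x j)))\<bar> \<le> C"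
        unfolding split_beta' using I by (intro abs_fmax_le) auto
    qed
    from NN.Fubini_integral[OF this] show ?thesis by simp
  qed
  also have "\<dots> = (\<integral>x. \<integral>y. fmax I (\<lambda>i. A i + (\<Sum>j<Suc n. V i ((x(n := y)) j))) \<partial>N \<partial>?N)"
    by (simp only: updV add.assoc)
  also have "\<dots> = (\<integral>x. fmax I (\<lambda>i. A i + (\<Sum>j<Suc n. V i (x j))) \<partial>Pi\<^sub>M {..<Suc n} (\<lambda>_. N))"
    using intT unfolding Suc_eq by (intro PN.product_integral_insert[symmetric]) (rule finite_lessThan, simp, assumption)
  finally show ?case .
qed

text \<open>Half of the offset is kept with the sample point and half with the mean, for which the maximum of
  expectations is at most the expectation of the maximum. The two halves are then the two values of
  a random sign, so that a single sample is enough.\<close>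

lemma symmetrisation_step:
  fixes f :: "'i \<Rightarrow> 'a \<Rightarrow> real"
  assumes \<mu>: "prob_space \<mu>" and I: "finite I" "I \<noteq> {}"
    and f: "\<And>i. i \<in> I \<Longrightarrow> f i \<in> borel_measurable \<mu>" "\<And>i x. i \<in> I \<Longrightarrow> x \<in> space \<mu> \<Longrightarrow> \<bar>f i x\<bar> \<le> B"
  shows "(\<integral>x. fmax I (\<lambda>i. A i + (f i x - (\<integral>y. f i y \<partial>\<mu>))) \<partial>\<mu>)
       \<le> (\<integral>z. fmax I (\<lambda>i. A i + 2 * (sgn (fst z) * f i (snd z))) \<partial>(coin \<Otimes>\<^sub>M \<mu>))"
proof -
  interpret \<mu>: prob_space \<mu> by fact
  define m where "m i = (\<integral>y. f i y \<partial>\<mu>)" for i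
  obtain C where C: "\<And>i. i \<in> I \<Longrightarrow> \<bar>A i\<bar> \<le> C"
    using that[of "fmax I (\<lambda>i. \<bar>A i\<bar>)"] fmax_ge[OF I(1), of _ "\<lambda>i. \<bar>A i\<bar>"] by simp
  have m: "\<bar>m i\<bar> \<le> B" if "i \<in> I" for i
    unfolding m_def using f that by (intro \<mu>.abs_expectation_le) auto
  have int: "integrable \<mu> (\<lambda>x. fmax I (\<lambda>i. A i + c * f i x))" for c
  proof (rule \<mu>.integrable_bounded[of _ "C + \<bar>c\<bar> * B"])
    show "(\<lambda>x. fmax I (\<lambda>i. A i + c * f i x)) \<in> borel_measurable \<mu>"
      using I f by (intro borel_measurable_Max borel_measurable_add borel_measurable_times) auto
    fix x assume x: "x \<in> space \<mu>"
    have "\<bar>A i + c * f i x\<bar> \<le> C + \<bar>c\<bar> * B" if "i \<in> I" for i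
      using C[OF that] mult_left_mono[OF f(2)[OF that x], of "\<bar>c\<bar>"]
      by (intro order_trans[OF abs_triangle_ineq] add_mono) (auto simp: abs_mult)
    then show "\<bar>fmax I (\<lambda>i. A i + c * f i x)\<bar> \<le> C + \<bar>c\<bar> * B"
      using I by (intro abs_fmax_le) auto
  qed
  have "(\<integral>x. fmax I (\<lambda>i. A i + (f i x - m i)) \<partial>\<mu>)
      \<le> (\<integral>x. (fmax I (\<lambda>i. A i + 2 * f i x) + fmax I (\<lambda>i. A i + (-2) * m i)) / 2 \<partial>\<mu>)"
  proof (rule integral_mono)
    show "integrable \<mu> (\<lambda>x. fmax I (\<lambda>i. A i + (f i x - m i)))"
    proof (rule \<mu>.integrable_bounded[of _ "C + (B + B)"])
      show "(\<lambda>x. fmax I (\<lambda>i. A i + (f i x - m i))) \<in> borel_measurable \<mu>"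
        using I f by (intro borel_measurable_Max borel_measurable_add borel_measurable_diff) auto
      fix x assume x: "x \<in> space \<mu>"
      have "\<bar>A i + (f i x - m i)\<bar> \<le> C + (B + B)" if "i \<in> I" for i
        using C[OF that] f(2)[OF that x] m[OF that] by linarith
      then show "\<bar>fmax I (\<lambda>i. A i + (f i x - m i))\<bar> \<le> C + (B + B)"
        using I by (intro abs_fmax_le) auto
    qed
    show "integrable \<mu> (\<lambda>x. (fmax I (\<lambda>i. A i + 2 * f i x) + fmax I (\<lambda>i. A i + (-2) * m i)) / 2)"
      using int[of 2] by simp
    fix x assume "x \<in> space \<mu>"
    show "fmax I (\<lambda>i. A i + (f i x - m i))
        \<le> (fmax I (\<lambda>i. A i + 2 * f i x) + fmax I (\<lambda>i. A i + (-2) * m i)) / 2"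
      unfolding fmax_le_iff[OF I]
    proof
      fix i assume "i \<in> I"
      then show "A i + (f i x - m i)
          \<le> (fmax I (\<lambda>i. A i + 2 * f i x) + fmax I (\<lambda>i. A i + (-2) * m i)) / 2"
        using fmax_ge[OF I(1), of i "\<lambda>i. A i + 2 * f i x"] fmax_ge[OF I(1), of i "\<lambda>i. A i + (-2) * m i"]
        by (simp add: field_simps)
    qed
  qed
  also have "\<dots> = ((\<integral>x. fmax I (\<lambda>i. A i + 2 * f i x) \<partial>\<mu>) + fmax I (\<lambda>i. A i + (-2) * m i)) / 2"
    using int[of 2] by (simp add: \<mu>.prob_space)
  also have "\<dots> \<le> ((\<integral>x. fmax I (\<lambda>i. A i + 2 * f i x) \<partial>\<mu>) + (\<integral>x. fmax I (\<lambda>i. A i + (-2) * f i x) \<partial>\<mu>)) / 2"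
  proof -
    have "fmax I (\<lambda>i. A i + (\<integral>x. (-2) * f i x \<partial>\<mu>)) \<le> (\<integral>x. fmax I (\<lambda>i. A i + (-2) * f i x) \<partial>\<mu>)"
      using f by (intro \<mu>.fmax_expectation_le[OF I, of _ "2 * B"]) (auto simp: abs_mult)
    then show ?thesis by (simp add: m_def)
  qed
  also have "\<dots> = (\<integral>x. (fmax I (\<lambda>i. A i + 2 * f i x) + fmax I (\<lambda>i. A i + (-2) * f i x)) / 2 \<partial>\<mu>)"
    using int[of 2] int[of "-2"] by simp
  also have "\<dots> = (\<integral>z. fmax I (\<lambda>i. A i + 2 * (sgn (fst z) * f i (snd z))) \<partial>(coin \<Otimes>\<^sub>M \<mu>))"
  proof (subst integral_coin_pair[OF \<mu>, of _ "C + 2 * B"])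
    show "(\<lambda>z. fmax I (\<lambda>i. A i + 2 * (sgn (fst z) * f i (snd z)))) \<in> borel_measurable (coin \<Otimes>\<^sub>M \<mu>)"
      using I f(1) by (intro borel_measurable_Max borel_measurable_add borel_measurable_times
          measurable_compose[OF measurable_fst borel_measurable_coin] measurable_compose[OF measurable_snd f(1)]) auto
    fix s x assume x: "x \<in> space \<mu>"
    have "\<bar>A i + 2 * (sgn s * f i x)\<bar> \<le> C + 2 * B" if "i \<in> I" for i
      using C[OF that] f(2)[OF that x] by (auto simp: sgn_if)
    then show "\<bar>fmax I (\<lambda>i. A i + 2 * (sgn (fst (s, x)) * f i (snd (s, x))))\<bar> \<le> C + 2 * B"
      using I by (intro abs_fmax_le) auto
  qed simp
  finally show ?thesis by (simp add: m_def)
qed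

lemma contraction_step:
  fixes v u :: "'i \<Rightarrow> 'a \<Rightarrow> real"
  assumes \<mu>: "prob_space \<mu>" and I: "finite I" "I \<noteq> {}"
    and v: "\<And>i. i \<in> I \<Longrightarrow> v i \<in> borel_measurable \<mu>" "\<And>i x. i \<in> I \<Longrightarrow> x \<in> space \<mu> \<Longrightarrow> \<bar>v i x\<bar> \<le> B"
    and u: "\<And>i. i \<in> I \<Longrightarrow> u i \<in> borel_measurable \<mu>" "\<And>i x. i \<in> I \<Longrightarrow> x \<in> space \<mu> \<Longrightarrow> \<bar>u i x\<bar> \<le> B"
    and L: "\<And>i j x. i \<in> I \<Longrightarrow> j \<in> I \<Longrightarrow> x \<in> space \<mu> \<Longrightarrow> \<bar>v i x - v j x\<bar> \<le> \<bar>u i x - u j x\<bar>"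
  shows "(\<integral>z. fmax I (\<lambda>i. A i + sgn (fst z) * v i (snd z)) \<partial>(coin \<Otimes>\<^sub>M \<mu>))
       \<le> (\<integral>z. fmax I (\<lambda>i. A i + sgn (fst z) * u i (snd z)) \<partial>(coin \<Otimes>\<^sub>M \<mu>))"
proof -
  interpret \<mu>: prob_space \<mu> by fact
  obtain C where C: "\<And>i. i \<in> I \<Longrightarrow> \<bar>A i\<bar> \<le> C"
    using that[of "fmax I (\<lambda>i. \<bar>A i\<bar>)"] fmax_ge[OF I(1), of _ "\<lambda>i. \<bar>A i\<bar>"] by simp
  have *: "(\<integral>z. fmax I (\<lambda>i. A i + sgn (fst z) * w i (snd z)) \<partial>(coin \<Otimes>\<^sub>M \<mu>))
      = (\<integral>x. (fmax I (\<lambda>i. A i + w i x) + fmax I (\<lambda>i. A i - w i x)) / 2 \<partial>\<mu>)" (is ?eq)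
    "integrable \<mu> (\<lambda>x. (fmax I (\<lambda>i. A i + w i x) + fmax I (\<lambda>i. A i - w i x)) / 2)" (is ?int)
    if w: "\<And>i. i \<in> I \<Longrightarrow> w i \<in> borel_measurable \<mu>" "\<And>i x. i \<in> I \<Longrightarrow> x \<in> space \<mu> \<Longrightarrow> \<bar>w i x\<bar> \<le> B" for w
  proof -
    have bd: "\<bar>fmax I (\<lambda>i. A i + s * w i x)\<bar> \<le> C + B" if "x \<in> space \<mu>" "\<bar>s\<bar> \<le> 1" for s x
    proof -
      have "\<bar>A i + s * w i x\<bar> \<le> C + B" if "i \<in> I" for i
      proof -
        have "\<bar>s * w i x\<bar> \<le> 1 * \<bar>w i x\<bar>"
          unfolding abs_mult using \<open>\<bar>s\<bar> \<le> 1\<close> by (rule mult_right_mono) simp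
        with C[OF that] w(2)[OF that \<open>x \<in> space \<mu>\<close>] show ?thesis by linarith
      qed
      then show ?thesis using I by (intro abs_fmax_le) auto
    qed
    have "(\<integral>z. fmax I (\<lambda>i. A i + sgn (fst z) * w i (snd z)) \<partial>(coin \<Otimes>\<^sub>M \<mu>))
      = (\<integral>x. (fmax I (\<lambda>i. A i + 1 * w i x) + fmax I (\<lambda>i. A i + (-1) * w i x)) / 2 \<partial>\<mu>)"
    proof (subst integral_coin_pair[OF \<mu>, of _ "C + B"])
      show "(\<lambda>z. fmax I (\<lambda>i. A i + sgn (fst z) * w i (snd z))) \<in> borel_measurable (coin \<Otimes>\<^sub>M \<mu>)"
        using I w(1) by (intro borel_measurable_Max borel_measurable_add borel_measurable_times
            measurable_compose[OF measurable_fst borel_measurable_coin] measurable_compose[OF measurable_snd w(1)]) auto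
      show "\<bar>fmax I (\<lambda>i. A i + sgn (fst (s, x)) * w i (snd (s, x)))\<bar> \<le> C + B" if "x \<in> space \<mu>" for s x
        using bd[OF that, of "sgn s"] by (simp add: sgn_if)
    qed simp
    then show ?eq by simp
    have "integrable \<mu> (\<lambda>x. fmax I (\<lambda>i. A i + s * w i x))" if "\<bar>s\<bar> \<le> 1" for s
    proof (rule \<mu>.integrable_bounded[OF _ bd[OF _ that]])
      show "(\<lambda>x. fmax I (\<lambda>i. A i + s * w i x)) \<in> borel_measurable \<mu>"
        using I w(1) by (intro borel_measurable_Max borel_measurable_add borel_measurable_times) auto
    qed
    from this[of 1] this[of "-1"] show ?int by simp
  qed
  have eqs: "(\<integral>z. fmax I (\<lambda>i. A i + sgn (fst z) * v i (snd z)) \<partial>(coin \<Otimes>\<^sub>M \<mu>))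
      = (\<integral>x. (fmax I (\<lambda>i. A i + v i x) + fmax I (\<lambda>i. A i - v i x)) / 2 \<partial>\<mu>)"
    "(\<integral>z. fmax I (\<lambda>i. A i + sgn (fst z) * u i (snd z)) \<partial>(coin \<Otimes>\<^sub>M \<mu>))
      = (\<integral>x. (fmax I (\<lambda>i. A i + u i x) + fmax I (\<lambda>i. A i - u i x)) / 2 \<partial>\<mu>)"
    using v u by (intro *(1); blast)+
  show ?thesis unfolding eqs
  proof (rule integral_mono)
    show "integrable \<mu> (\<lambda>x. (fmax I (\<lambda>i. A i + v i x) + fmax I (\<lambda>i. A i - v i x)) / 2)"
      "integrable \<mu> (\<lambda>x. (fmax I (\<lambda>i. A i + u i x) + fmax I (\<lambda>i. A i - u i x)) / 2)"
      using v u by (intro *(2); blast)+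
    fix x assume x: "x \<in> space \<mu>"
    show "(fmax I (\<lambda>i. A i + v i x) + fmax I (\<lambda>i. A i - v i x)) / 2
        \<le> (fmax I (\<lambda>i. A i + u i x) + fmax I (\<lambda>i. A i - u i x)) / 2"
      using fmax_contraction[OF I, of "\<lambda>i. v i x" "\<lambda>i. u i x" A] L x by simp
  qed
qed

lemma iid_sum_second_moment:
  fixes v :: "'a \<Rightarrow> real" and n :: nat and B :: real
  assumes M: "prob_space M" and v: "v \<in> borel_measurable M" "\<And>x. x \<in> space M \<Longrightarrow> \<bar>v x\<bar> \<le> B"
    and mean: "(\<integral>x. v x \<partial>M) = 0"
  shows "(\<integral>x. (\<Sum>j<n. v (x j))\<^sup>2 \<partial>Pi\<^sub>M {..<n} (\<lambda>_. M)) \<le> n * B\<^sup>2"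
proof (induction n)
  case 0
  interpret M: prob_space M by fact
  interpret PM: product_prob_space "\<lambda>_. M" UNIV ..
  show ?case by (simp add: PiM_empty lebesgue_integral_count_space_finite)
next
  case (Suc n)
  interpret M: prob_space M by fact
  interpret PM: product_prob_space "\<lambda>_. M" UNIV ..
  let ?M = "Pi\<^sub>M {..<n} (\<lambda>_. M)"
  interpret Mn: prob_space ?M by (intro prob_space_PiM M)
  interpret MS: prob_space "Pi\<^sub>M (insert n {..<n}) (\<lambda>_. M)" by (intro prob_space_PiM M)
  have Suc_eq: "{..<Suc n} = insert n {..<n}" by auto
  have bd: "(\<Sum>j<m. v (x j))\<^sup>2 \<le> (real m * B)\<^sup>2" if "\<And>j. j < m \<Longrightarrow> x j \<in> space M" for m x
  proof -
    have "\<bar>\<Sum>j<m. v (x j)\<bar> \<le> real m * B"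
      by (intro abs_sum_lessThan_le v(2) that)
    from power_mono[OF this, of 2] show ?thesis by (simp only: power2_abs abs_ge_zero)
  qed
  have mv: "(\<lambda>x. v (x j)) \<in> borel_measurable (Pi\<^sub>M J (\<lambda>_. M))" if "j \<in> J" for j J
    using measurable_compose[OF measurable_component_singleton[OF that] v(1)] .
  have intS: "integrable (Pi\<^sub>M (insert n {..<n}) (\<lambda>_. M)) (\<lambda>x. (\<Sum>j<Suc n. v (x j))\<^sup>2)"
  proof (rule MS.integrable_bounded[of _ "(real (Suc n) * B)\<^sup>2"])
    show "(\<lambda>x. (\<Sum>j<Suc n. v (x j))\<^sup>2) \<in> borel_measurable (Pi\<^sub>M (insert n {..<n}) (\<lambda>_. M))"
      by (intro borel_measurable_power borel_measurable_sum mv) auto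
    fix x assume x: "x \<in> space (Pi\<^sub>M (insert n {..<n}) (\<lambda>_. M))"
    then have "x j \<in> space M" if "j < Suc n" for j
      using that by (auto simp: space_PiM PiE_iff less_Suc_eq)
    then show "\<bar>(\<Sum>j<Suc n. v (x j))\<^sup>2\<bar> \<le> (real (Suc n) * B)\<^sup>2"
      using bd[of "Suc n" x] by (simp only: abs_power2)
  qed
  have intn: "integrable ?M (\<lambda>x. (\<Sum>j<n. v (x j))\<^sup>2)"
  proof (rule Mn.integrable_bounded[of _ "(real n * B)\<^sup>2"])
    show "(\<lambda>x. (\<Sum>j<n. v (x j))\<^sup>2) \<in> borel_measurable ?M"
      by (intro borel_measurable_power borel_measurable_sum mv) auto
    fix x assume x: "x \<in> space ?M"
    then have "x j \<in> space M" if "j < n" for j using that by (auto simp: space_PiM PiE_iff)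
    then show "\<bar>(\<Sum>j<n. v (x j))\<^sup>2\<bar> \<le> (real n * B)\<^sup>2"
      using bd[of n x] by (simp only: abs_power2)
  qed
  have iv: "integrable M v" using v by (intro M.integrable_bounded[of _ B]) auto
  have v2: "(v x)\<^sup>2 \<le> B\<^sup>2" if "x \<in> space M" for x
    using power_mono[OF v(2)[OF that], of 2] by (simp only: power2_abs abs_ge_zero)
  have iv2: "integrable M (\<lambda>x. (v x)\<^sup>2)"
    using v(1) v2 by (intro M.integrable_bounded[of _ "B\<^sup>2"]) auto
  have upd: "(\<Sum>j<Suc n. v ((x(n := y)) j)) = (\<Sum>j<n. v (x j)) + v y" for x y
    by simp
  have "(\<integral>x. (\<Sum>j<Suc n. v (x j))\<^sup>2 \<partial>Pi\<^sub>M {..<Suc n} (\<lambda>_. M))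
      = (\<integral>x. \<integral>y. (\<Sum>j<Suc n. v ((x(n := y)) j))\<^sup>2 \<partial>M \<partial>?M)"
    using intS unfolding Suc_eq by (intro PM.product_integral_insert) (rule finite_lessThan, simp, assumption)
  also have "\<dots> = (\<integral>x. \<integral>y. (\<Sum>j<n. v (x j))\<^sup>2 + 2 * (\<Sum>j<n. v (x j)) * v y + (v y)\<^sup>2 \<partial>M \<partial>?M)"
    by (simp only: upd power2_sum ac_simps)
  also have "\<dots> = (\<integral>x. (\<Sum>j<n. v (x j))\<^sup>2 + (\<integral>y. (v y)\<^sup>2 \<partial>M) \<partial>?M)"
    using iv iv2 mean by (simp add: M.prob_space)
  also have "\<dots> = (\<integral>x. (\<Sum>j<n. v (x j))\<^sup>2 \<partial>?M) + (\<integral>y. (v y)\<^sup>2 \<partial>M)"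
    using intn by (simp add: Mn.prob_space)
  also have "\<dots> \<le> n * B\<^sup>2 + B\<^sup>2"
  proof (rule add_mono[OF Suc.IH])
    have "(\<integral>y. (v y)\<^sup>2 \<partial>M) \<le> (\<integral>y. B\<^sup>2 \<partial>M)"
      using iv2 v2 by (intro integral_mono) auto
    then show "(\<integral>y. (v y)\<^sup>2 \<partial>M) \<le> B\<^sup>2" by (simp add: M.prob_space)
  qed
  finally show ?case by (simp add: algebra_simps)
qed

lemma integral_fmax_mult:
  assumes "finite I" "I \<noteq> {}" "0 \<le> c"
  shows "(\<integral>x. fmax I (\<lambda>i. c * f i x) \<partial>M) = c * (\<integral>x. fmax I (\<lambda>i. f i x) \<partial>M)"
proof -
  have "fmax I (\<lambda>i. c * f i x) = c * fmax I (\<lambda>i. f i x)" for x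
  proof (rule antisym)
    show "fmax I (\<lambda>i. c * f i x) \<le> c * fmax I (\<lambda>i. f i x)"
      unfolding fmax_le_iff[OF assms(1,2)] using assms(1,3) by (auto intro!: mult_left_mono)
    obtain i where "i \<in> I" "fmax I (\<lambda>i. f i x) = f i x"
      using fmax_attained[OF assms(1,2), of "\<lambda>i. f i x"] by auto
    then show "c * fmax I (\<lambda>i. f i x) \<le> fmax I (\<lambda>i. c * f i x)"
      using fmax_ge[OF assms(1), of i "\<lambda>i. c * f i x"] by simp
  qed
  then show ?thesis by simp
qed

lemma rademacher_contraction:
  fixes u v :: "'i \<Rightarrow> 'a \<Rightarrow> real" and n :: nat and B L :: real
  assumes \<mu>: "prob_space \<mu>" and I: "finite I" "I \<noteq> {}" and L0: "0 \<le> L"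
    and v: "\<And>i. i \<in> I \<Longrightarrow> v i \<in> borel_measurable \<mu>" "\<And>i x. i \<in> I \<Longrightarrow> x \<in> space \<mu> \<Longrightarrow> \<bar>v i x\<bar> \<le> B"
    and u: "\<And>i. i \<in> I \<Longrightarrow> u i \<in> borel_measurable \<mu>" "\<And>i x. i \<in> I \<Longrightarrow> x \<in> space \<mu> \<Longrightarrow> \<bar>u i x\<bar> \<le> B"
    and L: "\<And>i j x. i \<in> I \<Longrightarrow> j \<in> I \<Longrightarrow> x \<in> space \<mu> \<Longrightarrow> \<bar>v i x - v j x\<bar> \<le> L * \<bar>u i x - u j x\<bar>"
  shows "(\<integral>y. fmax I (\<lambda>i. \<Sum>j<n. sgn (fst (y j)) * v i (snd (y j))) \<partial>Pi\<^sub>M {..<n} (\<lambda>_. coin \<Otimes>\<^sub>M \<mu>))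
       \<le> L * (\<integral>y. fmax I (\<lambda>i. \<Sum>j<n. sgn (fst (y j)) * u i (snd (y j))) \<partial>Pi\<^sub>M {..<n} (\<lambda>_. coin \<Otimes>\<^sub>M \<mu>))"
proof -
  define B' where "B' = max B (L * B)"
  have Lu: "\<bar>L * u i x\<bar> \<le> B'" if "i \<in> I" "x \<in> space \<mu>" for i x
    using mult_left_mono[OF u(2)[OF that] L0] L0 by (simp add: abs_mult B'_def)
  have v': "\<bar>v i x\<bar> \<le> B'" if "i \<in> I" "x \<in> space \<mu>" for i x
    using v(2)[OF that] by (simp add: B'_def)
  have meas: "(\<lambda>z. sgn (fst z) * w (snd z)) \<in> borel_measurable (coin \<Otimes>\<^sub>M \<mu>)"
    if "w \<in> borel_measurable \<mu>" for w
    by (intro borel_measurable_times measurable_compose[OF measurable_fst borel_measurable_coin]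
        measurable_compose[OF measurable_snd that])
  have bd: "\<bar>sgn s * t\<bar> \<le> B'" if "\<bar>t\<bar> \<le> B'" for s t :: real
    using that by (auto simp: sgn_if)
  have "(\<integral>y. fmax I (\<lambda>i. 0 + (\<Sum>j<n. (\<lambda>z. sgn (fst z) * v i (snd z)) (y j))) \<partial>Pi\<^sub>M {..<n} (\<lambda>_. coin \<Otimes>\<^sub>M \<mu>))
     \<le> (\<integral>y. fmax I (\<lambda>i. 0 + (\<Sum>j<n. (\<lambda>z. sgn (fst z) * (L * u i (snd z))) (y j))) \<partial>Pi\<^sub>M {..<n} (\<lambda>_. coin \<Otimes>\<^sub>M \<mu>))"
  proof (rule iid_fmax_comparison[OF prob_space_coin_pair[OF \<mu>] prob_space_coin_pair[OF \<mu>] I])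
    fix i assume i: "i \<in> I"
    show "(\<lambda>z. sgn (fst z) * v i (snd z)) \<in> borel_measurable (coin \<Otimes>\<^sub>M \<mu>)"
      by (intro meas v i)
    show "(\<lambda>z. sgn (fst z) * (L * u i (snd z))) \<in> borel_measurable (coin \<Otimes>\<^sub>M \<mu>)"
      by (intro meas borel_measurable_times borel_measurable_const u i)
    fix z assume "z \<in> space (coin \<Otimes>\<^sub>M \<mu>)"
    then have z: "snd z \<in> space \<mu>" by (auto simp: space_pair_measure)
    show "\<bar>sgn (fst z) * v i (snd z)\<bar> \<le> B'" by (intro bd v' i z)
    show "\<bar>sgn (fst z) * (L * u i (snd z))\<bar> \<le> B'" by (intro bd Lu i z)
  next
    fix A
    show "(\<integral>z. fmax I (\<lambda>i. A i + sgn (fst z) * v i (snd z)) \<partial>(coin \<Otimes>\<^sub>M \<mu>))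
        \<le> (\<integral>z. fmax I (\<lambda>i. A i + sgn (fst z) * (L * u i (snd z))) \<partial>(coin \<Otimes>\<^sub>M \<mu>))"
    proof (rule contraction_step[OF \<mu> I])
      fix i j x assume ij: "i \<in> I" "j \<in> I" "x \<in> space \<mu>"
      have "L * \<bar>u i x - u j x\<bar> = \<bar>L * u i x - L * u j x\<bar>"
        using L0 by (simp add: abs_mult right_diff_distrib[symmetric])
      then show "\<bar>v i x - v j x\<bar> \<le> \<bar>L * u i x - L * u j x\<bar>"
        using L[OF ij] by simp
    qed (use v(1) u(1) v' Lu in \<open>auto intro!: borel_measurable_times\<close>)
  qed
  also have "\<dots> = (\<integral>y. fmax I (\<lambda>i. L * (\<Sum>j<n. sgn (fst (y j)) * u i (snd (y j)))) \<partial>Pi\<^sub>M {..<n} (\<lambda>_. coin \<Otimes>\<^sub>M \<mu>))"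
    by (simp add: sum_distrib_left ac_simps)
  also have "\<dots> = L * (\<integral>y. fmax I (\<lambda>i. \<Sum>j<n. sgn (fst (y j)) * u i (snd (y j))) \<partial>Pi\<^sub>M {..<n} (\<lambda>_. coin \<Otimes>\<^sub>M \<mu>))"
    by (rule integral_fmax_mult[OF I L0])
  finally show ?thesis by simp
qed

text \<open>Symmetrisation costs the factor 2 and contraction the factor \<open>L\<close>; both are applied one coordinate
  at a time.\<close>

lemma expected_deviation_le:
  fixes g :: "'i \<Rightarrow> 'a \<Rightarrow> real" and n :: nat and B L :: real
  assumes \<mu>: "prob_space \<mu>" and I: "finite I" "I \<noteq> {}" and L0: "0 \<le> L"
    and g: "\<And>i. i \<in> I \<Longrightarrow> g i \<in> borel_measurable \<mu>" "\<And>i x. i \<in> I \<Longrightarrow> x \<in> space \<mu> \<Longrightarrow> \<bar>g i x\<bar> \<le> B"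
    and \<psi>: "\<psi> \<in> borel_measurable borel" "\<And>a b. \<bar>\<psi> a - \<psi> b\<bar> \<le> L * \<bar>a - b\<bar>"
  shows "(\<integral>x. fmax I (\<lambda>i. \<Sum>j<n. \<psi> (g i (x j)) - (\<integral>y. \<psi> (g i y) \<partial>\<mu>)) \<partial>Pi\<^sub>M {..<n} (\<lambda>_. \<mu>))
       \<le> 2 * L * (\<integral>y. fmax I (\<lambda>i. \<Sum>j<n. sgn (fst (y j)) * g i (snd (y j))) \<partial>Pi\<^sub>M {..<n} (\<lambda>_. coin \<Otimes>\<^sub>M \<mu>))"
proof -
  interpret \<mu>: prob_space \<mu> by fact
  define f where "f i x = \<psi> (g i x)" for i x
  define C where "C = \<bar>\<psi> 0\<bar> + L * B"
  have mf: "f i \<in> borel_measurable \<mu>" if "i \<in> I" for i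
    unfolding f_def using measurable_compose[OF g(1)[OF that] \<psi>(1)] .
  have bf: "\<bar>f i x\<bar> \<le> C" if "i \<in> I" "x \<in> space \<mu>" for i x
  proof -
    have "L * \<bar>g i x - 0\<bar> \<le> L * B" using g(2)[OF that] L0 by (intro mult_left_mono) auto
    then show ?thesis using \<psi>(2)[of "g i x" 0] unfolding f_def C_def by linarith
  qed
  have mean: "\<bar>\<integral>y. f i y \<partial>\<mu>\<bar> \<le> C" if "i \<in> I" for i
    using mf[OF that] bf[OF that] by (rule \<mu>.abs_expectation_le)
  have meas: "(\<lambda>z. sgn (fst z) * f i (snd z)) \<in> borel_measurable (coin \<Otimes>\<^sub>M \<mu>)" if "i \<in> I" for i
    by (intro borel_measurable_times measurable_compose[OF measurable_fst borel_measurable_coin]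
        measurable_compose[OF measurable_snd mf] that)
  have "(\<integral>x. fmax I (\<lambda>i. 0 + (\<Sum>j<n. (\<lambda>x. f i x - (\<integral>y. f i y \<partial>\<mu>)) (x j))) \<partial>Pi\<^sub>M {..<n} (\<lambda>_. \<mu>))
     \<le> (\<integral>y. fmax I (\<lambda>i. 0 + (\<Sum>j<n. (\<lambda>z. 2 * (sgn (fst z) * f i (snd z))) (y j))) \<partial>Pi\<^sub>M {..<n} (\<lambda>_. coin \<Otimes>\<^sub>M \<mu>))"
  proof (rule iid_fmax_comparison[OF \<mu> prob_space_coin_pair[OF \<mu>] I])
    fix i assume i: "i \<in> I"
    show "(\<lambda>x. f i x - (\<integral>y. f i y \<partial>\<mu>)) \<in> borel_measurable \<mu>" using mf[OF i] by simp
    show "(\<lambda>z. 2 * (sgn (fst z) * f i (snd z))) \<in> borel_measurable (coin \<Otimes>\<^sub>M \<mu>)"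
      by (intro borel_measurable_times borel_measurable_const meas i)
    show "\<bar>f i x - (\<integral>y. f i y \<partial>\<mu>)\<bar> \<le> 2 * C" if "x \<in> space \<mu>" for x
      using bf[OF i that] mean[OF i] by linarith
    show "\<bar>2 * (sgn (fst z) * f i (snd z))\<bar> \<le> 2 * C" if "z \<in> space (coin \<Otimes>\<^sub>M \<mu>)" for z
    proof -
      have "snd z \<in> space \<mu>" using that by (auto simp: space_pair_measure)
      from bf[OF i this] show ?thesis by (auto simp: sgn_if)
    qed
  next
    fix A
    show "(\<integral>x. fmax I (\<lambda>i. A i + (f i x - (\<integral>y. f i y \<partial>\<mu>))) \<partial>\<mu>)
      \<le> (\<integral>z. fmax I (\<lambda>i. A i + 2 * (sgn (fst z) * f i (snd z))) \<partial>(coin \<Otimes>\<^sub>M \<mu>))"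
      by (rule symmetrisation_step[OF \<mu> I mf bf])
  qed
  also have "\<dots> = (\<integral>y. fmax I (\<lambda>i. 2 * (\<Sum>j<n. sgn (fst (y j)) * f i (snd (y j)))) \<partial>Pi\<^sub>M {..<n} (\<lambda>_. coin \<Otimes>\<^sub>M \<mu>))"
    by (simp add: sum_distrib_left)
  also have "\<dots> = 2 * (\<integral>y. fmax I (\<lambda>i. \<Sum>j<n. sgn (fst (y j)) * f i (snd (y j))) \<partial>Pi\<^sub>M {..<n} (\<lambda>_. coin \<Otimes>\<^sub>M \<mu>))"
    by (rule integral_fmax_mult[OF I]) simp
  also have "\<dots> \<le> 2 * (L * (\<integral>y. fmax I (\<lambda>i. \<Sum>j<n. sgn (fst (y j)) * g i (snd (y j))) \<partial>Pi\<^sub>M {..<n} (\<lambda>_. coin \<Otimes>\<^sub>M \<mu>)))"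
  proof (intro mult_left_mono rademacher_contraction[OF \<mu> I L0, of _ "max B C"])
    fix i x assume ix: "i \<in> I" "x \<in> space \<mu>"
    show "\<bar>f i x\<bar> \<le> max B C" using bf[OF ix] by simp
    show "\<bar>g i x\<bar> \<le> max B C" using g(2)[OF ix] by simp
  next
    show "\<bar>f i x - f j x\<bar> \<le> L * \<bar>g i x - g j x\<bar>" for i j x
      unfolding f_def by (rule \<psi>(2))
  qed (use mf g in auto)
  finally show ?thesis by (simp add: f_def)
qed

text \<open>The second moment of the sum is at most \<open>n\<close>, and \<open>\<bar>z\<bar> \<le> z\<^sup>2 / (2 * s) + s / 2\<close> with \<open>s = sqrt n\<close> passes
  from the second to the first moment.\<close>

lemma expected_abs_iid_sum_le:
  fixes v :: "'a \<Rightarrow> real" and n :: nat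
  assumes M: "prob_space M" and v: "v \<in> borel_measurable M" "\<And>x. x \<in> space M \<Longrightarrow> \<bar>v x\<bar> \<le> 1"
    and mean: "(\<integral>x. v x \<partial>M) = 0" and n: "1 \<le> n"
  shows "(\<integral>x. \<bar>\<Sum>j<n. v (x j)\<bar> \<partial>Pi\<^sub>M {..<n} (\<lambda>_. M)) \<le> sqrt n"
    and "integrable (Pi\<^sub>M {..<n} (\<lambda>_. M)) (\<lambda>x. \<bar>\<Sum>j<n. v (x j)\<bar>)"
proof -
  let ?M = "Pi\<^sub>M {..<n} (\<lambda>_. M)"
  interpret Mn: prob_space ?M by (intro prob_space_PiM M)
  define s where "s = sqrt n"
  have s: "s > 0" "s\<^sup>2 = n" using n by (auto simp: s_def)
  have bd: "\<bar>\<Sum>j<n. v (x j)\<bar> \<le> real n" if "x \<in> space ?M" for x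
  proof -
    have "x j \<in> space M" if "j < n" for j using \<open>x \<in> space ?M\<close> that by (auto simp: space_PiM PiE_iff)
    then have "\<bar>\<Sum>j<n. v (x j)\<bar> \<le> real n * 1" by (intro abs_sum_lessThan_le v(2))
    then show ?thesis by simp
  qed
  have "(\<lambda>x. v (x j)) \<in> borel_measurable ?M" if "j \<in> {..<n}" for j
    using measurable_compose[OF measurable_component_singleton[OF that] v(1)] .
  then have m: "(\<lambda>x. \<Sum>j<n. v (x j)) \<in> borel_measurable ?M"
    by (rule borel_measurable_sum)
  show int: "integrable ?M (\<lambda>x. \<bar>\<Sum>j<n. v (x j)\<bar>)"
    using m bd by (intro Mn.integrable_bounded[of _ n] borel_measurable_abs) simp_all
  have int2: "integrable ?M (\<lambda>x. (\<Sum>j<n. v (x j))\<^sup>2)"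
  proof (rule Mn.integrable_bounded)
    show "(\<lambda>x. (\<Sum>j<n. v (x j))\<^sup>2) \<in> borel_measurable ?M" using m by (rule borel_measurable_power)
    show "\<bar>(\<Sum>j<n. v (x j))\<^sup>2\<bar> \<le> (real n)\<^sup>2" if "x \<in> space ?M" for x
      using power_mono[OF bd[OF that], of 2] by (simp only: power2_abs abs_power2 abs_ge_zero)
  qed
  have amgm: "\<bar>z\<bar> \<le> (1 / (2 * s)) * z\<^sup>2 + s / 2" for z
  proof -
    have "0 \<le> (\<bar>z\<bar> - s)\<^sup>2" by simp
    then have "2 * s * \<bar>z\<bar> \<le> z\<^sup>2 + s * s"
      unfolding power2_diff power2_abs by (simp add: power2_eq_square algebra_simps)
    then show ?thesis using s(1) by (simp add: field_simps power2_eq_square)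
  qed
  have "(\<integral>x. \<bar>\<Sum>j<n. v (x j)\<bar> \<partial>?M) \<le> (\<integral>x. (1 / (2 * s)) * (\<Sum>j<n. v (x j))\<^sup>2 + s / 2 \<partial>?M)"
    using int int2 amgm by (intro integral_mono) auto
  also have "\<dots> = (1 / (2 * s)) * (\<integral>x. (\<Sum>j<n. v (x j))\<^sup>2 \<partial>?M) + s / 2"
    using int2 by (simp add: Mn.prob_space)
  also have "\<dots> \<le> (1 / (2 * s)) * (n * 1\<^sup>2) + s / 2"
    using iid_sum_second_moment[OF M v mean, of n] s
    by (intro add_mono mult_left_mono) auto
  also have "\<dots> = s" using s by (simp add: power2_eq_square field_simps)
  finally show "(\<integral>x. \<bar>\<Sum>j<n. v (x j)\<bar> \<partial>?M) \<le> sqrt n" by (simp add: s_def)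
qed

section \<open>Networks on the cube\<close>

lemma cube_coord: "x \<in> cube d \<Longrightarrow> j < d \<Longrightarrow> 0 \<le> x j \<and> x j \<le> 1"
  by (auto simp: cube_def PiE_iff)

lemma abs_dot_le: "(\<And>j. j < d \<Longrightarrow> \<bar>x j\<bar> \<le> 1) \<Longrightarrow> \<bar>dot d w x\<bar> \<le> l1_norm d w"
  unfolding dot_def l1_norm_def
  by (intro order_trans[OF sum_abs] sum_mono) (auto simp: abs_mult intro: mult_left_le)

lemma abs_dot_cube_le: "x \<in> cube d \<Longrightarrow> \<bar>dot d w x\<bar> \<le> l1_norm d w"
  using cube_coord[of x d] by (intro abs_dot_le) auto

lemma l1_norm_nonneg: "0 \<le> l1_norm d w"
  by (simp add: l1_norm_def sum_nonneg)

lemma space_cube_borel: "space (cube_borel d) = cube d"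
proof -
  have "cube d \<subseteq> space (Rd d)" by (auto simp: cube_def Rd_def space_PiM PiE_iff)
  then show ?thesis by (auto simp: cube_borel_def space_restrict_space)
qed

lemma borel_measurable_coord_cube:
  assumes "sets \<mu> = sets (cube_borel d)" "j < d"
  shows "(\<lambda>x. x j) \<in> borel_measurable \<mu>"
proof -
  have "(\<lambda>x. x j) \<in> borel_measurable (Rd d)"
    unfolding Rd_def using assms(2) by (intro measurable_component_singleton) simp
  then have "(\<lambda>x. x j) \<in> borel_measurable (cube_borel d)"
    unfolding cube_borel_def by (rule measurable_restrict_space1)
  then show ?thesis using measurable_cong_sets[OF assms(1) refl] by blast
qed

lemma borel_measurable_dot_cube:
  "sets \<mu> = sets (cube_borel d) \<Longrightarrow> (\<lambda>x. dot d w x) \<in> borel_measurable \<mu>"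
  unfolding dot_def
  by (intro borel_measurable_sum borel_measurable_times borel_measurable_coord_cube) auto

definition net :: "nat \<Rightarrow> nat \<Rightarrow> (real \<Rightarrow> real) \<Rightarrow> (nat \<Rightarrow> real) \<Rightarrow> (nat \<Rightarrow> nat \<Rightarrow> real) \<Rightarrow>
    (nat \<Rightarrow> real) \<Rightarrow> (nat \<Rightarrow> real) \<Rightarrow> real \<Rightarrow> (nat \<Rightarrow> real) \<Rightarrow> real" where
  "net d k \<phi> \<beta> w b w0 b0 x = (\<Sum>i<k. \<beta> i * \<phi> (dot d (w i) x + b i)) + dot d w0 x + b0"

lemma nn_class_iff:
  "g \<in> nn_class d k a1 a2 a3 a4 \<phi> \<longleftrightarrow> (\<exists>\<beta> w b w0 b0.
     (\<forall>i<k. l1_norm d (w i) \<le> a1 \<and> \<bar>b i\<bar> \<le> a1 \<and> \<bar>\<beta> i\<bar> \<le> a2) \<and>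
     \<bar>b0\<bar> \<le> a3 \<and> l1_norm d w0 \<le> a4 \<and> g = net d k \<phi> \<beta> w b w0 b0)"
proof -
  have "net d k \<phi> \<beta> w b w0 b0 = (\<lambda>x. (\<Sum>i<k. \<beta> i * \<phi> (dot d (w i) x + b i)) + dot d w0 x + b0)"
    for \<beta> w b w0 b0 by (simp add: net_def fun_eq_iff)
  then show ?thesis unfolding nn_class_def by (simp add: conj_assoc)
qed

text \<open>Both activations qualify: the sigmoid has slope at most one quarter.\<close>

definition activation :: "(real \<Rightarrow> real) \<Rightarrow> bool" where
  "activation \<phi> \<longleftrightarrow> (\<forall>a b. \<bar>\<phi> a - \<phi> b\<bar> \<le> \<bar>a - b\<bar>) \<and> \<bar>\<phi> 0\<bar> \<le> 1"

lemma activation_relu: "activation relu"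
  by (auto simp: activation_def relu_def max_def)

lemma activation_borel: "activation \<phi> \<Longrightarrow> \<phi> \<in> borel_measurable borel"
proof -
  assume "activation \<phi>"
  then have "1-lipschitz_on UNIV \<phi>" by (auto simp: lipschitz_on_def activation_def dist_real_def)
  then show ?thesis by (intro borel_measurable_continuous_onI lipschitz_on_continuous_on)
qed

lemma activation_bound: "activation \<phi> \<Longrightarrow> \<bar>\<phi> z\<bar> \<le> 1 + \<bar>z\<bar>"
  unfolding activation_def by (metis (no_types) abs_minus_commute abs_triangle_ineq2 add.commute diff_0_right diff_le_eq order_trans add_mono le_diff_eq)

lemma net_measurable:
  assumes "activation \<phi>" "sets \<mu> = sets (cube_borel d)"
  shows "net d k \<phi> \<beta> w b w0 b0 \<in> borel_measurable \<mu>"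
  unfolding net_def
  by (intro borel_measurable_add borel_measurable_sum borel_measurable_times borel_measurable_const
      measurable_compose[OF _ activation_borel[OF assms(1)]] borel_measurable_dot_cube assms(2))

lemma nn_class_measurable:
  "activation \<phi> \<Longrightarrow> sets \<mu> = sets (cube_borel d) \<Longrightarrow> g \<in> nn_class d k a1 a2 a3 a4 \<phi> \<Longrightarrow> g \<in> borel_measurable \<mu>"
  by (auto simp: nn_class_iff net_measurable)

lemma nn_class_bound:
  assumes \<phi>: "activation \<phi>" and g: "g \<in> nn_class d k a1 a2 a3 a4 \<phi>" and x: "x \<in> cube d"
  shows "\<bar>g x\<bar> \<le> real k * (a2 * (1 + 2 * a1)) + a4 + a3"
proof -
  obtain \<beta> w b w0 b0 where
    h: "\<And>i. i < k \<Longrightarrow> l1_norm d (w i) \<le> a1 \<and> \<bar>b i\<bar> \<le> a1 \<and> \<bar>\<beta> i\<bar> \<le> a2"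
    "\<bar>b0\<bar> \<le> a3" "l1_norm d w0 \<le> a4" "g = net d k \<phi> \<beta> w b w0 b0"
    using g unfolding nn_class_iff by blast
  have "\<bar>\<Sum>i<k. \<beta> i * \<phi> (dot d (w i) x + b i)\<bar> \<le> real k * (a2 * (1 + 2 * a1))"
  proof (rule abs_sum_lessThan_le)
    fix i assume "i < k"
    have "\<bar>\<phi> (dot d (w i) x + b i)\<bar> \<le> 1 + 2 * a1"
      using activation_bound[OF \<phi>, of "dot d (w i) x + b i"] abs_dot_cube_le[OF x, of "w i"] h(1)[OF \<open>i < k\<close>]
      by linarith
    then show "\<bar>\<beta> i * \<phi> (dot d (w i) x + b i)\<bar> \<le> a2 * (1 + 2 * a1)"
      using h(1)[OF \<open>i < k\<close>] unfolding abs_mult by (intro mult_mono) auto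
  qed
  moreover have "\<bar>dot d w0 x\<bar> \<le> a4" using abs_dot_cube_le[OF x, of w0] h(3) by linarith
  ultimately show ?thesis using h(2) unfolding h(4) net_def by linarith
qed

subsection \<open>Rademacher complexity\<close>

text \<open>The signed sums of all affine functions on the cube are controlled by \<open>d + 1\<close> scalar sums.\<close>

definition affine_dev :: "nat \<Rightarrow> nat \<Rightarrow> (nat \<Rightarrow> real \<times> (nat \<Rightarrow> real)) \<Rightarrow> real" where
  "affine_dev d n y = (\<Sum>c<d. \<bar>\<Sum>j<n. sgn (fst (y j)) * snd (y j) c\<bar>) + \<bar>\<Sum>j<n. sgn (fst (y j))\<bar>"

lemma expected_affine_dev_le:
  assumes \<mu>: "prob_space \<mu>" and s: "sets \<mu> = sets (cube_borel d)" and n: "1 \<le> n"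
  shows "(\<integral>y. affine_dev d n y \<partial>Pi\<^sub>M {..<n} (\<lambda>_. coin \<Otimes>\<^sub>M \<mu>)) \<le> (real d + 1) * sqrt n"
    and "integrable (Pi\<^sub>M {..<n} (\<lambda>_. coin \<Otimes>\<^sub>M \<mu>)) (affine_dev d n)"
proof -
  let ?P = "coin \<Otimes>\<^sub>M \<mu>"
  interpret \<mu>: prob_space \<mu> by fact
  have P: "prob_space ?P" using \<mu> by (rule prob_space_coin_pair)
  have sp: "space \<mu> = cube d" using sets_eq_imp_space_eq[OF s] space_cube_borel by simp
  have *: "(\<lambda>z. sgn (fst z) * u (snd z)) \<in> borel_measurable ?P" (is ?m)
    "\<And>z. z \<in> space ?P \<Longrightarrow> \<bar>sgn (fst z) * u (snd z)\<bar> \<le> 1"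
    "(\<integral>z. sgn (fst z) * u (snd z) \<partial>?P) = 0"
    if u: "u \<in> borel_measurable \<mu>" "\<And>x. x \<in> space \<mu> \<Longrightarrow> \<bar>u x\<bar> \<le> 1" for u :: "(nat \<Rightarrow> real) \<Rightarrow> real"
  proof -
    show m: ?m
      by (intro borel_measurable_times measurable_compose[OF measurable_fst borel_measurable_coin]
          measurable_compose[OF measurable_snd u(1)])
    show "\<bar>sgn (fst z) * u (snd z)\<bar> \<le> 1" if "z \<in> space ?P" for z
    proof -
      have "snd z \<in> space \<mu>" using that by (auto simp: space_pair_measure)
      from u(2)[OF this] show ?thesis by (auto simp: sgn_if)
    qed
    have "(\<integral>z. sgn (fst z) * u (snd z) \<partial>?P) = (\<integral>x. (sgn (fst (1, x)) * u (snd (1::real, x)) + sgn (fst (-1, x)) * u (snd (-1::real, x))) / 2 \<partial>\<mu>)"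
      using u(2) by (intro integral_coin_pair[OF \<mu> m, of 1]) (auto simp: sgn_if)
    then show "(\<integral>z. sgn (fst z) * u (snd z) \<partial>?P) = 0" by simp
  qed
  have coord: "(\<lambda>x. x c) \<in> borel_measurable \<mu>" "\<And>x. x \<in> space \<mu> \<Longrightarrow> \<bar>x c\<bar> \<le> 1" if "c < d" for c
    using borel_measurable_coord_cube[OF s that] cube_coord[OF _ that] unfolding sp by auto
  have sums: "(\<integral>y. \<bar>\<Sum>j<n. sgn (fst (y j)) * u (snd (y j))\<bar> \<partial>Pi\<^sub>M {..<n} (\<lambda>_. ?P)) \<le> sqrt n"
    "integrable (Pi\<^sub>M {..<n} (\<lambda>_. ?P)) (\<lambda>y. \<bar>\<Sum>j<n. sgn (fst (y j)) * u (snd (y j))\<bar>)"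
    if u: "u \<in> borel_measurable \<mu>" "\<And>x. x \<in> space \<mu> \<Longrightarrow> \<bar>u x\<bar> \<le> 1" for u :: "(nat \<Rightarrow> real) \<Rightarrow> real"
    using expected_abs_iid_sum_le[OF P *(1)[of u] *(2)[of u] *(3)[of u] n] u by blast+
  have one: "(\<integral>y. \<bar>\<Sum>j<n. sgn (fst (y j)) * 1\<bar> \<partial>Pi\<^sub>M {..<n} (\<lambda>_. ?P)) \<le> sqrt n"
    "integrable (Pi\<^sub>M {..<n} (\<lambda>_. ?P)) (\<lambda>y. \<bar>\<Sum>j<n. sgn (fst (y j)) * 1\<bar>)"
    using sums[of "\<lambda>_. 1"] by simp_all
  have co: "(\<integral>y. \<bar>\<Sum>j<n. sgn (fst (y j)) * snd (y j) c\<bar> \<partial>Pi\<^sub>M {..<n} (\<lambda>_. ?P)) \<le> sqrt n"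
    "integrable (Pi\<^sub>M {..<n} (\<lambda>_. ?P)) (\<lambda>y. \<bar>\<Sum>j<n. sgn (fst (y j)) * snd (y j) c\<bar>)" if "c < d" for c
    using sums[of "\<lambda>x. x c"] coord[OF that] by blast+
  show "integrable (Pi\<^sub>M {..<n} (\<lambda>_. ?P)) (affine_dev d n)"
    unfolding affine_dev_def[abs_def] using one(2) co(2)
    by (intro Bochner_Integration.integrable_add Bochner_Integration.integrable_sum) auto
  have "(\<integral>y. affine_dev d n y \<partial>Pi\<^sub>M {..<n} (\<lambda>_. ?P))
      = (\<Sum>c<d. \<integral>y. \<bar>\<Sum>j<n. sgn (fst (y j)) * snd (y j) c\<bar> \<partial>Pi\<^sub>M {..<n} (\<lambda>_. ?P))
        + (\<integral>y. \<bar>\<Sum>j<n. sgn (fst (y j))\<bar> \<partial>Pi\<^sub>M {..<n} (\<lambda>_. ?P))"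
    unfolding affine_dev_def using one(2) co(2)
    by (subst Bochner_Integration.integral_add)
       (auto intro!: Bochner_Integration.integrable_sum simp: Bochner_Integration.integral_sum)
  also have "\<dots> \<le> (\<Sum>c<d. sqrt n) + sqrt n"
    using co(1) one(1) by (intro add_mono sum_mono) auto
  finally show "(\<integral>y. affine_dev d n y \<partial>Pi\<^sub>M {..<n} (\<lambda>_. ?P)) \<le> (real d + 1) * sqrt n"
    by (simp add: algebra_simps)
qed

lemma signed_affine_sum_le:
  assumes w: "l1_norm d w \<le> a" and b: "\<bar>b\<bar> \<le> a"
  shows "\<bar>\<Sum>j<n. sgn (fst (y j)) * (dot d w (snd (y j)) + b)\<bar> \<le> a * affine_dev d n y"
proof -
  let ?Z = "\<lambda>c. \<Sum>j<n. sgn (fst (y j)) * snd (y j) c"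
  have "(\<Sum>j<n. sgn (fst (y j)) * (dot d w (snd (y j)) + b)) = (\<Sum>j<n. sgn (fst (y j)) * dot d w (snd (y j))) + b * (\<Sum>j<n. sgn (fst (y j)))"
    by (simp add: distrib_left sum.distrib sum_distrib_left ac_simps)
  also have "(\<Sum>j<n. sgn (fst (y j)) * dot d w (snd (y j))) = (\<Sum>c<d. w c * ?Z c)"
    unfolding dot_def sum_distrib_left by (subst sum.swap) (simp add: ac_simps)
  finally have eq: "(\<Sum>j<n. sgn (fst (y j)) * (dot d w (snd (y j)) + b)) = (\<Sum>c<d. w c * ?Z c) + b * (\<Sum>j<n. sgn (fst (y j)))" .
  have "\<bar>\<Sum>c<d. w c * ?Z c\<bar> \<le> (\<Sum>c<d. a * \<bar>?Z c\<bar>)"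
  proof (intro order_trans[OF sum_abs] sum_mono)
    fix c assume "c \<in> {..<d}"
    then have "\<bar>w c\<bar> \<le> l1_norm d w" unfolding l1_norm_def by (intro member_le_sum) auto
    then show "\<bar>w c * ?Z c\<bar> \<le> a * \<bar>?Z c\<bar>"
      unfolding abs_mult using w by (intro mult_right_mono) auto
  qed
  moreover have "\<bar>b * (\<Sum>j<n. sgn (fst (y j)))\<bar> \<le> a * \<bar>\<Sum>j<n. sgn (fst (y j))\<bar>"
    unfolding abs_mult using b by (intro mult_right_mono) auto
  ultimately show ?thesis
    unfolding eq affine_dev_def by (simp add: distrib_left sum_distrib_left)
qed

text \<open>The rectifier is a contraction, so neurons are no more complex than the affine functions inside
  them. The zero neuron lets the absolute value be split into two one-sided maxima.\<close>

lemma expected_relu_dev_le: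
  fixes n :: nat and zero :: "nat \<Rightarrow> real"
  assumes \<mu>: "prob_space \<mu>" and s: "sets \<mu> = sets (cube_borel d)" and n: "1 \<le> n"
    and T: "finite T" "(zero, 0) \<in> T" "l1_norm d zero = 0"
    and T1: "\<And>w b. (w, b) \<in> T \<Longrightarrow> l1_norm d w \<le> 1 \<and> \<bar>b\<bar> \<le> 1"
  defines "R \<equiv> \<lambda>\<theta> x. relu (dot d (fst \<theta>) x + snd \<theta>)"
  shows "(\<integral>y. fmax T (\<lambda>\<theta>. \<bar>\<Sum>j<n. sgn (fst (y j)) * R \<theta> (snd (y j))\<bar>) \<partial>Pi\<^sub>M {..<n} (\<lambda>_. coin \<Otimes>\<^sub>M \<mu>))
         \<le> 2 * (real d + 1) * sqrt n"
    and "integrable (Pi\<^sub>M {..<n} (\<lambda>_. coin \<Otimes>\<^sub>M \<mu>)) (\<lambda>y. fmax T (\<lambda>\<theta>. \<bar>\<Sum>j<n. sgn (fst (y j)) * R \<theta> (snd (y j))\<bar>))"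
proof -
  let ?P = "coin \<Otimes>\<^sub>M \<mu>"
  let ?Pn = "Pi\<^sub>M {..<n} (\<lambda>_. ?P)"
  interpret P: prob_space ?P using \<mu> by (rule prob_space_coin_pair)
  interpret Pn: prob_space ?Pn by (intro prob_space_PiM P.prob_space_axioms)
  have T': "T \<noteq> {}" using T by auto
  have sp: "space \<mu> = cube d" using sets_eq_imp_space_eq[OF s] space_cube_borel by simp
  have proj: "snd (y j) \<in> space \<mu>" if y: "y \<in> space ?Pn" and "j < n" for y j
  proof -
    have "y j \<in> space ?P"
      using PiE_mem[of y "{..<n}" "\<lambda>_. space ?P" j] that by (simp add: space_PiM)
    then show ?thesis by (simp add: space_pair_measure mem_Times_iff)
  qed
  define A where "A \<theta> x = dot d (fst \<theta>) x + snd \<theta>" for \<theta> :: "(nat \<Rightarrow> real) \<times> real" and x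
  have mA: "A \<theta> \<in> borel_measurable \<mu>" for \<theta>
    unfolding A_def by (intro borel_measurable_add borel_measurable_const borel_measurable_dot_cube s)
  have mR: "R \<theta> \<in> borel_measurable \<mu>" for \<theta>
    unfolding R_def by (rule measurable_compose[OF mA[unfolded A_def] activation_borel[OF activation_relu]])
  have bA: "\<bar>A \<theta> x\<bar> \<le> 2" if "\<theta> \<in> T" "x \<in> space \<mu>" for \<theta> x
    using abs_dot_cube_le[of x d "fst \<theta>"] T1[of "fst \<theta>" "snd \<theta>"] that unfolding A_def sp by auto
  have bR: "\<bar>R \<theta> x\<bar> \<le> 2" if "\<theta> \<in> T" "x \<in> space \<mu>" for \<theta> x
    using bA[OF that] unfolding R_def A_def relu_def by auto
  define S where "S u \<theta> y = (\<Sum>j<n. sgn (fst (y j)) * u \<theta> (snd (y j)))"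
    for u :: "(nat \<Rightarrow> real) \<times> real \<Rightarrow> (nat \<Rightarrow> real) \<Rightarrow> real" and \<theta> and y :: "nat \<Rightarrow> real \<times> (nat \<Rightarrow> real)"
  have mS: "S u \<theta> \<in> borel_measurable ?Pn" if "u \<theta> \<in> borel_measurable \<mu>" for u \<theta>
  proof -
    have m0: "(\<lambda>z. sgn (fst z) * u \<theta> (snd z)) \<in> borel_measurable ?P"
      by (intro borel_measurable_times measurable_compose[OF measurable_fst borel_measurable_coin]
          measurable_compose[OF measurable_snd that])
    have "(\<lambda>y. sgn (fst (y j)) * u \<theta> (snd (y j))) \<in> borel_measurable ?Pn" if "j \<in> {..<n}" for j
      using measurable_compose[OF measurable_component_singleton[OF that, of "\<lambda>_. ?P"] m0] .
    then show ?thesis unfolding S_def by (rule borel_measurable_sum)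
  qed
  have bS: "\<bar>S u \<theta> y\<bar> \<le> real n * 2"
    if "\<And>x. x \<in> space \<mu> \<Longrightarrow> \<bar>u \<theta> x\<bar> \<le> 2" "y \<in> space ?Pn" for u \<theta> y
    unfolding S_def
  proof (rule abs_sum_lessThan_le)
    fix j assume "j < n"
    then have "snd (y j) \<in> space \<mu>" by (rule proj[OF that(2)])
    from that(1)[OF this] show "\<bar>sgn (fst (y j)) * u \<theta> (snd (y j))\<bar> \<le> 2" by (auto simp: sgn_if)
  qed
  have int: "integrable ?Pn (\<lambda>y. fmax T (\<lambda>\<theta>. h (S u \<theta> y)))"
    if "\<And>\<theta>. u \<theta> \<in> borel_measurable \<mu>" "\<And>\<theta> x. \<theta> \<in> T \<Longrightarrow> x \<in> space \<mu> \<Longrightarrow> \<bar>u \<theta> x\<bar> \<le> 2"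
      "h \<in> borel_measurable borel" "\<And>z. \<bar>h z\<bar> \<le> \<bar>z\<bar>" for u h
  proof (rule Pn.integrable_bounded[of _ "real n * 2"])
    show "(\<lambda>y. fmax T (\<lambda>\<theta>. h (S u \<theta> y))) \<in> borel_measurable ?Pn"
      by (intro borel_measurable_Max T(1) measurable_compose[OF mS that(3)] that(1))
    fix y assume y: "y \<in> space ?Pn"
    show "\<bar>fmax T (\<lambda>\<theta>. h (S u \<theta> y))\<bar> \<le> real n * 2"
      using order_trans[OF that(4) bS[of u _ y, OF that(2) y]] by (intro abs_fmax_le T(1) T') auto
  qed
  show I: "integrable ?Pn (\<lambda>y. fmax T (\<lambda>\<theta>. \<bar>\<Sum>j<n. sgn (fst (y j)) * R \<theta> (snd (y j))\<bar>))"
    using int[of R abs] mR bR unfolding S_def by simp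
  have E: "(\<integral>y. fmax T (\<lambda>\<theta>. S v \<theta> y) \<partial>?Pn) \<le> (real d + 1) * sqrt n"
    if v: "\<And>\<theta>. v \<theta> \<in> borel_measurable \<mu>" "\<And>\<theta> x. \<theta> \<in> T \<Longrightarrow> x \<in> space \<mu> \<Longrightarrow> \<bar>v \<theta> x\<bar> \<le> 2"
      "\<And>\<theta> \<theta>' x. \<bar>v \<theta> x - v \<theta>' x\<bar> \<le> \<bar>A \<theta> x - A \<theta>' x\<bar>" for v
  proof -
    have "(\<integral>y. fmax T (\<lambda>\<theta>. S v \<theta> y) \<partial>?Pn) \<le> 1 * (\<integral>y. fmax T (\<lambda>\<theta>. S A \<theta> y) \<partial>?Pn)"
      unfolding S_def
      by (rule rademacher_contraction[OF \<mu> T(1) T', of 1 v 2 A]) (use v mA bA in auto)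
    also have "\<dots> \<le> (\<integral>y. affine_dev d n y \<partial>?Pn)"
      unfolding mult_1
    proof (rule integral_mono)
      show "integrable ?Pn (\<lambda>y. fmax T (\<lambda>\<theta>. S A \<theta> y))" using int[of A "\<lambda>z. z"] mA bA by simp
      show "integrable ?Pn (affine_dev d n)" by (rule expected_affine_dev_le[OF \<mu> s n])
      show "fmax T (\<lambda>\<theta>. S A \<theta> y) \<le> affine_dev d n y" for y
        unfolding fmax_le_iff[OF T(1) T']
      proof
        fix \<theta> assume "\<theta> \<in> T"
        then have "l1_norm d (fst \<theta>) \<le> 1" "\<bar>snd \<theta>\<bar> \<le> 1" using T1[of "fst \<theta>" "snd \<theta>"] by auto
        from signed_affine_sum_le[OF this, where n = n and y = y] show "S A \<theta> y \<le> affine_dev d n y"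
          unfolding S_def A_def by linarith
      qed
    qed
    also have "\<dots> \<le> (real d + 1) * sqrt n" by (rule expected_affine_dev_le[OF \<mu> s n])
    finally show ?thesis .
  qed
  have relu_lip: "\<bar>R \<theta> x - R \<theta>' x\<bar> \<le> \<bar>A \<theta> x - A \<theta>' x\<bar>" for \<theta> \<theta>' x
    unfolding R_def A_def using activation_relu by (auto simp: activation_def)
  have zero: "R (zero, 0) x = 0" if "x \<in> space \<mu>" for x
    using abs_dot_cube_le[of x d zero] that T(3) unfolding sp R_def relu_def by auto
  have S0: "S R (zero, 0) y = 0" if "y \<in> space ?Pn" for y
  proof -
    have "snd (y j) \<in> space \<mu>" if "j < n" for j
      by (rule proj[OF \<open>y \<in> space ?Pn\<close> that])
    then show ?thesis unfolding S_def by (intro sum.neutral) (simp add: zero)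
  qed
  have neg: "- S R \<theta> y = S (\<lambda>\<theta> x. - R \<theta> x) \<theta> y" for \<theta> y
    by (simp add: S_def sum_negf)
  have i1: "integrable ?Pn (\<lambda>y. fmax T (\<lambda>\<theta>. S R \<theta> y))" using int[of R "\<lambda>z. z"] mR bR by simp
  have i2: "integrable ?Pn (\<lambda>y. fmax T (\<lambda>\<theta>. - S R \<theta> y))" using int[of R uminus] mR bR by simp
  have "(\<integral>y. fmax T (\<lambda>\<theta>. \<bar>S R \<theta> y\<bar>) \<partial>?Pn) \<le> (\<integral>y. fmax T (\<lambda>\<theta>. S R \<theta> y) + fmax T (\<lambda>\<theta>. - S R \<theta> y) \<partial>?Pn)"
  proof (rule integral_mono)
    show "integrable ?Pn (\<lambda>y. fmax T (\<lambda>\<theta>. \<bar>S R \<theta> y\<bar>))" using I unfolding S_def .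
    show "integrable ?Pn (\<lambda>y. fmax T (\<lambda>\<theta>. S R \<theta> y) + fmax T (\<lambda>\<theta>. - S R \<theta> y))" using i1 i2 by simp
    show "fmax T (\<lambda>\<theta>. \<bar>S R \<theta> y\<bar>) \<le> fmax T (\<lambda>\<theta>. S R \<theta> y) + fmax T (\<lambda>\<theta>. - S R \<theta> y)"
      if "y \<in> space ?Pn" for y
      using fmax_abs_le[OF T(1) T' T(2), of "\<lambda>\<theta>. S R \<theta> y"] S0[OF that] by simp
  qed
  also have "\<dots> = (\<integral>y. fmax T (\<lambda>\<theta>. S R \<theta> y) \<partial>?Pn) + (\<integral>y. fmax T (\<lambda>\<theta>. S (\<lambda>\<theta> x. - R \<theta> x) \<theta> y) \<partial>?Pn)"
    using i1 i2 unfolding neg by simp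
  also have "\<dots> \<le> (real d + 1) * sqrt n + (real d + 1) * sqrt n"
  proof (intro add_mono E)
    show "\<bar>- R \<theta> x - - R \<theta>' x\<bar> \<le> \<bar>A \<theta> x - A \<theta>' x\<bar>" for \<theta> \<theta>' x
      using relu_lip[of \<theta> x \<theta>'] by linarith
  qed (use mR bR relu_lip in auto)
  finally show "(\<integral>y. fmax T (\<lambda>\<theta>. \<bar>\<Sum>j<n. sgn (fst (y j)) * R \<theta> (snd (y j))\<bar>) \<partial>?Pn) \<le> 2 * (real d + 1) * sqrt n"
    unfolding S_def by (simp add: algebra_simps)
qed

lemma signed_net_sum_le:
  assumes \<beta>: "\<And>i. i < k \<Longrightarrow> \<bar>\<beta> i\<bar> \<le> 2 * a / real k" and w0: "l1_norm d w0 \<le> a" and b0: "\<bar>b0\<bar> \<le> a"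
    and K: "\<And>i. i < k \<Longrightarrow> \<bar>\<Sum>j<n. sgn (fst (y j)) * relu (dot d (w i) (snd (y j)) + b i)\<bar> \<le> K" and a: "0 \<le> a" "0 \<le> K"
  shows "\<bar>\<Sum>j<n. sgn (fst (y j)) * net d k relu \<beta> w b w0 b0 (snd (y j))\<bar> \<le> 2 * a * K + a * affine_dev d n y"
proof -
  let ?Z = "\<lambda>i. \<Sum>j<n. sgn (fst (y j)) * relu (dot d (w i) (snd (y j)) + b i)"
  have "(\<Sum>j<n. sgn (fst (y j)) * net d k relu \<beta> w b w0 b0 (snd (y j)))
     = (\<Sum>j<n. \<Sum>i<k. \<beta> i * (sgn (fst (y j)) * relu (dot d (w i) (snd (y j)) + b i)))
       + (\<Sum>j<n. sgn (fst (y j)) * (dot d w0 (snd (y j)) + b0))"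
    by (simp add: net_def distrib_left sum.distrib sum_distrib_left ac_simps)
  also have "(\<Sum>j<n. \<Sum>i<k. \<beta> i * (sgn (fst (y j)) * relu (dot d (w i) (snd (y j)) + b i))) = (\<Sum>i<k. \<beta> i * ?Z i)"
    by (subst sum.swap) (simp add: sum_distrib_left)
  finally have eq: "(\<Sum>j<n. sgn (fst (y j)) * net d k relu \<beta> w b w0 b0 (snd (y j)))
     = (\<Sum>i<k. \<beta> i * ?Z i) + (\<Sum>j<n. sgn (fst (y j)) * (dot d w0 (snd (y j)) + b0))" .
  have "\<bar>\<Sum>i<k. \<beta> i * ?Z i\<bar> \<le> real k * (2 * a / real k * K)"
  proof (rule abs_sum_lessThan_le)
    fix i assume "i < k"
    then show "\<bar>\<beta> i * ?Z i\<bar> \<le> 2 * a / real k * K"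
      unfolding abs_mult using \<beta>[of i] K[of i] a by (intro mult_mono) auto
  qed
  also have "\<dots> \<le> 2 * a * K" using a by (cases "k = 0") auto
  finally show ?thesis
    using signed_affine_sum_le[OF w0 b0, where n = n and y = y] unfolding eq by linarith
qed

text \<open>The outer weights sum to at most \<open>2 * a\<close>, so the signed sum of a network is at most \<open>2 * a\<close> times that
  of a single neuron, plus that of its affine part. This is why \<open>k\<close> does not enter.\<close>

lemma expected_net_rademacher_le:
  fixes n :: nat and G :: "((nat \<Rightarrow> real) \<Rightarrow> real) set"
  assumes \<mu>: "prob_space \<mu>" and s: "sets \<mu> = sets (cube_borel d)" and n: "1 \<le> n"
    and a: "0 \<le> a" and G: "finite G" "G \<noteq> {}" "G \<subseteq> nn_class d k 1 (2 * a / real k) a a relu"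
  shows "(\<integral>y. fmax G (\<lambda>g. \<Sum>j<n. sgn (fst (y j)) * g (snd (y j))) \<partial>Pi\<^sub>M {..<n} (\<lambda>_. coin \<Otimes>\<^sub>M \<mu>))
    \<le> 5 * a * (real d + 1) * sqrt n"
proof -
  let ?P = "coin \<Otimes>\<^sub>M \<mu>"
  let ?Pn = "Pi\<^sub>M {..<n} (\<lambda>_. ?P)"
  interpret P: prob_space ?P using \<mu> by (rule prob_space_coin_pair)
  interpret Pn: prob_space ?Pn by (intro prob_space_PiM P.prob_space_axioms)
  have sp: "space \<mu> = cube d" using sets_eq_imp_space_eq[OF s] space_cube_borel by simp
  have "\<exists>\<beta> w b w0 b0.
     (\<forall>i<k. l1_norm d (w i) \<le> 1 \<and> \<bar>b i\<bar> \<le> 1 \<and> \<bar>\<beta> i\<bar> \<le> 2 * a / real k) \<and>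
     \<bar>b0\<bar> \<le> a \<and> l1_norm d w0 \<le> a \<and> g = net d k relu \<beta> w b w0 b0" if "g \<in> G" for g
  proof -
    have "g \<in> nn_class d k 1 (2 * a / real k) a a relu" using G(3) that by blast
    then show ?thesis unfolding nn_class_iff .
  qed
  then obtain \<beta> w b w0 b0 where P:
     "\<And>g i. g \<in> G \<Longrightarrow> i < k \<Longrightarrow> l1_norm d (w g i) \<le> 1 \<and> \<bar>b g i\<bar> \<le> 1 \<and> \<bar>\<beta> g i\<bar> \<le> 2 * a / real k"
     "\<And>g. g \<in> G \<Longrightarrow> \<bar>b0 g\<bar> \<le> a \<and> l1_norm d (w0 g) \<le> a"
     "\<And>g. g \<in> G \<Longrightarrow> net d k relu (\<beta> g) (w g) (b g) (w0 g) (b0 g) = g"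
    by metis
  define T where "T = insert (\<lambda>_. 0, 0) (\<Union>g\<in>G. (\<lambda>i. (w g i, b g i)) ` {..<k})"
  have T: "finite T" "T \<noteq> {}" "(\<lambda>_. 0, 0) \<in> T" using G(1) by (auto simp: T_def)
  have z0: "l1_norm d (\<lambda>_. 0) = 0" by (simp add: l1_norm_def)
  have T1: "l1_norm d u \<le> 1 \<and> \<bar>c\<bar> \<le> 1" if "(u, c) \<in> T" for u c
    using that P(1) z0 by (auto simp: T_def)
  define K where "K y = fmax T (\<lambda>\<theta>. \<bar>\<Sum>j<n. sgn (fst (y j)) * relu (dot d (fst \<theta>) (snd (y j)) + snd \<theta>)\<bar>)"
    for y :: "nat \<Rightarrow> real \<times> (nat \<Rightarrow> real)"
  have K: "(\<integral>y. K y \<partial>?Pn) \<le> 2 * (real d + 1) * sqrt n" "integrable ?Pn K"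
    unfolding K_def[abs_def] using expected_relu_dev_le[OF \<mu> s n T(1,3) z0 T1] by auto
  have K0: "0 \<le> K y" for y
    unfolding K_def using fmax_ge[OF T(1,3), of "\<lambda>\<theta>. \<bar>\<Sum>j<n. sgn (fst (y j)) * relu (dot d (fst \<theta>) (snd (y j)) + snd \<theta>)\<bar>"]
    by (rule order_trans[rotated]) simp
  note D = expected_affine_dev_le[OF \<mu> s n]
  have le: "\<bar>fmax G (\<lambda>g. \<Sum>j<n. sgn (fst (y j)) * g (snd (y j)))\<bar> \<le> 2 * a * K y + a * affine_dev d n y" for y
  proof (intro abs_fmax_le G)
    fix g assume g: "g \<in> G"
    have "\<bar>\<Sum>j<n. sgn (fst (y j)) * net d k relu (\<beta> g) (w g) (b g) (w0 g) (b0 g) (snd (y j))\<bar> \<le> 2 * a * K y + a * affine_dev d n y"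
    proof (rule signed_net_sum_le)
      fix i assume i: "i < k"
      then have "(w g i, b g i) \<in> T" using g by (auto simp: T_def)
      from fmax_ge[OF T(1) this, of "\<lambda>\<theta>. \<bar>\<Sum>j<n. sgn (fst (y j)) * relu (dot d (fst \<theta>) (snd (y j)) + snd \<theta>)\<bar>"]
      show "\<bar>\<Sum>j<n. sgn (fst (y j)) * relu (dot d (w g i) (snd (y j)) + b g i)\<bar> \<le> K y"
        unfolding K_def by simp
    qed (use P g a K0 in auto)
    then show "\<bar>\<Sum>j<n. sgn (fst (y j)) * g (snd (y j))\<bar> \<le> 2 * a * K y + a * affine_dev d n y"
      unfolding P(3)[OF g] .
  qed
  have mg: "(\<lambda>y. fmax G (\<lambda>g. \<Sum>j<n. sgn (fst (y j)) * g (snd (y j)))) \<in> borel_measurable ?Pn"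
  proof (intro borel_measurable_Max borel_measurable_sum G(1))
    fix g j assume g: "g \<in> G" and j: "j \<in> {..<n}"
    have "g \<in> borel_measurable \<mu>" using nn_class_measurable[OF activation_relu s] g G(3) by blast
    then have m0: "(\<lambda>z. sgn (fst z) * g (snd z)) \<in> borel_measurable ?P"
      by (intro borel_measurable_times measurable_compose[OF measurable_fst borel_measurable_coin]
          measurable_compose[OF measurable_snd])
    show "(\<lambda>y. sgn (fst (y j)) * g (snd (y j))) \<in> borel_measurable ?Pn"
      using measurable_compose[OF measurable_component_singleton[OF j, of "\<lambda>_. ?P"] m0] .
  qed
  have iR: "integrable ?Pn (\<lambda>y. 2 * a * K y + a * affine_dev d n y)" using K(2) D(2) by simp
  have "(\<integral>y. fmax G (\<lambda>g. \<Sum>j<n. sgn (fst (y j)) * g (snd (y j))) \<partial>?Pn) \<le> (\<integral>y. 2 * a * K y + a * affine_dev d n y \<partial>?Pn)"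
  proof (rule integral_mono)
    show "integrable ?Pn (\<lambda>y. fmax G (\<lambda>g. \<Sum>j<n. sgn (fst (y j)) * g (snd (y j))))"
      by (rule Bochner_Integration.integrable_bound[OF iR mg]) (use le in \<open>auto intro: order_trans[OF _ abs_ge_self]\<close>)
    show "fmax G (\<lambda>g. \<Sum>j<n. sgn (fst (y j)) * g (snd (y j))) \<le> 2 * a * K y + a * affine_dev d n y" for y
      using le[of y] by linarith
  qed (rule iR)
  also have "\<dots> = 2 * a * (\<integral>y. K y \<partial>?Pn) + a * (\<integral>y. affine_dev d n y \<partial>?Pn)"
    using K(2) D(2) by simp
  also have "\<dots> \<le> 2 * a * (2 * (real d + 1) * sqrt n) + a * ((real d + 1) * sqrt n)"
    using a K(1) D(1) by (intro add_mono mult_left_mono) auto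
  finally show ?thesis by (simp add: algebra_simps)
qed

text \<open>The bound does not depend on \<open>G\<close>, which may therefore be an arbitrarily fine net of the class.\<close>

lemma expected_net_deviation_le:
  fixes n :: nat and G :: "((nat \<Rightarrow> real) \<Rightarrow> real) set"
  assumes \<mu>: "prob_space \<mu>" and s: "sets \<mu> = sets (cube_borel d)" and n: "1 \<le> n" and k: "1 \<le> k"
    and a: "0 \<le> a" and G: "finite G" "G \<subseteq> nn_class d k 1 (2 * a / real k) a a relu" "(\<lambda>_. 0) \<in> G"
    and \<psi>: "\<psi> \<in> borel_measurable borel" "\<And>a b. \<bar>\<psi> a - \<psi> b\<bar> \<le> L * \<bar>a - b\<bar>" and L: "0 \<le> L"
  shows "(\<integral>x. fmax G (\<lambda>g. \<bar>\<Sum>j<n. \<psi> (g (x j)) - (\<integral>y. \<psi> (g y) \<partial>\<mu>)\<bar>) \<partial>Pi\<^sub>M {..<n} (\<lambda>_. \<mu>))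
       \<le> 20 * L * a * (real d + 1) * sqrt n" (is ?thesis1)
    and "integrable (Pi\<^sub>M {..<n} (\<lambda>_. \<mu>)) (\<lambda>x. fmax G (\<lambda>g. \<bar>\<Sum>j<n. \<psi> (g (x j)) - (\<integral>y. \<psi> (g y) \<partial>\<mu>)\<bar>))" (is ?thesis2)
proof -
  interpret \<mu>: prob_space \<mu> by fact
  let ?M = "Pi\<^sub>M {..<n} (\<lambda>_. \<mu>)"
  interpret Mn: prob_space ?M by (intro prob_space_PiM \<mu>)
  have sp: "space \<mu> = cube d" using sets_eq_imp_space_eq[OF s] space_cube_borel by simp
  have G': "G \<noteq> {}" using G by auto
  define B where "B = real k * (2 * a / real k * (1 + 2 * 1)) + a + a"
  have bg: "\<bar>g x\<bar> \<le> B" if "g \<in> G" "x \<in> space \<mu>" for g x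
    using nn_class_bound[OF activation_relu, of g d k 1 "2 * a / real k" a a x] G(2) that
    unfolding B_def sp by blast
  have mg: "g \<in> borel_measurable \<mu>" if "g \<in> G" for g
    using nn_class_measurable[OF activation_relu s] that G(2) by blast
  define S where "S g x = (\<Sum>j<n. \<psi> (g (x j)) - (\<integral>y. \<psi> (g y) \<partial>\<mu>))"
    for g :: "(nat \<Rightarrow> real) \<Rightarrow> real" and x :: "nat \<Rightarrow> nat \<Rightarrow> real"
  define C where "C = \<bar>\<psi> 0\<bar> + L * B"
  have b\<psi>: "\<bar>\<psi> (g x)\<bar> \<le> C" if "g \<in> G" "x \<in> space \<mu>" for g x
  proof -
    have "L * \<bar>g x - 0\<bar> \<le> L * B" using bg[OF that] L by (intro mult_left_mono) auto
    then show ?thesis using \<psi>(2)[of "g x" 0] unfolding C_def by linarith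
  qed
  have m\<psi>: "(\<lambda>x. \<psi> (g x)) \<in> borel_measurable \<mu>" if "g \<in> G" for g
    using measurable_compose[OF mg[OF that] \<psi>(1)] .
  have mS: "S g \<in> borel_measurable ?M" if "g \<in> G" for g
  proof -
    have "(\<lambda>x. \<psi> (g x) - (\<integral>y. \<psi> (g y) \<partial>\<mu>)) \<in> borel_measurable \<mu>" using m\<psi>[OF that] by simp
    then have "(\<lambda>x. \<psi> (g (x j)) - (\<integral>y. \<psi> (g y) \<partial>\<mu>)) \<in> borel_measurable ?M" if "j \<in> {..<n}" for j
      using measurable_compose[OF measurable_component_singleton[OF that, of "\<lambda>_. \<mu>"]] by fast
    then show ?thesis unfolding S_def[abs_def] by (rule borel_measurable_sum)
  qed
  have bS: "\<bar>S g x\<bar> \<le> real n * (2 * C)" if "g \<in> G" "x \<in> space ?M" for g x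
    unfolding S_def
  proof (rule abs_sum_lessThan_le)
    fix j assume "j < n"
    then have "x j \<in> space \<mu>" using PiE_mem[of x "{..<n}" "\<lambda>_. space \<mu>" j] that by (simp add: space_PiM)
    then have "\<bar>\<psi> (g (x j))\<bar> \<le> C" by (rule b\<psi>[OF that(1)])
    moreover have "\<bar>\<integral>y. \<psi> (g y) \<partial>\<mu>\<bar> \<le> C"
      by (rule \<mu>.abs_expectation_le[OF m\<psi> b\<psi>]) (use that in auto)
    ultimately show "\<bar>\<psi> (g (x j)) - (\<integral>y. \<psi> (g y) \<partial>\<mu>)\<bar> \<le> 2 * C" by linarith
  qed
  have int: "integrable ?M (\<lambda>x. fmax G (\<lambda>g. h (S g x)))"
    if "h \<in> borel_measurable borel" "\<And>z. \<bar>h z\<bar> \<le> \<bar>z\<bar>" for h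
  proof (rule Mn.integrable_bounded[of _ "real n * (2 * C)"])
    show "(\<lambda>x. fmax G (\<lambda>g. h (S g x))) \<in> borel_measurable ?M"
      by (intro borel_measurable_Max G(1) measurable_compose[OF mS that(1)])
    show "\<bar>fmax G (\<lambda>g. h (S g x))\<bar> \<le> real n * (2 * C)" if "x \<in> space ?M" for x
      using order_trans[OF \<open>\<And>z. \<bar>h z\<bar> \<le> \<bar>z\<bar>\<close> bS[OF _ that]] by (intro abs_fmax_le G(1) G') auto
  qed
  show ?thesis2 using int[of abs] unfolding S_def by simp
  have i1: "integrable ?M (\<lambda>x. fmax G (\<lambda>g. S g x))" using int[of "\<lambda>z. z"] by simp
  have i2: "integrable ?M (\<lambda>x. fmax G (\<lambda>g. - S g x))" using int[of uminus] by simp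
  note R = expected_net_rademacher_le[OF \<mu> s n a G(1) G' G(2)]
  have dev: "(\<integral>x. fmax G (\<lambda>g. \<Sum>j<n. \<theta> (g (x j)) - (\<integral>y. \<theta> (g y) \<partial>\<mu>)) \<partial>?M) \<le> 2 * L * (5 * a * (real d + 1) * sqrt n)"
    if \<theta>: "\<theta> \<in> borel_measurable borel" "\<And>a b. \<bar>\<theta> a - \<theta> b\<bar> \<le> L * \<bar>a - b\<bar>" for \<theta>
  proof -
    have "(\<integral>x. fmax G (\<lambda>g. \<Sum>j<n. \<theta> (g (x j)) - (\<integral>y. \<theta> (g y) \<partial>\<mu>)) \<partial>?M)
      \<le> 2 * L * (\<integral>y. fmax G (\<lambda>g. \<Sum>j<n. sgn (fst (y j)) * g (snd (y j))) \<partial>Pi\<^sub>M {..<n} (\<lambda>_. coin \<Otimes>\<^sub>M \<mu>))"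
      by (rule expected_deviation_le[where B = B, OF \<mu> G(1) G' L]) (use mg bg \<theta> in auto)
    also have "\<dots> \<le> 2 * L * (5 * a * (real d + 1) * sqrt n)"
      using R L by (intro mult_left_mono) auto
    finally show ?thesis .
  qed
  have 1: "(\<integral>x. fmax G (\<lambda>g. S g x) \<partial>?M) \<le> 2 * L * (5 * a * (real d + 1) * sqrt n)"
    unfolding S_def by (rule dev[OF \<psi>])
  have "(\<integral>x. fmax G (\<lambda>g. \<Sum>j<n. - \<psi> (g (x j)) - (\<integral>y. - \<psi> (g y) \<partial>\<mu>)) \<partial>?M) \<le> 2 * L * (5 * a * (real d + 1) * sqrt n)"
  proof (rule dev)
    show "(\<lambda>z. - \<psi> z) \<in> borel_measurable borel" using \<psi>(1) by simp
    show "\<bar>- \<psi> a - - \<psi> b\<bar> \<le> L * \<bar>a - b\<bar>" for a b using \<psi>(2)[of a b] by linarith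
  qed
  moreover have "- S g x = (\<Sum>j<n. - \<psi> (g (x j)) - (\<integral>y. - \<psi> (g y) \<partial>\<mu>))" for g x
    unfolding S_def sum_negf[symmetric] by simp
  ultimately have 2: "(\<integral>x. fmax G (\<lambda>g. - S g x) \<partial>?M) \<le> 2 * L * (5 * a * (real d + 1) * sqrt n)"
    by simp
  have S0: "S (\<lambda>_. 0) x = 0" for x by (simp add: S_def \<mu>.prob_space)
  have "(\<integral>x. fmax G (\<lambda>g. \<bar>S g x\<bar>) \<partial>?M) \<le> (\<integral>x. fmax G (\<lambda>g. S g x) + fmax G (\<lambda>g. - S g x) \<partial>?M)"
  proof (rule integral_mono)
    show "integrable ?M (\<lambda>x. fmax G (\<lambda>g. \<bar>S g x\<bar>))" using int[of abs] by simp
    show "integrable ?M (\<lambda>x. fmax G (\<lambda>g. S g x) + fmax G (\<lambda>g. - S g x))" using i1 i2 by simp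
    show "fmax G (\<lambda>g. \<bar>S g x\<bar>) \<le> fmax G (\<lambda>g. S g x) + fmax G (\<lambda>g. - S g x)" for x
      using fmax_abs_le[OF G(1) G' G(3), of "\<lambda>g. S g x"] S0 by simp
  qed
  also have "\<dots> = (\<integral>x. fmax G (\<lambda>g. S g x) \<partial>?M) + (\<integral>x. fmax G (\<lambda>g. - S g x) \<partial>?M)"
    using i1 i2 by simp
  also have "\<dots> \<le> 20 * L * a * (real d + 1) * sqrt n" using 1 2 by linarith
  finally show ?thesis1 unfolding S_def .
qed

subsection \<open>Finite nets\<close>

text \<open>Rounding towards zero decreases absolute values, so rounded parameters obey the same bounds and
  the net consists of members of the class.\<close>

definition trunc_to :: "real \<Rightarrow> real \<Rightarrow> real" where
  "trunc_to h x = sgn x * (h * of_int \<lfloor>\<bar>x\<bar> / h\<rfloor>)"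

definition grid :: "real \<Rightarrow> nat \<Rightarrow> real set" where
  "grid h N = (\<lambda>j::int. h * of_int j) ` {- int N..int N}"

lemma grid_card: "finite (grid h N)" "card (grid h N) \<le> 2 * N + 1"
proof -
  show "finite (grid h N)" by (simp add: grid_def)
  have "card (grid h N) \<le> card {- int N..int N}" unfolding grid_def by (rule card_image_le) simp
  then show "card (grid h N) \<le> 2 * N + 1" by simp
qed

lemma trunc_to:
  assumes h: "0 < h"
  shows "\<bar>trunc_to h x\<bar> \<le> \<bar>x\<bar>" "\<bar>x - trunc_to h x\<bar> \<le> h"
    and "\<bar>x\<bar> \<le> h * real N \<Longrightarrow> trunc_to h x \<in> grid h N"
proof -
  define m where "m = \<lfloor>\<bar>x\<bar> / h\<rfloor>"
  have m0: "0 \<le> m" using h by (simp add: m_def)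
  have "of_int m \<le> \<bar>x\<bar> / h" "\<bar>x\<bar> / h < of_int m + 1" unfolding m_def by linarith+
  then have m: "h * of_int m \<le> \<bar>x\<bar>" "\<bar>x\<bar> < h * of_int m + h"
    using h by (simp_all add: field_simps)
  have hm: "0 \<le> h * real_of_int m" using h m0 by simp
  show "\<bar>trunc_to h x\<bar> \<le> \<bar>x\<bar>" "\<bar>x - trunc_to h x\<bar> \<le> h"
    unfolding trunc_to_def m_def[symmetric] using m hm h by (auto simp: sgn_if)
  assume x: "\<bar>x\<bar> \<le> h * real N"
  have "h * of_int m \<le> h * real N" using m(1) x by linarith
  then have "m \<le> int N" using h by simp
  define m' where "m' = (if x < 0 then - m else if x = 0 then 0 else m)"
  have "trunc_to h x = h * of_int m'"
    unfolding trunc_to_def m_def[symmetric] m'_def by (simp add: sgn_if)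
  moreover have "m' \<in> {- int N..int N}" using m0 \<open>m \<le> int N\<close> by (auto simp: m'_def)
  ultimately show "trunc_to h x \<in> grid h N" unfolding grid_def by blast
qed

lemma l1_norm_trunc_le: "0 < h \<Longrightarrow> l1_norm d (\<lambda>j\<in>{..<d}. trunc_to h (w j)) \<le> l1_norm d w"
  unfolding l1_norm_def by (intro sum_mono) (simp add: trunc_to)

lemma dot_trunc_diff:
  assumes h: "0 < h" and x: "x \<in> cube d"
  shows "\<bar>dot d w x - dot d (\<lambda>j\<in>{..<d}. trunc_to h (w j)) x\<bar> \<le> real d * h"
proof -
  have "\<bar>dot d w x - dot d (\<lambda>j\<in>{..<d}. trunc_to h (w j)) x\<bar> = \<bar>\<Sum>j<d. (w j - trunc_to h (w j)) * x j\<bar>"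
    unfolding dot_def by (simp add: left_diff_distrib sum_subtractf)
  also have "\<dots> \<le> real d * h"
  proof (rule abs_sum_lessThan_le)
    fix j assume "j < d"
    have "\<bar>w j - trunc_to h (w j)\<bar> * \<bar>x j\<bar> \<le> h * 1"
      using trunc_to(2)[OF h, of "w j"] cube_coord[OF x \<open>j < d\<close>] h by (intro mult_mono) auto
    then show "\<bar>(w j - trunc_to h (w j)) * x j\<bar> \<le> h" by (simp add: abs_mult)
  qed
  finally show ?thesis .
qed

text \<open>The exponent counts the scalar parameters: \<open>k * (d + 2)\<close> for the neurons and \<open>d + 1\<close> for the affine
  part.\<close>

lemma nn_class_finite_net:
  assumes \<phi>: "activation \<phi>" and h: "0 < h" and a1: "a1 \<le> 1"
    and N: "a1 \<le> h * real N" "a2 \<le> h * real N" "a3 \<le> h * real N" "a4 \<le> h * real N"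
  obtains G where "finite G" "G \<subseteq> nn_class d k a1 a2 a3 a4 \<phi>" "card G \<le> (2 * N + 1) ^ (k * (d + 2) + d + 1)"
    "\<And>g. g \<in> nn_class d k a1 a2 a3 a4 \<phi> \<Longrightarrow>
       \<exists>g'\<in>G. \<forall>x\<in>cube d. \<bar>g x - g' x\<bar> \<le> h * (real k * (3 + a2 * (real d + 1)) + real d + 1)"
proof -
  let ?C = "nn_class d k a1 a2 a3 a4 \<phi>"
  let ?g = "grid h N"
  define Q where "Q = ({..<k} \<rightarrow>\<^sub>E ?g) \<times> ({..<k} \<rightarrow>\<^sub>E ({..<d} \<rightarrow>\<^sub>E ?g)) \<times> ({..<k} \<rightarrow>\<^sub>E ?g) \<times> ({..<d} \<rightarrow>\<^sub>E ?g) \<times> ?g"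
  define F where "F = (\<lambda>(\<beta>, w, b, w0, b0). net d k \<phi> \<beta> w b w0 b0)"
  define G where "G = ?C \<inter> F ` Q"
  have finQ: "finite Q"
    unfolding Q_def by (intro finite_cartesian_product finite_PiE grid_card finite_lessThan)
  have "card G \<le> card Q"
    unfolding G_def using finQ by (meson card_image_le card_mono finite_imageI inf_le2 order_trans)
  also have "card Q = card ?g ^ k * ((card ?g ^ d) ^ k * (card ?g ^ k * (card ?g ^ d * card ?g)))"
    unfolding Q_def by (simp add: card_cartesian_product card_PiE)
  also have "\<dots> = card ?g ^ (k * (d + 2) + d + 1)"
    by (simp add: power_add power_mult[symmetric] algebra_simps)
  also have "\<dots> \<le> (2 * N + 1) ^ (k * (d + 2) + d + 1)"
    by (rule power_mono[OF grid_card(2)]) simp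
  finally have card: "card G \<le> (2 * N + 1) ^ (k * (d + 2) + d + 1)" .
  have net: "\<exists>g'\<in>G. \<forall>x\<in>cube d. \<bar>g x - g' x\<bar> \<le> h * (real k * (3 + a2 * (real d + 1)) + real d + 1)" if gC: "g \<in> ?C" for g
  proof -
    obtain \<beta> w b w0 b0 where
      p: "\<And>i. i < k \<Longrightarrow> l1_norm d (w i) \<le> a1 \<and> \<bar>b i\<bar> \<le> a1 \<and> \<bar>\<beta> i\<bar> \<le> a2"
      "\<bar>b0\<bar> \<le> a3" "l1_norm d w0 \<le> a4" "g = net d k \<phi> \<beta> w b w0 b0"
      using gC unfolding nn_class_iff by blast
    have coord: "\<bar>u j\<bar> \<le> l1_norm d u" if "j < d" for u j
      unfolding l1_norm_def using that by (intro member_le_sum) auto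
    define \<beta>' where "\<beta>' = (\<lambda>i\<in>{..<k}. trunc_to h (\<beta> i))"
    define w' where "w' = (\<lambda>i\<in>{..<k}. \<lambda>j\<in>{..<d}. trunc_to h (w i j))"
    define b' where "b' = (\<lambda>i\<in>{..<k}. trunc_to h (b i))"
    define w0' where "w0' = (\<lambda>j\<in>{..<d}. trunc_to h (w0 j))"
    define b0' where "b0' = trunc_to h b0"
    have tr: "trunc_to h u \<in> ?g" if "\<bar>u\<bar> \<le> a1 \<or> \<bar>u\<bar> \<le> a2 \<or> \<bar>u\<bar> \<le> a3 \<or> \<bar>u\<bar> \<le> a4" for u
      using that N by (intro trunc_to(3)[OF h]) auto
    have cw: "\<bar>w i j\<bar> \<le> a1" if "i < k" "j < d" for i j
      using coord[OF that(2), of "w i"] p(1)[OF that(1)] by linarith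
    have cw0: "\<bar>w0 j\<bar> \<le> a4" if "j < d" for j
      using coord[OF that, of w0] p(3) by linarith
    have "\<beta>' \<in> {..<k} \<rightarrow>\<^sub>E ?g" "b' \<in> {..<k} \<rightarrow>\<^sub>E ?g"
      unfolding \<beta>'_def b'_def restrict_PiE_iff using p(1) tr by blast+
    moreover have "w' \<in> {..<k} \<rightarrow>\<^sub>E ({..<d} \<rightarrow>\<^sub>E ?g)"
      unfolding w'_def restrict_PiE_iff using cw tr by blast
    moreover have "w0' \<in> {..<d} \<rightarrow>\<^sub>E ?g" "b0' \<in> ?g"
      unfolding w0'_def b0'_def restrict_PiE_iff using cw0 p(2) tr by blast+
    ultimately have "(\<beta>', w', b', w0', b0') \<in> Q" unfolding Q_def by blast
    moreover have p': "l1_norm d (w' i) \<le> a1 \<and> \<bar>b' i\<bar> \<le> a1 \<and> \<bar>\<beta>' i\<bar> \<le> a2" if "i < k" for i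
      using p(1)[OF that] that l1_norm_trunc_le[OF h, of d "w i"] trunc_to(1)[OF h, of "b i"] trunc_to(1)[OF h, of "\<beta> i"]
      unfolding w'_def b'_def \<beta>'_def by simp
    have "net d k \<phi> \<beta>' w' b' w0' b0' \<in> ?C"
      unfolding nn_class_iff using p' p(2,3) l1_norm_trunc_le[OF h, of d w0] trunc_to(1)[OF h, of b0]
      by (intro exI[of _ \<beta>'] exI[of _ w'] exI[of _ b'] exI[of _ w0'] exI[of _ b0']) (auto simp: w0'_def b0'_def)
    ultimately have "net d k \<phi> \<beta>' w' b' w0' b0' \<in> G" unfolding G_def F_def by force
    moreover have "\<bar>g x - net d k \<phi> \<beta>' w' b' w0' b0' x\<bar> \<le> h * (real k * (3 + a2 * (real d + 1)) + real d + 1)"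
      if x: "x \<in> cube d" for x
    proof -
      have "\<bar>\<Sum>i<k. \<beta> i * \<phi> (dot d (w i) x + b i) - \<beta>' i * \<phi> (dot d (w' i) x + b' i)\<bar>
          \<le> real k * (h * (3 + a2 * (real d + 1)))"
      proof (rule abs_sum_lessThan_le)
        fix i assume i: "i < k"
        let ?z = "dot d (w i) x + b i" and ?z' = "dot d (w' i) x + b' i"
        have "\<bar>?z - ?z'\<bar> \<le> real d * h + h"
          using dot_trunc_diff[OF h x, of "w i"] trunc_to(2)[OF h, of "b i"] i unfolding w'_def b'_def by simp
        then have "\<bar>\<phi> ?z - \<phi> ?z'\<bar> \<le> real d * h + h"
          using \<phi> unfolding activation_def by (meson order_trans)
        then have 1: "\<bar>\<beta>' i\<bar> * \<bar>\<phi> ?z - \<phi> ?z'\<bar> \<le> a2 * (real d * h + h)"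
          using p'[OF i] by (intro mult_mono) auto
        have "\<bar>\<phi> ?z\<bar> \<le> 3"
          using activation_bound[OF \<phi>, of ?z] abs_dot_cube_le[OF x, of "w i"] p(1)[OF i] a1 by linarith
        moreover have "\<bar>\<beta> i - \<beta>' i\<bar> \<le> h" using trunc_to(2)[OF h, of "\<beta> i"] i by (simp add: \<beta>'_def)
        ultimately have 2: "\<bar>\<beta> i - \<beta>' i\<bar> * \<bar>\<phi> ?z\<bar> \<le> h * 3" using h by (intro mult_mono) auto
        have "\<beta> i * \<phi> ?z - \<beta>' i * \<phi> ?z' = (\<beta> i - \<beta>' i) * \<phi> ?z + \<beta>' i * (\<phi> ?z - \<phi> ?z')"
          by (simp add: algebra_simps)
        then have "\<bar>\<beta> i * \<phi> ?z - \<beta>' i * \<phi> ?z'\<bar> \<le> \<bar>\<beta> i - \<beta>' i\<bar> * \<bar>\<phi> ?z\<bar> + \<bar>\<beta>' i\<bar> * \<bar>\<phi> ?z - \<phi> ?z'\<bar>"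
          by (simp only: abs_mult[symmetric] abs_triangle_ineq)
        also have "\<dots> \<le> h * (3 + a2 * (real d + 1))" using 1 2 by (simp add: algebra_simps)
        finally show "\<bar>\<beta> i * \<phi> ?z - \<beta>' i * \<phi> ?z'\<bar> \<le> h * (3 + a2 * (real d + 1))" .
      qed
      moreover have "\<bar>dot d w0 x - dot d w0' x\<bar> \<le> real d * h"
        unfolding w0'_def by (rule dot_trunc_diff[OF h x])
      moreover have "\<bar>b0 - b0'\<bar> \<le> h" unfolding b0'_def by (rule trunc_to(2)[OF h])
      moreover have "g x - net d k \<phi> \<beta>' w' b' w0' b0' x
        = (\<Sum>i<k. \<beta> i * \<phi> (dot d (w i) x + b i) - \<beta>' i * \<phi> (dot d (w' i) x + b' i)) + (dot d w0 x - dot d w0' x) + (b0 - b0')"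
        unfolding p(4) net_def by (simp add: sum_subtractf)
      moreover have "h * (real k * (3 + a2 * (real d + 1)) + real d + 1) = real k * (h * (3 + a2 * (real d + 1))) + real d * h + h"
        by (simp add: algebra_simps)
      ultimately show ?thesis by linarith
    qed
    ultimately show ?thesis by blast
  qed
  have "finite G" unfolding G_def using finQ by simp
  with card net show ?thesis by (intro that[of G]) (auto simp: G_def)
qed

section \<open>The variational functional\<close>

definition hellinger_functional :: "'a measure \<Rightarrow> 'a measure \<Rightarrow> ('a \<Rightarrow> real) \<Rightarrow> real" where
  "hellinger_functional \<mu> \<nu> g = (\<integral>x. g x \<partial>\<mu>) - (\<integral>x. g x / (1 - g x) \<partial>\<nu>)"

lemma hellinger2_density_version:
  assumes \<mu>: "prob_space \<mu>" and \<nu>: "prob_space \<nu>" and p: "density_version \<mu> \<nu> p"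
  shows "integrable \<nu> p" "(\<integral>x. p x \<partial>\<nu>) = 1" "hellinger2 \<mu> \<nu> = (\<integral>x. (sqrt (p x) - 1)\<^sup>2 \<partial>\<nu>)"
    "integrable \<nu> (\<lambda>x. (sqrt (p x) - 1)\<^sup>2)" "hellinger2 \<mu> \<nu> \<le> 2"
proof -
  interpret \<nu>: prob_space \<nu> by fact
  interpret \<mu>: prob_space \<mu> by fact
  have mp: "p \<in> borel_measurable \<nu>" and p0: "\<And>x. x \<in> space \<nu> \<Longrightarrow> 0 < p x" and dens: "density \<nu> (\<lambda>x. ennreal (p x)) = \<mu>"
    using p by (auto simp: density_version_def)
  have AEp: "AE x in \<nu>. 0 \<le> p x" using p0 by (auto intro!: AE_I2 less_imp_le)
  have "integrable \<mu> (\<lambda>_. 1::real)" by simp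
  then show p_int: "integrable \<nu> p"
    unfolding dens[symmetric] by (subst (asm) integrable_real_density) (use mp AEp in auto)
  have "(\<integral>x. 1 \<partial>\<mu>) = (\<integral>x. p x * 1 \<partial>\<nu>)"
    unfolding dens[symmetric] by (rule integral_real_density) (use mp AEp in auto)
  then show p1: "(\<integral>x. p x \<partial>\<nu>) = 1" by (simp add: \<mu>.prob_space)
  have "AE x in \<nu>. ennreal (p x) = RN_deriv \<nu> \<mu> x"
    by (rule \<nu>.RN_deriv_unique) (use mp dens in auto)
  then have "AE x in \<nu>. (sqrt (enn2real (RN_deriv \<nu> \<mu> x)) - 1)\<^sup>2 = (sqrt (p x) - 1)\<^sup>2"
    using AE_space by eventually_elim (metis enn2real_ennreal less_imp_le p0)
  then show H: "hellinger2 \<mu> \<nu> = (\<integral>x. (sqrt (p x) - 1)\<^sup>2 \<partial>\<nu>)"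
    unfolding hellinger2_def using mp by (intro integral_cong_AE) auto
  have le: "(sqrt (p x) - 1)\<^sup>2 \<le> p x + 1" if "x \<in> space \<nu>" for x
    using p0[OF that] by (simp add: power2_eq_square algebra_simps)
  show sq_int: "integrable \<nu> (\<lambda>x. (sqrt (p x) - 1)\<^sup>2)"
  proof (rule Bochner_Integration.integrable_bound[of _ "\<lambda>x. p x + 1"])
    show "integrable \<nu> (\<lambda>x. p x + 1)" using p_int by simp
    show "(\<lambda>x. (sqrt (p x) - 1)\<^sup>2) \<in> borel_measurable \<nu>" using mp by measurable
    show "AE x in \<nu>. norm ((sqrt (p x) - 1)\<^sup>2) \<le> norm (p x + 1)"
      using le by (intro AE_I2) (auto intro: order_trans[OF _ abs_ge_self])
  qed
  have "hellinger2 \<mu> \<nu> \<le> (\<integral>x. p x + 1 \<partial>\<nu>)"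
    unfolding H using sq_int p_int le by (intro integral_mono) auto
  also have "\<dots> = 2" using p_int p1 by (simp add: \<nu>.prob_space)
  finally show "hellinger2 \<mu> \<nu> \<le> 2" .
qed

text \<open>With \<open>u = 1 - g\<close>, the integrand of the difference with respect to \<open>\<nu>\<close> is
  \<open>p * u - 2 * sqrt p + 1 / u\<close>, which is \<open>p * (u - 1 / sqrt p)\<^sup>2 / u\<close>.\<close>

lemma hellinger_gap:
  assumes \<mu>: "prob_space \<mu>" and \<nu>: "prob_space \<nu>" and p: "density_version \<mu> \<nu> p"
    and g: "g \<in> borel_measurable \<nu>" "\<And>x. x \<in> space \<nu> \<Longrightarrow> \<bar>g x\<bar> \<le> B" "\<And>x. x \<in> space \<nu> \<Longrightarrow> g x \<le> 1 - t" and t: "0 < t"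
  shows "hellinger2 \<mu> \<nu> - hellinger_functional \<mu> \<nu> g = (\<integral>x. (g x - f_H2 p x)\<^sup>2 / (1 - g x) \<partial>\<mu>)"
proof -
  interpret \<nu>: prob_space \<nu> by fact
  interpret \<mu>: prob_space \<mu> by fact
  have mp: "p \<in> borel_measurable \<nu>" and p0: "\<And>x. x \<in> space \<nu> \<Longrightarrow> 0 < p x" and dens: "density \<nu> (\<lambda>x. ennreal (p x)) = \<mu>"
    using p by (auto simp: density_version_def)
  have AEp: "AE x in \<nu>. 0 \<le> p x" using p0 by (auto intro!: AE_I2 less_imp_le)
  note p_int = hellinger2_density_version(1)[OF \<mu> \<nu> p] and H = hellinger2_density_version(3)[OF \<mu> \<nu> p]
    and sq_int = hellinger2_density_version(4)[OF \<mu> \<nu> p]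
  have pg_int: "integrable \<nu> (\<lambda>x. p x * g x)"
  proof (rule Bochner_Integration.integrable_bound[of _ "\<lambda>x. B * p x"])
    show "integrable \<nu> (\<lambda>x. B * p x)" using p_int by simp
    show "(\<lambda>x. p x * g x) \<in> borel_measurable \<nu>" using mp g(1) by measurable
    have "norm (p x * g x) \<le> norm (B * p x)" if "x \<in> space \<nu>" for x
      using mult_left_mono[OF g(2)[OF that], of "p x"] p0[OF that]
      by (auto simp: abs_mult mult.commute intro: order_trans[OF _ mult_right_mono[OF abs_ge_self[of B]]])
    then show "AE x in \<nu>. norm (p x * g x) \<le> norm (B * p x)" by (rule AE_I2)
  qed
  have q_int: "integrable \<nu> (\<lambda>x. g x / (1 - g x))"
  proof (rule \<nu>.integrable_bounded[of _ "B / t"])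
    show "(\<lambda>x. g x / (1 - g x)) \<in> borel_measurable \<nu>" using g(1) by measurable
    fix x assume x: "x \<in> space \<nu>"
    have "\<bar>g x\<bar> / \<bar>1 - g x\<bar> \<le> B / t" using g(2,3)[OF x] t by (intro frac_le) auto
    then show "\<bar>g x / (1 - g x)\<bar> \<le> B / t" by (simp add: abs_divide)
  qed
  have pm: "(\<integral>x. F x \<partial>\<mu>) = (\<integral>x. p x * F x \<partial>\<nu>)" if "F \<in> borel_measurable \<nu>" for F :: "'a \<Rightarrow> real"
    unfolding dens[symmetric] by (rule integral_real_density) (use mp AEp that in auto)
  have mf: "(\<lambda>x. (g x - f_H2 p x)\<^sup>2 / (1 - g x)) \<in> borel_measurable \<nu>"
    unfolding f_H2_def using mp g(1) by measurable
  have "hellinger2 \<mu> \<nu> - hellinger_functional \<mu> \<nu> g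
     = (\<integral>x. (sqrt (p x) - 1)\<^sup>2 \<partial>\<nu>) - ((\<integral>x. p x * g x \<partial>\<nu>) - (\<integral>x. g x / (1 - g x) \<partial>\<nu>))"
    unfolding H hellinger_functional_def pm[OF g(1)] ..
  also have "\<dots> = (\<integral>x. (sqrt (p x) - 1)\<^sup>2 - (p x * g x - g x / (1 - g x)) \<partial>\<nu>)"
    using sq_int pg_int q_int by simp
  also have "\<dots> = (\<integral>x. p x * ((g x - f_H2 p x)\<^sup>2 / (1 - g x)) \<partial>\<nu>)"
  proof (rule Bochner_Integration.integral_cong[OF refl])
    fix x assume x: "x \<in> space \<nu>"
    define s u where "s = sqrt (p x)" and "u = 1 - g x"
    have u: "u \<noteq> 0" and g_eq: "g x = 1 - u" using g(3)[OF x] t by (auto simp: u_def)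
    have s: "s > 0" and ps: "p x = s * s" using p0[OF x] by (auto simp: s_def)
    have f: "f_H2 p x = 1 - 1 / s"
      using p0[OF x] by (simp add: f_H2_def s_def powr_minus powr_half_sqrt divide_simps)
    show "(sqrt (p x) - 1)\<^sup>2 - (p x * g x - g x / (1 - g x)) = p x * ((g x - f_H2 p x)\<^sup>2 / (1 - g x))"
      unfolding s_def[symmetric] f g_eq ps using u s by (simp add: field_simps power2_eq_square)
  qed
  also have "\<dots> = (\<integral>x. (g x - f_H2 p x)\<^sup>2 / (1 - g x) \<partial>\<mu>)" by (rule pm[OF mf, symmetric])
  finally show ?thesis .
qed

lemma hellinger_functional_le:
  assumes "prob_space \<mu>" "prob_space \<nu>" "density_version \<mu> \<nu> p" "g \<in> borel_measurable \<nu>"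
    "\<And>x. x \<in> space \<nu> \<Longrightarrow> \<bar>g x\<bar> \<le> B" "\<And>x. x \<in> space \<nu> \<Longrightarrow> g x \<le> 1 - t" "0 < t"
  shows "hellinger_functional \<mu> \<nu> g \<le> hellinger2 \<mu> \<nu>"
proof -
  have sp: "space \<mu> = space \<nu>" using assms(3) by (auto simp: density_version_def)
  have "0 \<le> (\<integral>x. (g x - f_H2 p x)\<^sup>2 / (1 - g x) \<partial>\<mu>)"
  proof (rule integral_nonneg_AE, rule AE_I2)
    fix x assume "x \<in> space \<mu>"
    then show "0 \<le> (g x - f_H2 p x)\<^sup>2 / (1 - g x)"
      using assms(6)[of x] assms(7) by (intro divide_nonneg_nonneg) (auto simp: sp)
  qed
  moreover have "hellinger2 \<mu> \<nu> - hellinger_functional \<mu> \<nu> g = (\<integral>x. (g x - f_H2 p x)\<^sup>2 / (1 - g x) \<partial>\<mu>)"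
    by (rule hellinger_gap) (use assms in auto)
  ultimately show ?thesis by linarith
qed

text \<open>As \<open>f_H2 p\<close> lies below \<open>1 - t\<close>, clipping there moves \<open>g\<close> closer to it, and the denominator \<open>1 - g\<close> of the
  gap is at least \<open>t\<close> afterwards.\<close>

lemma hellinger_clipped_gap_le:
  assumes \<mu>: "prob_space \<mu>" and \<nu>: "prob_space \<nu>" and p: "density_version \<mu> \<nu> p" and t: "0 < t"
    and g: "g \<in> borel_measurable \<nu>" "\<And>x. x \<in> space \<nu> \<Longrightarrow> \<bar>g x\<bar> \<le> B"
    and f: "\<And>x. x \<in> space \<nu> \<Longrightarrow> \<bar>f_H2 p x\<bar> \<le> F" "AE x in \<mu>. f_H2 p x \<le> 1 - t"
  shows "hellinger2 \<mu> \<nu> - hellinger_functional \<mu> \<nu> (\<lambda>x. min (1 - t) (g x)) \<le> (\<integral>x. (g x - f_H2 p x)\<^sup>2 \<partial>\<mu>) / t"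
proof -
  interpret \<mu>: prob_space \<mu> by fact
  have se: "sets \<mu> = sets \<nu>" and sp: "space \<mu> = space \<nu>" and mp: "p \<in> borel_measurable \<nu>"
    using p by (auto simp: density_version_def)
  have "f_H2 p \<in> borel_measurable \<nu>" unfolding f_H2_def[abs_def] using mp by measurable
  then have g': "g \<in> borel_measurable \<mu>" and f': "f_H2 p \<in> borel_measurable \<mu>"
    using g(1) measurable_cong_sets[OF se refl] by blast+
  have "hellinger2 \<mu> \<nu> - hellinger_functional \<mu> \<nu> (\<lambda>x. min (1 - t) (g x))
      = (\<integral>x. (min (1 - t) (g x) - f_H2 p x)\<^sup>2 / (1 - min (1 - t) (g x)) \<partial>\<mu>)"
  proof (rule hellinger_gap[OF \<mu> \<nu> p _ _ _ t, of _ "\<bar>1 - t\<bar> + B"])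
    show "\<bar>min (1 - t) (g x)\<bar> \<le> \<bar>1 - t\<bar> + B" if "x \<in> space \<nu>" for x
      using g(2)[OF that] by (auto simp: min_def)
  qed (use g(1) in auto)
  also have "\<dots> \<le> (\<integral>x. (g x - f_H2 p x)\<^sup>2 / t \<partial>\<mu>)"
  proof (rule integral_mono_AE)
    have bd: "\<bar>(g x - f_H2 p x)\<^sup>2\<bar> \<le> (B + F)\<^sup>2" if "x \<in> space \<mu>" for x
    proof -
      have "\<bar>g x - f_H2 p x\<bar> \<le> B + F" using g(2)[of x] f(1)[of x] that unfolding sp by linarith
      from power_mono[OF this, of 2] show ?thesis by (simp only: power2_abs abs_power2 abs_ge_zero)
    qed
    have i1: "integrable \<mu> (\<lambda>x. (g x - f_H2 p x)\<^sup>2)"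
      by (rule \<mu>.integrable_bounded[OF _ bd]) (use g' f' in measurable)
    then show i2: "integrable \<mu> (\<lambda>x. (g x - f_H2 p x)\<^sup>2 / t)" by simp
    show le: "AE x in \<mu>. (min (1 - t) (g x) - f_H2 p x)\<^sup>2 / (1 - min (1 - t) (g x)) \<le> (g x - f_H2 p x)\<^sup>2 / t"
      using f(2)
    proof eventually_elim
      case (elim x)
      have "\<bar>min (1 - t) (g x) - f_H2 p x\<bar> \<le> \<bar>g x - f_H2 p x\<bar>" using elim by (auto simp: min_def)
      then have "(min (1 - t) (g x) - f_H2 p x)\<^sup>2 \<le> (g x - f_H2 p x)\<^sup>2" by (rule abs_le_square_iff[THEN iffD1])
      then show ?case using t by (intro frac_le) auto
    qed
    have "(\<lambda>x. (min (1 - t) (g x) - f_H2 p x)\<^sup>2 / (1 - min (1 - t) (g x))) \<in> borel_measurable \<mu>"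
      using g' f' by measurable
    moreover have "AE x in \<mu>. norm ((min (1 - t) (g x) - f_H2 p x)\<^sup>2 / (1 - min (1 - t) (g x))) \<le> norm ((g x - f_H2 p x)\<^sup>2 / t)"
      using le
    proof eventually_elim
      case (elim x)
      have nonneg: "0 \<le> (min (1 - t) (g x) - f_H2 p x)\<^sup>2 / (1 - min (1 - t) (g x))"
        using t by (intro divide_nonneg_nonneg) (auto simp: min_def)
      show ?case
        unfolding real_norm_def abs_of_nonneg[OF nonneg] using elim abs_ge_self order_trans by blast
    qed
    ultimately show "integrable \<mu> (\<lambda>x. (min (1 - t) (g x) - f_H2 p x)\<^sup>2 / (1 - min (1 - t) (g x)))"
      by (rule Bochner_Integration.integrable_bound[OF i2])
  qed
  finally show ?thesis by simp
qed

section \<open>Networks from mixtures of neurons\<close>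

lemma (in prob_space) exists_le_expectation:
  fixes \<Phi> :: "'a \<Rightarrow> real"
  assumes "integrable M \<Phi>" "expectation \<Phi> \<le> c"
  shows "\<exists>\<theta>\<in>space M. \<Phi> \<theta> \<le> c"
proof (rule ccontr)
  assume "\<not> ?thesis"
  then have "\<And>\<theta>. \<theta> \<in> space M \<Longrightarrow> c < \<Phi> \<theta>" by (meson not_le)
  then have "expectation (\<lambda>_. c) < expectation \<Phi>"
    using assms(1) by (intro integral_less_AE_space) (auto simp: emeasure_space_1)
  then show False using assms(2) by (simp add: prob_space)
qed

lemma (in prob_space) second_moment_centred_le:
  fixes h :: "'a \<Rightarrow> real"
  assumes h: "h \<in> borel_measurable M" "\<And>x. x \<in> space M \<Longrightarrow> \<bar>h x\<bar> \<le> B"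
  shows "expectation (\<lambda>x. (c + h x - expectation h)\<^sup>2) \<le> c\<^sup>2 + B\<^sup>2"
proof -
  define m where "m = expectation h"
  have ih: "integrable M h" using h by (rule integrable_bounded)
  have h2: "\<bar>(h x)\<^sup>2\<bar> \<le> B\<^sup>2" if "x \<in> space M" for x
    using power_mono[OF h(2)[OF that], of 2] by (simp only: power2_abs abs_power2 abs_ge_zero)
  have ih2: "integrable M (\<lambda>x. (h x)\<^sup>2)"
    using h(1) h2 by (intro integrable_bounded) auto
  have "(\<lambda>x. (c + h x - m)\<^sup>2) = (\<lambda>x. ((c - m)\<^sup>2 + 2 * (c - m) * h x) + (h x)\<^sup>2)"
    by (auto simp: power2_eq_square algebra_simps)
  then have "expectation (\<lambda>x. (c + h x - m)\<^sup>2) = (c - m)\<^sup>2 + 2 * (c - m) * m + expectation (\<lambda>x. (h x)\<^sup>2)"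
    using ih ih2 by (simp add: prob_space m_def)
  also have "\<dots> \<le> (c - m)\<^sup>2 + 2 * (c - m) * m + B\<^sup>2"
  proof -
    have "expectation (\<lambda>x. (h x)\<^sup>2) \<le> expectation (\<lambda>_. B\<^sup>2)"
      using ih2 h2 by (intro integral_mono) auto
    then show ?thesis by (simp add: prob_space)
  qed
  also have "\<dots> = c\<^sup>2 - m\<^sup>2 + B\<^sup>2" by (simp add: power2_eq_square algebra_simps)
  also have "\<dots> \<le> c\<^sup>2 + B\<^sup>2" by simp
  finally show ?thesis by (simp add: m_def)
qed

text \<open>The greedy form of Maurey's argument: a neuron drawn from \<open>Q\<close> increases the squared \<open>L\<^sup>2\<close> error of the
  unnormalised sum by at most \<open>B\<^sup>2\<close> on average, hence some neuron does.\<close>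

lemma greedy_mixture:
  fixes h :: "'b \<Rightarrow> 'a \<Rightarrow> real"
  assumes \<mu>: "prob_space \<mu>" and Q: "prob_space Q"
    and h: "(\<lambda>(\<theta>, x). h \<theta> x) \<in> borel_measurable (Q \<Otimes>\<^sub>M \<mu>)"
      "\<And>\<theta> x. \<theta> \<in> space Q \<Longrightarrow> x \<in> space \<mu> \<Longrightarrow> \<bar>h \<theta> x\<bar> \<le> B"
  defines "f \<equiv> \<lambda>x. \<integral>\<theta>. h \<theta> x \<partial>Q"
  shows "\<exists>\<theta> :: nat \<Rightarrow> 'b. (\<forall>i<k. \<theta> i \<in> space Q) \<and> (\<integral>x. ((\<Sum>i<k. h (\<theta> i) x) - real k * f x)\<^sup>2 \<partial>\<mu>) \<le> real k * B\<^sup>2"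
proof (induction k)
  case 0
  show ?case by simp
next
  case (Suc k)
  interpret \<mu>: prob_space \<mu> by fact
  interpret Q: prob_space Q by fact
  interpret P: pair_prob_space Q \<mu> ..
  have m1: "h \<theta> \<in> borel_measurable \<mu>" if "\<theta> \<in> space Q" for \<theta>
    using measurable_Pair2[OF h(1) that] by simp
  have m2: "(\<lambda>\<theta>. h \<theta> x) \<in> borel_measurable Q" if "x \<in> space \<mu>" for x
    using measurable_Pair1[OF h(1) that] by simp
  have bf: "\<bar>f x\<bar> \<le> B" if "x \<in> space \<mu>" for x
    unfolding f_def using m2[OF that] by (rule Q.abs_expectation_le) (use h(2) that in auto)
  have mf: "f \<in> borel_measurable \<mu>"
    unfolding f_def using P.integrable_snd[OF integrable_pair_bounded[OF Q \<mu> h(1), of B]] h(2) by auto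
  obtain \<theta> :: "nat \<Rightarrow> 'b" where \<theta>: "\<And>i. i < k \<Longrightarrow> \<theta> i \<in> space Q"
    and IH: "(\<integral>x. ((\<Sum>i<k. h (\<theta> i) x) - real k * f x)\<^sup>2 \<partial>\<mu>) \<le> real k * B\<^sup>2"
    using Suc.IH by auto
  define e where "e x = (\<Sum>i<k. h (\<theta> i) x) - real k * f x" for x
  have me: "e \<in> borel_measurable \<mu>"
    unfolding e_def[abs_def] using \<theta> m1 mf by (intro borel_measurable_diff borel_measurable_sum borel_measurable_times) auto
  define C where "C = 2 * real k * B + 2 * B"
  have be: "\<bar>e x\<bar> \<le> 2 * real k * B" if "x \<in> space \<mu>" for x
  proof -
    have "\<bar>\<Sum>i<k. h (\<theta> i) x\<bar> \<le> real k * B" using h(2) \<theta> that by (intro abs_sum_lessThan_le) auto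
    moreover have "\<bar>real k * f x\<bar> \<le> real k * B"
      unfolding abs_mult using bf[OF that] by (intro mult_mono) auto
    ultimately show ?thesis unfolding e_def by linarith
  qed
  have bd: "\<bar>(e x + h \<eta> x - f x)\<^sup>2\<bar> \<le> C\<^sup>2" if "\<eta> \<in> space Q" "x \<in> space \<mu>" for \<eta> x
  proof -
    have "\<bar>e x + h \<eta> x - f x\<bar> \<le> C"
      using be[OF that(2)] h(2)[OF that] bf[OF that(2)] unfolding C_def by linarith
    from power_mono[OF this, of 2] show ?thesis by (simp only: power2_abs abs_power2 abs_ge_zero)
  qed
  have mm: "(\<lambda>(\<eta>, x). (e x + h \<eta> x - f x)\<^sup>2) \<in> borel_measurable (Q \<Otimes>\<^sub>M \<mu>)"
    using h(1) unfolding split_beta'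
    by (intro borel_measurable_power borel_measurable_diff borel_measurable_add
        measurable_compose[OF measurable_snd me] measurable_compose[OF measurable_snd mf])
  have int: "integrable (Q \<Otimes>\<^sub>M \<mu>) (\<lambda>(\<eta>, x). (e x + h \<eta> x - f x)\<^sup>2)"
    by (rule integrable_pair_bounded[OF Q \<mu> mm bd])
  have ie2: "integrable \<mu> (\<lambda>x. (e x)\<^sup>2)"
  proof (rule \<mu>.integrable_bounded[of _ "(2 * real k * B)\<^sup>2"])
    show "(\<lambda>x. (e x)\<^sup>2) \<in> borel_measurable \<mu>" using me by (rule borel_measurable_power)
    show "\<bar>(e x)\<^sup>2\<bar> \<le> (2 * real k * B)\<^sup>2" if "x \<in> space \<mu>" for x
      using power_mono[OF be[OF that], of 2] by (simp only: power2_abs abs_power2 abs_ge_zero)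
  qed
  have "(\<integral>\<eta>. \<integral>x. (e x + h \<eta> x - f x)\<^sup>2 \<partial>\<mu> \<partial>Q) = (\<integral>x. \<integral>\<eta>. (e x + h \<eta> x - f x)\<^sup>2 \<partial>Q \<partial>\<mu>)"
    using P.Fubini_integral[OF int] by simp
  also have "\<dots> \<le> (\<integral>x. (e x)\<^sup>2 + B\<^sup>2 \<partial>\<mu>)"
  proof (rule integral_mono)
    show "integrable \<mu> (\<lambda>x. \<integral>\<eta>. (e x + h \<eta> x - f x)\<^sup>2 \<partial>Q)" using P.integrable_snd[OF int] by simp
    show "integrable \<mu> (\<lambda>x. (e x)\<^sup>2 + B\<^sup>2)" using ie2 by simp
    fix x assume x: "x \<in> space \<mu>"
    show "(\<integral>\<eta>. (e x + h \<eta> x - f x)\<^sup>2 \<partial>Q) \<le> (e x)\<^sup>2 + B\<^sup>2"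
      unfolding f_def by (rule Q.second_moment_centred_le[OF m2[OF x]]) (use h(2) x in auto)
  qed
  also have "\<dots> \<le> real k * B\<^sup>2 + B\<^sup>2"
    using IH ie2 unfolding e_def by (simp add: \<mu>.prob_space)
  finally obtain \<eta> where \<eta>: "\<eta> \<in> space Q" "(\<integral>x. (e x + h \<eta> x - f x)\<^sup>2 \<partial>\<mu>) \<le> real k * B\<^sup>2 + B\<^sup>2"
    using Q.exists_le_expectation[of "\<lambda>\<eta>. \<integral>x. (e x + h \<eta> x - f x)\<^sup>2 \<partial>\<mu>" "real k * B\<^sup>2 + B\<^sup>2"] P.integrable_fst[OF int] by auto
  show ?case
  proof (intro exI[of _ "\<theta>(k := \<eta>)"] conjI allI impI)
    show "(\<theta>(k := \<eta>)) i \<in> space Q" if "i < Suc k" for i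
      using that \<theta>[of i] \<eta>(1) by (auto simp: less_Suc_eq)
    have "(\<Sum>i<Suc k. h ((\<theta>(k := \<eta>)) i) x) - real (Suc k) * f x = e x + h \<eta> x - f x" for x
      by (simp add: e_def algebra_simps)
    then show "(\<integral>x. ((\<Sum>i<Suc k. h ((\<theta>(k := \<eta>)) i) x) - real (Suc k) * f x)\<^sup>2 \<partial>\<mu>) \<le> real (Suc k) * B\<^sup>2"
      using \<eta>(2) by (simp add: algebra_simps)
  qed
qed

lemma mixture_network:
  fixes c :: "'b \<Rightarrow> real" and w :: "'b \<Rightarrow> nat \<Rightarrow> real" and b :: "'b \<Rightarrow> real"
  assumes \<mu>: "prob_space \<mu>" and s: "sets \<mu> = sets (cube_borel d)" and Q: "prob_space Q" and k: "1 \<le> k"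
    and m: "c \<in> borel_measurable Q" "\<And>j. j < d \<Longrightarrow> (\<lambda>\<theta>. w \<theta> j) \<in> borel_measurable Q" "b \<in> borel_measurable Q"
    and bd: "\<And>\<theta>. \<theta> \<in> space Q \<Longrightarrow> \<bar>c \<theta>\<bar> \<le> B" "\<And>\<theta>. \<theta> \<in> space Q \<Longrightarrow> l1_norm d (w \<theta>) \<le> 1"
      "\<And>\<theta>. \<theta> \<in> space Q \<Longrightarrow> \<bar>b \<theta>\<bar> \<le> 1" and B: "0 \<le> B"
    and f: "\<And>x. x \<in> cube d \<Longrightarrow> f x = c0 + dot d v x + (\<integral>\<theta>. c \<theta> * relu (dot d (w \<theta>) x + b \<theta>) \<partial>Q)"
  shows "\<exists>g \<in> nn_class d k 1 (B / real k) \<bar>c0\<bar> (l1_norm d v) relu. (\<integral>x. (g x - f x)\<^sup>2 \<partial>\<mu>) \<le> (2 * B)\<^sup>2 / real k"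
proof -
  interpret \<mu>: prob_space \<mu> by fact
  have sp: "space \<mu> = cube d" using sets_eq_imp_space_eq[OF s] space_cube_borel by simp
  define h where "h \<theta> x = c \<theta> * relu (dot d (w \<theta>) x + b \<theta>)" for \<theta> x
  have mh: "(\<lambda>(\<theta>, x). h \<theta> x) \<in> borel_measurable (Q \<Otimes>\<^sub>M \<mu>)"
    unfolding h_def split_beta' dot_def
    by (intro borel_measurable_times borel_measurable_add borel_measurable_sum
        measurable_compose[OF _ activation_borel[OF activation_relu]]
        measurable_compose[OF measurable_fst m(1)] measurable_compose[OF measurable_fst m(2)]
        measurable_compose[OF measurable_fst m(3)] measurable_compose[OF measurable_snd borel_measurable_coord_cube[OF s]]) auto
  have bh: "\<bar>h \<theta> x\<bar> \<le> 2 * B" if "\<theta> \<in> space Q" "x \<in> space \<mu>" for \<theta> x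
  proof -
    have "\<bar>relu (dot d (w \<theta>) x + b \<theta>)\<bar> \<le> 2"
      using abs_dot_cube_le[of x d "w \<theta>"] bd(2,3)[OF that(1)] that(2) unfolding sp relu_def by auto
    then have "\<bar>c \<theta>\<bar> * \<bar>relu (dot d (w \<theta>) x + b \<theta>)\<bar> \<le> B * 2"
      using bd(1)[OF that(1)] B by (intro mult_mono) auto
    then show ?thesis by (simp add: h_def abs_mult mult.commute)
  qed
  obtain \<theta> :: "nat \<Rightarrow> 'b" where \<theta>: "\<And>i. i < k \<Longrightarrow> \<theta> i \<in> space Q"
    "(\<integral>x. ((\<Sum>i<k. h (\<theta> i) x) - real k * (\<integral>\<theta>. h \<theta> x \<partial>Q))\<^sup>2 \<partial>\<mu>) \<le> real k * (2 * B)\<^sup>2"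
    using greedy_mixture[OF \<mu> Q mh bh, of k] by auto
  define g where "g = net d k relu (\<lambda>i. c (\<theta> i) / real k) (\<lambda>i. w (\<theta> i)) (\<lambda>i. b (\<theta> i)) v c0"
  have "g \<in> nn_class d k 1 (B / real k) \<bar>c0\<bar> (l1_norm d v) relu"
    unfolding nn_class_iff g_def using \<theta>(1) bd
    by (intro exI[of _ "\<lambda>i. c (\<theta> i) / real k"] exI[of _ "\<lambda>i. w (\<theta> i)"] exI[of _ "\<lambda>i. b (\<theta> i)"] exI[of _ v] exI[of _ c0])
       (auto intro!: divide_right_mono)
  moreover have "(\<integral>x. (g x - f x)\<^sup>2 \<partial>\<mu>) \<le> (2 * B)\<^sup>2 / real k"
  proof -
    have "(\<integral>x. (g x - f x)\<^sup>2 \<partial>\<mu>) = (\<integral>x. ((\<Sum>i<k. h (\<theta> i) x) - real k * (\<integral>\<theta>. h \<theta> x \<partial>Q))\<^sup>2 / (real k)\<^sup>2 \<partial>\<mu>)"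
    proof (rule Bochner_Integration.integral_cong[OF refl])
      fix x assume "x \<in> space \<mu>"
      then have "g x - f x = (\<Sum>i<k. h (\<theta> i) x / real k) - (\<integral>\<theta>. h \<theta> x \<partial>Q)"
        unfolding sp using f[of x] by (simp add: g_def net_def h_def)
      also have "\<dots> = ((\<Sum>i<k. h (\<theta> i) x) - real k * (\<integral>\<theta>. h \<theta> x \<partial>Q)) / real k"
        using k by (simp add: sum_divide_distrib[symmetric] field_simps)
      finally show "(g x - f x)\<^sup>2 = ((\<Sum>i<k. h (\<theta> i) x) - real k * (\<integral>\<theta>. h \<theta> x \<partial>Q))\<^sup>2 / (real k)\<^sup>2"
        by (simp add: power_divide)
    qed
    also have "\<dots> = (\<integral>x. ((\<Sum>i<k. h (\<theta> i) x) - real k * (\<integral>\<theta>. h \<theta> x \<partial>Q))\<^sup>2 \<partial>\<mu>) / (real k)\<^sup>2" by simp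
    also have "\<dots> \<le> real k * (2 * B)\<^sup>2 / (real k)\<^sup>2" using \<theta>(2) by (intro divide_right_mono) auto
    also have "\<dots> = (2 * B)\<^sup>2 / real k" using k by (simp add: power2_eq_square)
    finally show ?thesis .
  qed
  ultimately show ?thesis by blast
qed

section \<open>From Fourier representations to mixtures of ramps\<close>

definition sym_unif :: "real measure" where
  "sym_unif = density lborel (\<lambda>t. ennreal (indicator {-1..1} t / 2))"

lemma prob_space_sym_unif: "prob_space sym_unif"
proof
  have "emeasure sym_unif (space sym_unif) = (\<integral>\<^sup>+t. ennreal (indicator {-1..1::real} t / 2) \<partial>lborel)"
    unfolding sym_unif_def by (subst emeasure_density) auto
  also have "\<dots> = (\<integral>\<^sup>+t. ennreal (1 / 2) * indicator {-1..1::real} t \<partial>lborel)"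
    by (intro nn_integral_cong) (simp split: split_indicator)
  also have "\<dots> = ennreal (1 / 2) * ennreal 2" by (subst nn_integral_cmult_indicator) auto
  also have "\<dots> = 1" by (subst ennreal_mult[symmetric]) auto
  finally show "emeasure sym_unif (space sym_unif) = 1" .
qed

lemma sets_sym_unif [measurable_cong]: "sets sym_unif = sets borel"
  by (simp add: sym_unif_def)

lemma integral_sym_unif:
  fixes f :: "real \<Rightarrow> complex"
  assumes "f \<in> borel_measurable borel"
  shows "(\<integral>t. f t \<partial>sym_unif) = (\<integral>t. indicator {-1..1} t *\<^sub>R f t \<partial>lborel) / 2"
proof -
  have "(\<integral>t. f t \<partial>sym_unif) = (\<integral>t. (indicator {-1..1} t / 2) *\<^sub>R f t \<partial>lborel)"
    unfolding sym_unif_def using assms by (intro integral_density) auto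
  also have "\<dots> = (\<integral>t. (indicator {-1..1} t *\<^sub>R f t) / 2 \<partial>lborel)"
    by (intro Bochner_Integration.integral_cong) (auto simp: scaleR_conv_of_real)
  finally show ?thesis by simp
qed

text \<open>The positive part of \<open>y - t\<close> for positive \<open>t\<close>, and of \<open>t - y\<close> for negative \<open>t\<close>: the ramp with kink at
  \<open>t\<close> that opens away from the origin.\<close>

definition ramp :: "real \<Rightarrow> real \<Rightarrow> real" where
  "ramp y t = relu (sgn t * y + (- \<bar>t\<bar>))"

lemma ramp_measurable [measurable]: "ramp y \<in> borel_measurable borel"
  unfolding ramp_def[abs_def]
  by (intro measurable_compose[OF _ activation_borel[OF activation_relu]]) measurable

text \<open>The remainder of second order is an integral of \<open>(y - t) * exp (\<i> * L * t)\<close> over \<open>t\<close> between 0 and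
  \<open>y\<close>; extending it by zero turns the factor \<open>y - t\<close> into a ramp. The scaling by \<open>L\<close> keeps all kinks
  in the unit interval around 0, whatever the frequency.\<close>

lemma exp_taylor_ramp:
  fixes L y :: real
  assumes y: "\<bar>y\<bar> \<le> 1"
  shows "exp (\<i> * of_real (L * y)) - 1 - \<i> * of_real (L * y)
       = - (of_real (2 * L\<^sup>2) * (\<integral>t. of_real (ramp y t) * exp (\<i> * of_real (L * t)) \<partial>sym_unif))"
proof (cases "L = 0")
  case False
  define E where "E t = exp (\<i> * of_real (L * t))" for t :: real
  define f where "f t = of_real (y - t) * E t" for t :: real
  define G where "G t = of_real (y - t) * E t / (\<i> * of_real L) - E t / of_real (L\<^sup>2)" for t :: real
  have dE: "(E has_vector_derivative (\<i> * of_real L * E t)) (at t within S)" for t S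
  proof -
    have "((\<lambda>t. exp (\<i> * (of_real L * of_real t))) has_vector_derivative (\<i> * of_real L * exp (\<i> * (of_real L * of_real t)))) (at t within S)"
      by (rule has_vector_derivative_real_field) (auto intro!: derivative_eq_intros)
    then show ?thesis unfolding E_def[abs_def] by simp
  qed
  have dG: "(G has_vector_derivative f t) (at t within S)" for t S
  proof -
    have d1: "((\<lambda>t. of_real (y - t) :: complex) has_vector_derivative (- 1)) (at t within S)"
    proof -
      have "((\<lambda>t. of_real y - of_real t :: complex) has_vector_derivative (- 1)) (at t within S)"
        by (rule has_vector_derivative_real_field) (auto intro!: derivative_eq_intros)
      then show ?thesis by simp
    qed
    have "((\<lambda>t. of_real (y - t) * E t) has_vector_derivative (of_real (y - t) * (\<i> * of_real L * E t) + (- 1) * E t)) (at t within S)"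
      by (rule has_vector_derivative_mult[OF d1 dE])
    then have "(G has_vector_derivative ((of_real (y - t) * (\<i> * of_real L * E t) + (- 1) * E t) / (\<i> * of_real L) - (\<i> * of_real L * E t) / of_real (L\<^sup>2))) (at t within S)"
      unfolding G_def[abs_def] by (intro has_vector_derivative_diff has_vector_derivative_divide dE)
    moreover have "(of_real (y - t) * (\<i> * of_real L * E t) + (- 1) * E t) / (\<i> * of_real L) - (\<i> * of_real L * E t) / of_real (L\<^sup>2) = f t"
      using False by (simp add: f_def field_simps power2_eq_square)
    ultimately show ?thesis by simp
  qed
  have cf: "continuous_on S f" for S
    unfolding f_def[abs_def] E_def by (intro continuous_intros)
  have Gdiff: "G y - G 0 = - (E y - 1 - \<i> * of_real (L * y)) / of_real (L\<^sup>2)"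
    using False by (simp add: G_def E_def field_simps power2_eq_square)
  have mf: "f \<in> borel_measurable borel" by (rule borel_measurable_continuous_onI[OF cf])
  have mE: "E \<in> borel_measurable borel"
    unfolding E_def by (intro borel_measurable_continuous_onI continuous_intros)
  have mr: "(\<lambda>t. of_real (ramp y t) * E t) \<in> borel_measurable borel"
    using mE by measurable
  have AE0: "AE t in lborel. t \<noteq> (0::real)" by (rule AE_lborel_singleton)
  have "(\<integral>t. indicator {-1..1} t *\<^sub>R (of_real (ramp y t) * E t) \<partial>lborel) = G y - G 0"
  proof (cases "0 \<le> y")
    case True
    have "(\<integral>t. indicator {-1..1} t *\<^sub>R (of_real (ramp y t) * E t) \<partial>lborel) = (\<integral>t. indicator {0..y} t *\<^sub>R f t \<partial>lborel)"
    proof (rule integral_cong_AE)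
      show "AE t in lborel. indicator {-1..1} t *\<^sub>R (of_real (ramp y t) * E t) = indicator {0..y} t *\<^sub>R f t"
        using AE0 by eventually_elim
          (use y True in \<open>auto simp: ramp_def relu_def f_def sgn_if max_def split: split_indicator\<close>)
    qed (use mr mf in measurable)
    also have "\<dots> = G y - G 0" by (rule integral_FTC_Icc[OF True dG cf])
    finally show ?thesis .
  next
    case F: False
    then have y0: "y \<le> 0" by simp
    have "(\<integral>t. indicator {-1..1} t *\<^sub>R (of_real (ramp y t) * E t) \<partial>lborel) = (\<integral>t. - (indicator {y..0} t *\<^sub>R f t) \<partial>lborel)"
    proof (rule integral_cong_AE)
      show "AE t in lborel. indicator {-1..1} t *\<^sub>R (of_real (ramp y t) * E t) = - (indicator {y..0} t *\<^sub>R f t)"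
        using AE0 by eventually_elim
          (use y F in \<open>auto simp: ramp_def relu_def f_def sgn_if max_def algebra_simps split: split_indicator\<close>)
    qed (use mr mf in measurable)
    also have "\<dots> = - (\<integral>t. indicator {y..0} t *\<^sub>R f t \<partial>lborel)" by simp
    also have "\<dots> = - (G 0 - G y)" by (subst integral_FTC_Icc[OF y0 dG cf]) simp
    finally show ?thesis by simp
  qed
  then have "(\<integral>t. of_real (ramp y t) * E t \<partial>sym_unif) = (G y - G 0) / 2"
    unfolding integral_sym_unif[OF mr] by simp
  then have "- (of_real (2 * L\<^sup>2) * (\<integral>t. of_real (ramp y t) * E t \<partial>sym_unif)) = E y - 1 - \<i> * of_real (L * y)"
    unfolding Gdiff using False by (simp add: field_simps)
  then show ?thesis unfolding E_def by simp
qed simp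

lemma sets_total_variation [measurable_cong]: "sets (total_variation M F) = sets M"
  unfolding total_variation_def by (simp add: sets.space_closed sets.sigma_sets_eq)

lemma space_total_variation: "space (total_variation M F) = space M"
  by (rule sets_eq_imp_space_eq[OF sets_total_variation])

lemma polar_density_finite_measure:
  assumes "polar_density M F h"
  shows "finite_measure (total_variation M F)"
proof (rule finite_measureI)
  let ?\<tau> = "total_variation M F"
  have "integrable ?\<tau> h" and AE1: "AE \<omega> in ?\<tau>. cmod (h \<omega>) = 1"
    using assms by (auto simp: polar_density_def)
  then have "(\<integral>\<^sup>+\<omega>. ennreal (cmod (h \<omega>)) \<partial>?\<tau>) < \<infinity>" by (simp add: integrable_iff_bounded)
  moreover have "(\<integral>\<^sup>+\<omega>. ennreal (cmod (h \<omega>)) \<partial>?\<tau>) = (\<integral>\<^sup>+\<omega>. 1 \<partial>?\<tau>)"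
    using AE1 by (intro nn_integral_cong_AE) auto
  ultimately show "emeasure ?\<tau> (space ?\<tau>) \<noteq> \<infinity>" by simp
qed

text \<open>A Fourier representation admits a polar density for each point separately; by uniqueness one
  density serves all points.\<close>

lemma polar_density_unique:
  assumes "polar_density M F h" "polar_density M F h'"
  shows "AE \<omega> in total_variation M F. h \<omega> = h' \<omega>"
proof -
  interpret finite_measure "total_variation M F" using assms(1) by (rule polar_density_finite_measure)
  have *: "set_lebesgue_integral (total_variation M F) A u = F A"
    if "polar_density M F u" "A \<in> sets M" for u A
    using that unfolding polar_density_def set_lebesgue_integral_def
    by (simp add: scaleR_conv_of_real of_real_indicator)
  show ?thesis
    using assms * by (intro density_unique_banach) (auto simp: polar_density_def sets_total_variation)
qed

lemma dot_measurable [measurable]: "(\<lambda>\<omega>. dot d \<omega> x) \<in> borel_measurable (Rd d)"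
  unfolding dot_def Rd_def
  by (intro borel_measurable_sum borel_measurable_times borel_measurable_const measurable_component_singleton) auto

lemma l1_norm_measurable [measurable]: "l1_norm d \<in> borel_measurable (Rd d)"
  unfolding l1_norm_def[abs_def] Rd_def
  by (intro borel_measurable_sum borel_measurable_abs measurable_component_singleton) auto

lemma zero_vec_in_space: "zero_vec d \<in> space (Rd d)" "j < d \<Longrightarrow> (zero_vec d)(j := s) \<in> space (Rd d)"
  by (auto simp: zero_vec_def Rd_def space_PiM PiE_iff extensional_def)

lemma dot_axis: "j < d \<Longrightarrow> dot d \<omega> ((zero_vec d)(j := s)) = \<omega> j * s"
proof -
  assume j: "j < d"
  have "dot d \<omega> ((zero_vec d)(j := s)) = (\<Sum>i<d. if i = j then \<omega> j * s else 0)"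
    unfolding dot_def by (intro sum.cong) (auto simp: zero_vec_def)
  then show ?thesis using j by simp
qed

lemma dot_zero_vec: "dot d \<omega> (zero_vec d) = 0"
  by (simp add: dot_def zero_vec_def)

text \<open>The remainder of second order is bounded by the second spectral moment. Comparing coefficients at
  the origin along the axes, the gradient is the first moment of the complex measure, so the affine
  part can be subtracted under the integral.\<close>

lemma fourier_remainder:
  fixes ft :: "(nat \<Rightarrow> real) \<Rightarrow> real"
  assumes rep: "fourier_rep d ft F" and mom: "spectral_moment d 2 F < \<infinity>"
    and grad: "gradient_at_zero d ft v"
  obtains h where "polar_density (Rd d) F h" "integrable (total_variation (Rd d) F) (\<lambda>\<omega>. (l1_norm d \<omega>)\<^sup>2)"
    "\<And>x. x \<in> space (Rd d) \<Longrightarrow> \<bar>ft x\<bar> \<le> measure (total_variation (Rd d) F) (space (Rd d))"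
    "\<And>x. x \<in> space (Rd d) \<Longrightarrow> integrable (total_variation (Rd d) F)
        (\<lambda>\<omega>. (exp (\<i> * of_real (dot d \<omega> x)) - 1 - \<i> * of_real (dot d \<omega> x)) * h \<omega>)"
    "\<And>x. x \<in> space (Rd d) \<Longrightarrow> of_real (ft x - ft (zero_vec d) - dot d v x)
      = (\<integral>\<omega>. (exp (\<i> * of_real (dot d \<omega> x)) - 1 - \<i> * of_real (dot d \<omega> x)) * h \<omega> \<partial>total_variation (Rd d) F)"
proof -
  let ?\<tau> = "total_variation (Rd d) F"
  let ?e = "\<lambda>x \<omega>. exp (\<i> * complex_of_real (dot d \<omega> x))"
  have rep': "has_complex_measure_integral (Rd d) F (?e x) (of_real (ft x))" if "x \<in> space (Rd d)" for x
    using rep that by (simp add: fourier_rep_def)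
  obtain h where h: "polar_density (Rd d) F h"
    using rep'[OF zero_vec_in_space(1)] unfolding has_complex_measure_integral_def by auto
  interpret finite_measure ?\<tau> using h by (rule polar_density_finite_measure)
  have ih: "integrable ?\<tau> h" and AE1: "AE \<omega> in ?\<tau>. cmod (h \<omega>) = 1" using h by (auto simp: polar_density_def)
  have mh [measurable]: "h \<in> borel_measurable (Rd d)"
    using borel_measurable_integrable[OF ih] measurable_cong_sets[OF sets_total_variation refl] by blast
  have ft: "of_real (ft x) = (\<integral>\<omega>. ?e x \<omega> * h \<omega> \<partial>?\<tau>)" "integrable ?\<tau> (\<lambda>\<omega>. ?e x \<omega> * h \<omega>)"
    if x: "x \<in> space (Rd d)" for x
  proof -
    obtain h' where h': "polar_density (Rd d) F h'" "of_real (ft x) = (\<integral>\<omega>. ?e x \<omega> * h' \<omega> \<partial>?\<tau>)"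
      "integrable ?\<tau> (\<lambda>\<omega>. ?e x \<omega> * h' \<omega>)"
      using rep'[OF x] unfolding has_complex_measure_integral_def by auto
    have eq: "AE \<omega> in ?\<tau>. ?e x \<omega> * h' \<omega> = ?e x \<omega> * h \<omega>"
      using polar_density_unique[OF h'(1) h] by eventually_elim simp
    have m: "(\<lambda>\<omega>. ?e x \<omega> * h \<omega>) \<in> borel_measurable ?\<tau>"
      unfolding measurable_cong_sets[OF sets_total_variation refl]
      by (intro borel_measurable_times mh measurable_compose[OF dot_measurable] borel_measurable_continuous_onI continuous_intros)
    show "integrable ?\<tau> (\<lambda>\<omega>. ?e x \<omega> * h \<omega>)"
      by (rule integrable_cong_AE_imp[OF h'(3) m eq])
    show "of_real (ft x) = (\<integral>\<omega>. ?e x \<omega> * h \<omega> \<partial>?\<tau>)"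
      unfolding h'(2) by (rule integral_cong_AE[OF borel_measurable_integrable[OF h'(3)] m eq])
  qed
  have norm_h: "AE \<omega> in ?\<tau>. norm (u \<omega> * h \<omega>) = norm (u \<omega>)" for u :: "(nat \<Rightarrow> real) \<Rightarrow> complex"
    using AE1 by eventually_elim (simp add: norm_mult)
  have int_sq: "integrable ?\<tau> (\<lambda>\<omega>. (l1_norm d \<omega>)\<^sup>2)"
    using mom unfolding spectral_moment_def by (intro integrableI_nonneg) (auto intro!: AE_I2)
  have int_l1: "integrable ?\<tau> (l1_norm d)"
  proof (rule Bochner_Integration.integrable_bound[of _ "\<lambda>\<omega>. 1 + (l1_norm d \<omega>)\<^sup>2"])
    show "integrable ?\<tau> (\<lambda>\<omega>. 1 + (l1_norm d \<omega>)\<^sup>2)" using int_sq by simp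
    show "l1_norm d \<in> borel_measurable ?\<tau>" by measurable
    have "l1_norm d \<omega> \<le> 1 + (l1_norm d \<omega>)\<^sup>2" for \<omega>
    proof -
      have "0 \<le> (l1_norm d \<omega> - 1)\<^sup>2" by simp
      then have "2 * l1_norm d \<omega> \<le> 1 + (l1_norm d \<omega>)\<^sup>2" unfolding power2_diff by simp
      then show ?thesis using l1_norm_nonneg[of d \<omega>] by linarith
    qed
    then show "AE \<omega> in ?\<tau>. norm (l1_norm d \<omega>) \<le> norm (1 + (l1_norm d \<omega>)\<^sup>2)"
      by (intro AE_I2) (simp add: l1_norm_nonneg)
  qed
  have coord: "\<bar>\<omega> j\<bar> \<le> l1_norm d \<omega>" if "j < d" for \<omega> j
    unfolding l1_norm_def using that by (intro member_le_sum) auto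
  have mc [measurable]: "(\<lambda>\<omega>. \<omega> j) \<in> borel_measurable (Rd d)" if "j < d" for j
    unfolding Rd_def using that by (intro measurable_component_singleton) simp
  have int_c: "integrable ?\<tau> (\<lambda>\<omega>. \<i> * of_real (\<omega> j) * h \<omega>)" if j: "j < d" for j
  proof (rule Bochner_Integration.integrable_bound[OF int_l1])
    show "(\<lambda>\<omega>. \<i> * of_real (\<omega> j) * h \<omega>) \<in> borel_measurable ?\<tau>" using mc[OF j] by measurable
    show "AE \<omega> in ?\<tau>. norm (\<i> * of_real (\<omega> j) * h \<omega>) \<le> norm (l1_norm d \<omega>)"
      using norm_h[of "\<lambda>\<omega>. \<i> * of_real (\<omega> j)"] by eventually_elim
        (use coord[OF j] in \<open>auto simp: norm_mult intro: order_trans[OF _ abs_ge_self]\<close>)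
  qed
  have int_1: "integrable ?\<tau> (\<lambda>\<omega>. 1 * h \<omega>)" using ih by simp
  have ft0: "of_real (ft (zero_vec d)) = (\<integral>\<omega>. 1 * h \<omega> \<partial>?\<tau>)"
    using ft(1)[OF zero_vec_in_space(1)] by (simp add: dot_zero_vec)
  have taylor: "cmod (exp (\<i> * of_real z) - 1 - \<i> * of_real z) \<le> z\<^sup>2" for z :: real
  proof -
    have "2 * cmod (exp (\<i> * of_real z) - 1 - \<i> * of_real z) \<le> z\<^sup>2"
      using iexp_approx1[of z 1] by (simp add: power2_eq_square algebra_simps)
    with norm_ge_zero[of "exp (\<i> * of_real z) - 1 - \<i> * of_real z"] show ?thesis by linarith
  qed
  have vj: "of_real (v j) = (\<integral>\<omega>. \<i> * of_real (\<omega> j) * h \<omega> \<partial>?\<tau>)" if j: "j < d" for j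
  proof -
    define I where "I = (\<integral>\<omega>. \<i> * of_real (\<omega> j) * h \<omega> \<partial>?\<tau>)"
    define S where "S = (\<integral>\<omega>. (l1_norm d \<omega>)\<^sup>2 \<partial>?\<tau>)"
    let ?a = "\<lambda>s. (zero_vec d)(j := s)"
    have z: "?a 0 = zero_vec d" using j by (auto simp: zero_vec_def)
    have bound: "cmod (of_real (ft (?a s) - ft (zero_vec d)) - of_real s * I) \<le> s\<^sup>2 * S" for s
    proof -
      have "of_real (ft (?a s) - ft (zero_vec d)) - of_real s * I
        = (\<integral>\<omega>. ?e (?a s) \<omega> * h \<omega> - 1 * h \<omega> - of_real s * (\<i> * of_real (\<omega> j) * h \<omega>) \<partial>?\<tau>)"
        using ft[OF zero_vec_in_space(2)[OF j], of s] int_1 int_c[OF j] ft0 unfolding I_def by simp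
      also have "\<dots> = (\<integral>\<omega>. (exp (\<i> * of_real (\<omega> j * s)) - 1 - \<i> * of_real (\<omega> j * s)) * h \<omega> \<partial>?\<tau>)"
        by (intro Bochner_Integration.integral_cong) (simp_all add: dot_axis[OF j] algebra_simps)
      also have "cmod \<dots> \<le> (\<integral>\<omega>. s\<^sup>2 * (l1_norm d \<omega>)\<^sup>2 \<partial>?\<tau>)"
      proof -
        have le: "AE \<omega> in ?\<tau>. cmod ((exp (\<i> * of_real (\<omega> j * s)) - 1 - \<i> * of_real (\<omega> j * s)) * h \<omega>) \<le> s\<^sup>2 * (l1_norm d \<omega>)\<^sup>2"
          using norm_h[of "\<lambda>\<omega>. exp (\<i> * of_real (\<omega> j * s)) - 1 - \<i> * of_real (\<omega> j * s)"]
        proof eventually_elim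
          case (elim \<omega>)
          have "(\<omega> j)\<^sup>2 \<le> (l1_norm d \<omega>)\<^sup>2"
            using coord[OF j, of \<omega>] l1_norm_nonneg[of d \<omega>] by (intro abs_le_square_iff[THEN iffD1]) simp
          then have "(\<omega> j * s)\<^sup>2 \<le> s\<^sup>2 * (l1_norm d \<omega>)\<^sup>2"
            by (simp add: power_mult_distrib mult.commute mult_left_mono)
          with taylor[of "\<omega> j * s"] show ?case unfolding elim by linarith
        qed
        have i2: "integrable ?\<tau> (\<lambda>\<omega>. s\<^sup>2 * (l1_norm d \<omega>)\<^sup>2)" using int_sq by simp
        have "(\<lambda>\<omega>. (exp (\<i> * of_real (\<omega> j * s)) - 1 - \<i> * of_real (\<omega> j * s)) * h \<omega>) \<in> borel_measurable ?\<tau>"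
          using mc[OF j] by measurable
        then have i1: "integrable ?\<tau> (\<lambda>\<omega>. (exp (\<i> * of_real (\<omega> j * s)) - 1 - \<i> * of_real (\<omega> j * s)) * h \<omega>)"
          by (rule Bochner_Integration.integrable_bound[OF i2])
             (use le in \<open>eventually_elim, simp\<close>)
        show ?thesis
          by (rule order_trans[OF integral_norm_bound integral_mono_AE[OF integrable_norm[OF i1] i2 le]])
      qed
      finally show ?thesis by (simp add: S_def)
    qed
    have "((\<lambda>s. (ft (?a s) - ft (?a 0)) / (s - 0)) \<longlongrightarrow> v j) (at 0)"
      using grad j unfolding gradient_at_zero_def has_field_derivative_iff by auto
    then have t1: "((\<lambda>s. of_real ((ft (?a s) - ft (?a 0)) / (s - 0)) :: complex) \<longlongrightarrow> of_real (v j)) (at 0)"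
      by (rule tendsto_of_real)
    have "((\<lambda>s. of_real ((ft (?a s) - ft (?a 0)) / (s - 0)) - I) \<longlongrightarrow> 0) (at 0)"
    proof (rule Lim_null_comparison)
      show "\<forall>\<^sub>F s in at 0. norm (of_real ((ft (?a s) - ft (?a 0)) / (s - 0)) - I) \<le> \<bar>s\<bar> * S"
        unfolding eventually_at_filter
      proof (rule always_eventually, intro allI impI)
        fix s :: real assume s: "s \<noteq> 0"
        have "of_real ((ft (?a s) - ft (?a 0)) / (s - 0)) - I = (of_real (ft (?a s) - ft (zero_vec d)) - of_real s * I) / of_real s"
          using s unfolding z by (simp add: field_simps)
        then have "norm (of_real ((ft (?a s) - ft (?a 0)) / (s - 0)) - I) \<le> s\<^sup>2 * S / \<bar>s\<bar>"
          using bound[of s] by (simp add: norm_divide divide_right_mono)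
        also have "\<dots> = \<bar>s\<bar> * S" using s by (simp add: power2_eq_square abs_if)
        finally show "norm (of_real ((ft (?a s) - ft (?a 0)) / (s - 0)) - I) \<le> \<bar>s\<bar> * S" .
      qed
      show "((\<lambda>s. \<bar>s\<bar> * S) \<longlongrightarrow> 0) (at 0)" by (auto intro!: tendsto_eq_intros)
    qed
    then have "((\<lambda>s. of_real ((ft (?a s) - ft (?a 0)) / (s - 0))) \<longlongrightarrow> I) (at 0)"
      by (simp add: LIM_zero_iff)
    with t1 show ?thesis unfolding I_def[symmetric] using tendsto_unique[OF _ t1] by (metis at_neq_bot)
  qed
  have int_d: "integrable ?\<tau> (\<lambda>\<omega>. \<i> * of_real (dot d \<omega> x) * h \<omega>)"
    and dotv: "of_real (dot d v x) = (\<integral>\<omega>. \<i> * of_real (dot d \<omega> x) * h \<omega> \<partial>?\<tau>)" for x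
  proof -
    have eq: "(\<lambda>\<omega>. \<i> * of_real (dot d \<omega> x) * h \<omega>) = (\<lambda>\<omega>. \<Sum>j<d. of_real (x j) * (\<i> * of_real (\<omega> j) * h \<omega>))"
      unfolding dot_def by (simp add: sum_distrib_left sum_distrib_right ac_simps)
    have ic: "integrable ?\<tau> (\<lambda>\<omega>. of_real (x j) * (\<i> * of_real (\<omega> j) * h \<omega>))" if "j \<in> {..<d}" for j
      using int_c[of j] that by (intro integrable_mult_right) auto
    show "integrable ?\<tau> (\<lambda>\<omega>. \<i> * of_real (dot d \<omega> x) * h \<omega>)"
      unfolding eq by (intro Bochner_Integration.integrable_sum ic)
    have "(\<integral>\<omega>. \<i> * of_real (dot d \<omega> x) * h \<omega> \<partial>?\<tau>) = (\<Sum>j<d. \<integral>\<omega>. of_real (x j) * (\<i> * of_real (\<omega> j) * h \<omega>) \<partial>?\<tau>)"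
      unfolding eq by (rule Bochner_Integration.integral_sum[OF ic])
    also have "\<dots> = (\<Sum>j<d. of_real (x j) * of_real (v j))"
      using vj by (intro sum.cong refl) (simp del: integral_mult_right_zero add: integral_mult_right_zero)
    finally show "of_real (dot d v x) = (\<integral>\<omega>. \<i> * of_real (dot d \<omega> x) * h \<omega> \<partial>?\<tau>)"
      by (simp add: dot_def mult.commute)
  qed
  show ?thesis
  proof (rule that[OF h int_sq])
    fix x assume x: "x \<in> space (Rd d)"
    have "cmod (of_real (ft x)) \<le> (\<integral>\<omega>. norm (?e x \<omega> * h \<omega>) \<partial>?\<tau>)"
      unfolding ft(1)[OF x] by (rule integral_norm_bound)
    also have "\<dots> = (\<integral>\<omega>. 1 \<partial>?\<tau>)"
      using norm_h[of "?e x"] ft(2)[OF x] by (intro integral_cong_AE) (auto elim!: eventually_mono)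
    finally show "\<bar>ft x\<bar> \<le> measure ?\<tau> (space (Rd d))" by (simp add: space_total_variation)
    have "integrable ?\<tau> (\<lambda>\<omega>. ?e x \<omega> * h \<omega> - 1 * h \<omega> - \<i> * of_real (dot d \<omega> x) * h \<omega>)"
      using ft(2)[OF x] int_1 int_d by (intro Bochner_Integration.integrable_diff)
    then show "integrable ?\<tau> (\<lambda>\<omega>. (?e x \<omega> - 1 - \<i> * of_real (dot d \<omega> x)) * h \<omega>)"
      by (simp add: left_diff_distrib)
    have "of_real (ft x - ft (zero_vec d) - dot d v x)
        = (\<integral>\<omega>. ?e x \<omega> * h \<omega> - 1 * h \<omega> - \<i> * of_real (dot d \<omega> x) * h \<omega> \<partial>?\<tau>)"
      using ft[OF x] int_1 ft0 int_d dotv by simp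
    also have "\<dots> = (\<integral>\<omega>. (?e x \<omega> - 1 - \<i> * of_real (dot d \<omega> x)) * h \<omega> \<partial>?\<tau>)"
      by (simp add: left_diff_distrib)
    finally show "of_real (ft x - ft (zero_vec d) - dot d v x)
        = (\<integral>\<omega>. (?e x \<omega> - 1 - \<i> * of_real (dot d \<omega> x)) * h \<omega> \<partial>?\<tau>)" .
  qed
qed

lemma Re_complex_of_real_mult: "Re (complex_of_real a * z) = a * Re z"
  by simp

lemma nn_class_mono:
  assumes "a1 \<le> a1'" "a2 \<le> a2'" "a3 \<le> a3'" "a4 \<le> a4'"
  shows "nn_class d k a1 a2 a3 a4 \<phi> \<subseteq> nn_class d k a1' a2' a3' a4' \<phi>"
proof
  fix g assume "g \<in> nn_class d k a1 a2 a3 a4 \<phi>"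
  then obtain \<beta> w b w0 b0 where
    "\<And>i. i < k \<Longrightarrow> l1_norm d (w i) \<le> a1 \<and> \<bar>b i\<bar> \<le> a1 \<and> \<bar>\<beta> i\<bar> \<le> a2"
    "\<bar>b0\<bar> \<le> a3" "l1_norm d w0 \<le> a4" "g = net d k \<phi> \<beta> w b w0 b0"
    unfolding nn_class_iff by blast
  then show "g \<in> nn_class d k a1' a2' a3' a4' \<phi>"
    unfolding nn_class_iff using assms
    by (intro exI[of _ \<beta>] exI[of _ w] exI[of _ b] exI[of _ w0] exI[of _ b0]) (auto intro: order_trans)
qed

lemma set_sup_norm_cube_ge: "1 \<le> d \<Longrightarrow> 1 \<le> set_sup_norm d (cube d)"
proof -
  assume d: "1 \<le> d"
  have x: "(\<lambda>j\<in>{..<d}. 1) \<in> cube d" by (auto simp: cube_def)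
  have "1 = ennreal \<bar>(\<lambda>j\<in>{..<d}. 1::real) 0\<bar>" using d by simp
  also have "\<dots> \<le> (SUP j\<in>{..<d}. ennreal \<bar>(\<lambda>j\<in>{..<d}. 1::real) j\<bar>)" using d by (intro SUP_upper) auto
  also have "\<dots> \<le> set_sup_norm d (cube d)" unfolding set_sup_norm_def using x by (rule SUP_upper)
  finally show ?thesis .
qed

lemma l1_norm_scaled: "l1_norm d (\<lambda>j. s * u j / c) = \<bar>s\<bar> * l1_norm d u / \<bar>c\<bar>"
  by (simp add: l1_norm_def abs_mult abs_divide sum_distrib_left sum_divide_distrib)

text \<open>The mixing measure is the product of the normalised measure \<open>\<parallel>\<omega>\<parallel>\<^sub>1\<^sup>2 |F|(d\<omega>)\<close> and the uniform
  distribution of the kink. The phases of the polar density and of the Fourier mode go into the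
  outer weight, which is at most twice the second spectral moment. When this moment vanishes, the
  function is affine on the cube.\<close>

lemma fourier_mixture:
  assumes \<mu>: "prob_space \<mu>" and s: "sets \<mu> = sets (cube_borel d)" and k: "1 \<le> k"
    and rep: "fourier_rep d ft F" and mom: "spectral_moment d 2 F \<le> ennreal c" and c: "0 \<le> c"
    and grad: "gradient_at_zero d ft v" and ft0: "\<bar>ft (zero_vec d)\<bar> \<le> c" and v: "l1_norm d v \<le> c"
  shows "\<exists>g \<in> nn_class d k 1 (2 * c / real k) c c relu. (\<integral>x. (g x - ft x)\<^sup>2 \<partial>\<mu>) \<le> (4 * c)\<^sup>2 / real k"
    and "\<exists>B. \<forall>x\<in>space (Rd d). \<bar>ft x\<bar> \<le> B"
proof -
  let ?\<tau> = "total_variation (Rd d) F"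
  let ?T = "\<lambda>x \<omega>. exp (\<i> * complex_of_real (dot d \<omega> x)) - 1 - \<i> * complex_of_real (dot d \<omega> x)"
  have "spectral_moment d 2 F < \<infinity>" using mom by (rule order.strict_trans1) simp
  from fourier_remainder[OF rep this grad] obtain h where h: "polar_density (Rd d) F h"
    and int_sq: "integrable ?\<tau> (\<lambda>\<omega>. (l1_norm d \<omega>)\<^sup>2)"
    and bd_ft: "\<And>x. x \<in> space (Rd d) \<Longrightarrow> \<bar>ft x\<bar> \<le> measure ?\<tau> (space (Rd d))"
    and int_T: "\<And>x. x \<in> space (Rd d) \<Longrightarrow> integrable ?\<tau> (\<lambda>\<omega>. ?T x \<omega> * h \<omega>)"
    and rem: "\<And>x. x \<in> space (Rd d) \<Longrightarrow> of_real (ft x - ft (zero_vec d) - dot d v x) = (\<integral>\<omega>. ?T x \<omega> * h \<omega> \<partial>?\<tau>)"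
    by blast
  show "\<exists>B. \<forall>x\<in>space (Rd d). \<bar>ft x\<bar> \<le> B" using bd_ft by blast
  have cube_sub: "cube d \<subseteq> space (Rd d)" by (auto simp: cube_def Rd_def space_PiM PiE_iff)
  have ih: "integrable ?\<tau> h" and AE1: "AE \<omega> in ?\<tau>. cmod (h \<omega>) = 1" using h by (auto simp: polar_density_def)
  have mh [measurable]: "h \<in> borel_measurable (Rd d)"
    using borel_measurable_integrable[OF ih] measurable_cong_sets[OF sets_total_variation refl] by blast
  define S where "S = (\<integral>\<omega>. (l1_norm d \<omega>)\<^sup>2 \<partial>?\<tau>)"
  have nnS: "(\<integral>\<^sup>+\<omega>. ennreal ((l1_norm d \<omega>)\<^sup>2) \<partial>?\<tau>) = ennreal S"
    unfolding S_def by (rule nn_integral_eq_integral[OF int_sq]) simp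
  then have S: "S \<le> c" using mom c unfolding spectral_moment_def by simp
  have S0: "0 \<le> S" unfolding S_def by (rule integral_nonneg_AE) simp
  show "\<exists>g \<in> nn_class d k 1 (2 * c / real k) c c relu. (\<integral>x. (g x - ft x)\<^sup>2 \<partial>\<mu>) \<le> (4 * c)\<^sup>2 / real k"
  proof -
    have fin: ?thesis
      if "g \<in> nn_class d k 1 (2 * S / real k) \<bar>ft (zero_vec d)\<bar> (l1_norm d v) relu"
        "(\<integral>x. (g x - ft x)\<^sup>2 \<partial>\<mu>) \<le> (2 * (2 * S))\<^sup>2 / real k" for g
    proof -
      have "2 * S / real k \<le> 2 * c / real k" using S by (intro divide_right_mono) auto
      from nn_class_mono[OF order_refl this ft0 v] have "g \<in> nn_class d k 1 (2 * c / real k) c c relu"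
        using that(1) by blast
      moreover have "(2 * (2 * S))\<^sup>2 / real k \<le> (4 * c)\<^sup>2 / real k"
        using S S0 by (intro divide_right_mono power_mono) auto
      ultimately show ?thesis using that(2) by force
    qed
    show ?thesis
    proof (cases "S = 0")
      case True
      have "AE \<omega> in ?\<tau>. (l1_norm d \<omega>)\<^sup>2 = 0"
        using True int_sq unfolding S_def by (subst (asm) integral_nonneg_eq_0_iff_AE) auto
      then have AE0: "AE \<omega> in ?\<tau>. ?T x \<omega> * h \<omega> = 0" if x: "x \<in> cube d" for x
      proof eventually_elim
        case (elim \<omega>)
        then have "dot d \<omega> x = 0" using abs_dot_cube_le[OF x, of \<omega>] by simp
        then show ?case by simp
      qed
      have eq: "ft x = ft (zero_vec d) + dot d v x + (\<integral>\<theta>. 0 * relu (dot d (\<lambda>_. 0) x + 0) \<partial>sym_unif)" if x: "x \<in> cube d" for x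
      proof -
        have "complex_of_real (ft x - ft (zero_vec d) - dot d v x) = 0"
          unfolding rem[OF subsetD[OF cube_sub x]] using AE0[OF x] by (rule integral_eq_zero_AE)
        then have "ft x - ft (zero_vec d) - dot d v x = 0" by (simp only: of_real_eq_0_iff)
        then show ?thesis by simp
      qed
      have "\<exists>g \<in> nn_class d k 1 ((2 * S) / real k) \<bar>ft (zero_vec d)\<bar> (l1_norm d v) relu. (\<integral>x. (g x - ft x)\<^sup>2 \<partial>\<mu>) \<le> (2 * (2 * S))\<^sup>2 / real k"
        by (rule mixture_network[OF \<mu> s prob_space_sym_unif k, of "\<lambda>_. 0" "\<lambda>_ _. 0" "\<lambda>_. 0"])
           (use True eq in \<open>auto simp: l1_norm_def\<close>)
      then show ?thesis using fin by blast
    next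
      case False
      with S0 have Sp: "0 < S" by simp
      define \<tau>' where "\<tau>' = density ?\<tau> (\<lambda>\<omega>. ennreal ((l1_norm d \<omega>)\<^sup>2 / S))"
      have sets' [measurable_cong]: "sets \<tau>' = sets (Rd d)" by (simp add: \<tau>'_def sets_total_variation)
      have p\<tau>: "prob_space \<tau>'"
      proof
        have "emeasure \<tau>' (space \<tau>') = (\<integral>\<^sup>+\<omega>. ennreal ((l1_norm d \<omega>)\<^sup>2 / S) \<partial>?\<tau>)"
          unfolding \<tau>'_def by (subst emeasure_density) (auto intro!: nn_integral_cong)
        also have "\<dots> = ennreal (\<integral>\<omega>. (l1_norm d \<omega>)\<^sup>2 / S \<partial>?\<tau>)"
          using int_sq Sp by (intro nn_integral_eq_integral) auto
        also have "\<dots> = 1" using Sp by (simp add: S_def[symmetric])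
        finally show "emeasure \<tau>' (space \<tau>') = 1" .
      qed
      \<comment> \<open>The polar density has modulus one only almost everywhere, whereas outer weights have to be
        bounded at every parameter.\<close>
      define h1 where "h1 \<omega> = (if cmod (h \<omega>) \<le> 1 then h \<omega> else 0)" for \<omega>
      have mh1 [measurable]: "h1 \<in> borel_measurable (Rd d)" unfolding h1_def[abs_def] by measurable
      have h1b: "cmod (h1 \<omega>) \<le> 1" for \<omega> by (simp add: h1_def)
      let ?L = "l1_norm d"
      define cc where "cc \<theta> = - 2 * S * Re (h1 (fst \<theta>) * exp (\<i> * of_real (?L (fst \<theta>) * snd \<theta>)))"
        for \<theta> :: "(nat \<Rightarrow> real) \<times> real"
      define w where "w \<theta> = (\<lambda>j. sgn (snd \<theta>) * fst \<theta> j / ?L (fst \<theta>))" for \<theta> :: "(nat \<Rightarrow> real) \<times> real"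
      \<comment> \<open>Kinks outside the unit interval have probability zero; the cap keeps their biases admissible.\<close>
      define b where "b \<theta> = - min \<bar>snd \<theta>\<bar> 1" for \<theta> :: "(nat \<Rightarrow> real) \<times> real"
      let ?Q = "\<tau>' \<Otimes>\<^sub>M sym_unif"
      interpret P: pair_prob_space \<tau>' sym_unif
        by (intro pair_prob_space.intro pair_sigma_finite.intro prob_space_imp_sigma_finite p\<tau> prob_space_sym_unif)
      have Q: "prob_space ?Q" by (intro prob_space_pair p\<tau> prob_space_sym_unif)
      have mcc: "cc \<in> borel_measurable ?Q" unfolding cc_def[abs_def] by measurable
      have mb: "b \<in> borel_measurable ?Q" unfolding b_def[abs_def] by measurable
      have mw: "(\<lambda>\<theta>. w \<theta> j) \<in> borel_measurable ?Q" if "j < d" for j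
      proof -
        have [measurable]: "(\<lambda>\<omega>. \<omega> j) \<in> borel_measurable (Rd d)"
          unfolding Rd_def using that by (intro measurable_component_singleton) simp
        show ?thesis unfolding w_def by measurable
      qed
      have bcc: "\<bar>cc \<theta>\<bar> \<le> 2 * S" for \<theta>
      proof -
        have "\<bar>Re (h1 (fst \<theta>) * exp (\<i> * of_real (?L (fst \<theta>) * snd \<theta>)))\<bar> \<le> 1"
          by (rule order_trans[OF abs_Re_le_cmod]) (use h1b[of "fst \<theta>"] in \<open>simp add: norm_mult\<close>)
        then have "2 * S * \<bar>Re (h1 (fst \<theta>) * exp (\<i> * of_real (?L (fst \<theta>) * snd \<theta>)))\<bar> \<le> 2 * S * 1"
          using Sp by (intro mult_left_mono) auto
        then show ?thesis using Sp unfolding cc_def by (simp add: abs_mult)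
      qed
      have bw: "l1_norm d (w \<theta>) \<le> 1" for \<theta>
      proof -
        have "l1_norm d (w \<theta>) = \<bar>sgn (snd \<theta>)\<bar> * ?L (fst \<theta>) / \<bar>?L (fst \<theta>)\<bar>"
          unfolding w_def by (rule l1_norm_scaled)
        also have "\<dots> \<le> 1" by (simp add: abs_sgn_eq l1_norm_nonneg)
        finally show ?thesis .
      qed
      have eq: "ft x = ft (zero_vec d) + dot d v x + (\<integral>\<theta>. cc \<theta> * relu (dot d (w \<theta>) x + b \<theta>) \<partial>?Q)" if x: "x \<in> cube d" for x
      proof -
        have xR: "x \<in> space (Rd d)" using cube_sub x by blast
        define y where "y \<omega> = dot d \<omega> x / ?L \<omega>" for \<omega>
        have yb: "\<bar>y \<omega>\<bar> \<le> 1" for \<omega>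
          using abs_dot_cube_le[OF x, of \<omega>] l1_norm_nonneg[of d \<omega>]
          unfolding y_def by (cases "?L \<omega> = 0") (auto simp: abs_divide divide_le_eq)
        have Ly: "?L \<omega> * y \<omega> = dot d \<omega> x" for \<omega>
          using abs_dot_cube_le[OF x, of \<omega>] unfolding y_def by (cases "?L \<omega> = 0") auto
        have dw: "dot d (w (\<omega>, t)) x = sgn t * y \<omega>" for \<omega> t
          unfolding dot_def w_def y_def by (simp add: sum_distrib_left sum_divide_distrib ac_simps)
        define H where "H \<theta> = cc \<theta> * relu (dot d (w \<theta>) x + b \<theta>)" for \<theta>
        have mH: "H \<in> borel_measurable ?Q"
          unfolding H_def[abs_def] dot_def
          by (intro borel_measurable_times borel_measurable_add borel_measurable_sum mcc mb
              measurable_compose[OF _ activation_borel[OF activation_relu]] mw borel_measurable_const) auto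
        have bH: "\<bar>H \<theta>\<bar> \<le> 2 * S * 1" for \<theta>
        proof -
          have "\<bar>relu (dot d (w \<theta>) x + b \<theta>)\<bar> \<le> 1"
            using abs_dot_cube_le[OF x, of "w \<theta>"] bw[of \<theta>] unfolding relu_def b_def by (auto simp: max_def min_def)
          then show ?thesis unfolding H_def abs_mult using bcc Sp by (intro mult_mono) auto
        qed

        have iH: "integrable ?Q H" using mH bH by (intro P.P.integrable_bounded) auto
        have inner: "(?L \<omega>)\<^sup>2 / S * (\<integral>t. H (\<omega>, t) \<partial>sym_unif) = Re (?T x \<omega> * h1 \<omega>)" if \<omega>: "\<omega> \<in> space (Rd d)" for \<omega>
        proof -
          let ?E = "\<lambda>t. exp (\<i> * complex_of_real (?L \<omega> * t))"
          have "?E \<in> borel_measurable borel"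
            by (intro borel_measurable_continuous_onI continuous_intros)
          then have mR [measurable]: "(\<lambda>t. of_real (ramp (y \<omega>) t) * ?E t) \<in> borel_measurable borel"
            by measurable
          have bR: "cmod (of_real (ramp (y \<omega>) t) * ?E t) \<le> 1" for t
          proof -
            have "\<bar>sgn t * y \<omega>\<bar> \<le> 1" using yb[of \<omega>] by (auto simp: sgn_if)
            then have "\<bar>ramp (y \<omega>) t\<bar> \<le> 1" unfolding ramp_def relu_def by auto
            then show ?thesis by (simp add: norm_mult)
          qed
          have iR: "integrable sym_unif (\<lambda>t. of_real (ramp (y \<omega>) t) * ?E t)"
            using bR by (intro P.M2.integrable_const_bound[of _ 1] AE_I2) measurable
          have \<omega>': "\<omega> \<in> space \<tau>'" using \<omega> sets_eq_imp_space_eq[OF sets'] by simp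
          have mHt: "(\<lambda>t. H (\<omega>, t)) \<in> borel_measurable sym_unif" by (rule measurable_Pair2[OF mH \<omega>'])
          have "AE t in sym_unif. \<bar>t\<bar> \<le> 1"
            unfolding sym_unif_def by (subst AE_density) (auto simp: indicator_def split: if_splits)
          then have "AE t in sym_unif. H (\<omega>, t) = Re (- of_real (2 * S) * h1 \<omega> * (of_real (ramp (y \<omega>) t) * ?E t))"
          proof eventually_elim
            case (elim t)
            then have "b (\<omega>, t) = - \<bar>t\<bar>" by (simp add: b_def)
            then have "H (\<omega>, t) = - 2 * S * Re (h1 \<omega> * ?E t) * ramp (y \<omega>) t"
              unfolding H_def cc_def dw ramp_def by simp
            also have "\<dots> = Re (of_real (- 2 * S * ramp (y \<omega>) t) * (h1 \<omega> * ?E t))"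
              by (subst Re_complex_of_real_mult) simp
            finally show ?case by (simp add: ac_simps)
          qed
          then have "(\<integral>t. H (\<omega>, t) \<partial>sym_unif) = (\<integral>t. Re (- of_real (2 * S) * h1 \<omega> * (of_real (ramp (y \<omega>) t) * ?E t)) \<partial>sym_unif)"
            by (intro integral_cong_AE mHt) measurable
          also have "\<dots> = Re (\<integral>t. - of_real (2 * S) * h1 \<omega> * (of_real (ramp (y \<omega>) t) * ?E t) \<partial>sym_unif)"
            using iR by (intro integral_Re integrable_mult_right)
          also have "(\<integral>t. - of_real (2 * S) * h1 \<omega> * (of_real (ramp (y \<omega>) t) * ?E t) \<partial>sym_unif)
            = - of_real (2 * S) * h1 \<omega> * (\<integral>t. of_real (ramp (y \<omega>) t) * ?E t \<partial>sym_unif)" by simp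
          finally have 1: "(?L \<omega>)\<^sup>2 / S * (\<integral>t. H (\<omega>, t) \<partial>sym_unif)
            = Re (of_real ((?L \<omega>)\<^sup>2 / S) * (- of_real (2 * S) * h1 \<omega> * (\<integral>t. of_real (ramp (y \<omega>) t) * ?E t \<partial>sym_unif)))"
            by (simp only: Re_complex_of_real_mult)
          have "?T x \<omega> = - (of_real (2 * (?L \<omega>)\<^sup>2) * (\<integral>t. of_real (ramp (y \<omega>) t) * ?E t \<partial>sym_unif))"
            using exp_taylor_ramp[OF yb[of \<omega>], of "?L \<omega>"] unfolding Ly .
          moreover have "complex_of_real ((?L \<omega>)\<^sup>2 / S) * of_real (2 * S) = of_real (2 * (?L \<omega>)\<^sup>2)"
            using Sp by (simp only: of_real_mult[symmetric]) simp
          moreover have "u * (- v * z * I) = (- (u * v * I)) * z" for u v z I :: complex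
            by (simp add: ac_simps)
          ultimately show ?thesis unfolding 1 by (simp only:)
        qed
        have "(\<integral>\<theta>. H \<theta> \<partial>?Q) = (\<integral>\<omega>. \<integral>t. H (\<omega>, t) \<partial>sym_unif \<partial>\<tau>')"
          using P.integral_fst'[OF iH] by simp
        also have "\<dots> = (\<integral>\<omega>. (?L \<omega>)\<^sup>2 / S * (\<integral>t. H (\<omega>, t) \<partial>sym_unif) \<partial>?\<tau>)"
        proof -
          have "(\<lambda>\<omega>. \<integral>t. H (\<omega>, t) \<partial>sym_unif) \<in> borel_measurable \<tau>'"
            using borel_measurable_integrable[OF P.integrable_fst'[OF iH]] .
          then have "(\<lambda>\<omega>. \<integral>t. H (\<omega>, t) \<partial>sym_unif) \<in> borel_measurable ?\<tau>"
            using measurable_cong_sets[OF sets'[folded sets_total_variation[of "Rd d" F]] refl] by blast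
          then show ?thesis unfolding \<tau>'_def using Sp by (intro integral_real_density) auto
        qed
        also have "\<dots> = (\<integral>\<omega>. Re (?T x \<omega> * h1 \<omega>) \<partial>?\<tau>)"
          using inner by (intro Bochner_Integration.integral_cong) (auto simp: space_total_variation)
        also have "\<dots> = (\<integral>\<omega>. Re (?T x \<omega> * h \<omega>) \<partial>?\<tau>)"
        proof (rule integral_cong_AE)
          show "AE \<omega> in ?\<tau>. Re (?T x \<omega> * h1 \<omega>) = Re (?T x \<omega> * h \<omega>)"
            using AE1 by eventually_elim (simp add: h1_def)
        qed measurable
        also have "\<dots> = Re (\<integral>\<omega>. ?T x \<omega> * h \<omega> \<partial>?\<tau>)" by (rule integral_Re[OF int_T[OF xR]])
        also have "\<dots> = ft x - ft (zero_vec d) - dot d v x" unfolding rem[OF xR, symmetric] by simp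
        finally show ?thesis unfolding H_def by simp
      qed
      have "\<exists>g \<in> nn_class d k 1 ((2 * S) / real k) \<bar>ft (zero_vec d)\<bar> (l1_norm d v) relu. (\<integral>x. (g x - ft x)\<^sup>2 \<partial>\<mu>) \<le> (2 * (2 * S))\<^sup>2 / real k"
      proof (rule mixture_network[OF \<mu> s Q k mcc mw mb bcc bw _ _ eq])
        show "\<bar>b \<theta>\<bar> \<le> 1" for \<theta> by (simp add: b_def)
        show "0 \<le> 2 * S" using Sp by simp
      qed
      then show ?thesis using fin by blast
    qed
  qed
qed

text \<open>The infimum in the coefficient need not be attained, so there is an admissible constant below
  \<open>M + 1\<close>.\<close>

lemma kb_network:
  assumes \<mu>: "prob_space \<mu>" and s: "sets \<mu> = sets (cube_borel d)" and k: "1 \<le> k" and d: "1 \<le> d"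
    and kb: "kb_coeff d (cube d) f \<le> ereal M" and M: "0 \<le> M"
  defines "c \<equiv> M + 1"
  shows "\<exists>g \<in> nn_class d k 1 (2 * c / real k) c c relu. (\<integral>x. (g x - f x)\<^sup>2 \<partial>\<mu>) \<le> (4 * c)\<^sup>2 / real k"
    and "\<exists>B. \<forall>x\<in>cube d. \<bar>f x\<bar> \<le> B"
proof -
  have sp: "space \<mu> = cube d" using sets_eq_imp_space_eq[OF s] space_cube_borel by simp
  have cube_sub: "cube d \<subseteq> space (Rd d)" by (auto simp: cube_def Rd_def space_PiM PiE_iff)
  have "kb_coeff d (cube d) f < ereal c" using kb by (rule order.strict_trans1) (simp add: c_def)
  then obtain c' ft F v where c': "c' < c" "0 \<le> c'" and rep: "fourier_rep d ft F" and eq: "\<And>x. x \<in> cube d \<Longrightarrow> ft x = f x"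
    and mom: "set_sup_norm d (cube d) * spectral_moment d 2 F \<le> ennreal c'" and b: "\<bar>ft (zero_vec d)\<bar> \<le> c'"
    and grad: "gradient_at_zero d ft v" and v: "l1_norm d v \<le> c'"
    unfolding kb_coeff_def Inf_less_iff by auto
  have "spectral_moment d 2 F \<le> set_sup_norm d (cube d) * spectral_moment d 2 F"
    using mult_right_mono[OF set_sup_norm_cube_ge[OF d], of "spectral_moment d 2 F"] by simp
  also have "\<dots> \<le> ennreal c" using mom c' by (auto intro: order_trans ennreal_leI)
  finally have mom': "spectral_moment d 2 F \<le> ennreal c" .
  have c0: "0 \<le> c" using M by (simp add: c_def)
  note * = fourier_mixture[OF \<mu> s k rep mom' c0 grad]
  obtain g where g: "g \<in> nn_class d k 1 (2 * c / real k) c c relu" "(\<integral>x. (g x - ft x)\<^sup>2 \<partial>\<mu>) \<le> (4 * c)\<^sup>2 / real k"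
    using *(1) b v c' by force
  have "(\<integral>x. (g x - f x)\<^sup>2 \<partial>\<mu>) = (\<integral>x. (g x - ft x)\<^sup>2 \<partial>\<mu>)"
    by (intro Bochner_Integration.integral_cong) (auto simp: sp eq)
  then have "(\<integral>x. (g x - f x)\<^sup>2 \<partial>\<mu>) \<le> (4 * c)\<^sup>2 / real k" using g(2) by simp
  then show "\<exists>g \<in> nn_class d k 1 (2 * c / real k) c c relu. (\<integral>x. (g x - f x)\<^sup>2 \<partial>\<mu>) \<le> (4 * c)\<^sup>2 / real k"
    using g(1) by blast
  have "\<exists>B. \<forall>x\<in>space (Rd d). \<bar>ft x\<bar> \<le> B" using *(2) b v c' by force
  then show "\<exists>B. \<forall>x\<in>cube d. \<bar>f x\<bar> \<le> B" using eq cube_sub by (metis subsetD)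
qed

section \<open>From uniform deviations to the estimator\<close>

text \<open>The two summands of the objective as functions of the unclipped output of the network. Both are
  Lipschitz, so that contraction applies to them.\<close>

definition clip_fst :: "real \<Rightarrow> real \<Rightarrow> real" where
  "clip_fst t z = min (1 - t) z"

definition clip_snd :: "real \<Rightarrow> real \<Rightarrow> real" where
  "clip_snd t z = min (1 - t) z / (1 - min (1 - t) z)"

lemma clip_fst_lipschitz: "\<bar>clip_fst t a - clip_fst t b\<bar> \<le> 1 * \<bar>a - b\<bar>"
  by (auto simp: clip_fst_def min_def)

lemma clip_snd_lipschitz:
  assumes t: "0 < t"
  shows "\<bar>clip_snd t a - clip_snd t b\<bar> \<le> 1 / t\<^sup>2 * \<bar>a - b\<bar>"
proof -
  define u v where "u = 1 - min (1 - t) a" and "v = 1 - min (1 - t) b"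
  have uv: "t \<le> u" "t \<le> v" "\<bar>u - v\<bar> \<le> \<bar>a - b\<bar>" by (auto simp: u_def v_def min_def)
  have "clip_snd t a = 1 / u - 1" "clip_snd t b = 1 / v - 1"
    using uv t unfolding clip_snd_def u_def v_def by (auto simp: field_simps)
  then have "\<bar>clip_snd t a - clip_snd t b\<bar> = \<bar>u - v\<bar> / (u * v)"
    using uv t by (simp add: diff_frac_eq abs_divide abs_mult abs_minus_commute)
  also have "\<dots> \<le> \<bar>a - b\<bar> / t\<^sup>2"
    unfolding power2_eq_square using uv t by (intro frac_le mult_mono) auto
  finally show ?thesis by simp
qed

lemma clip_borel [measurable]: "clip_fst t \<in> borel_measurable borel" "clip_snd t \<in> borel_measurable borel"
  unfolding clip_fst_def[abs_def] clip_snd_def[abs_def] by measurable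

lemma integrable_lipschitz_image:
  fixes g :: "'a \<Rightarrow> real" and B L :: real
  assumes "prob_space \<mu>" "g \<in> borel_measurable \<mu>" "\<And>x. x \<in> space \<mu> \<Longrightarrow> \<bar>g x\<bar> \<le> B"
    "\<psi> \<in> borel_measurable borel" "\<And>a b. \<bar>\<psi> a - \<psi> b\<bar> \<le> L * \<bar>a - b\<bar>" "0 \<le> L"
  shows "integrable \<mu> (\<lambda>x. \<psi> (g x) :: real)"
proof -
  interpret prob_space \<mu> by fact
  have "\<bar>\<psi> (g x)\<bar> \<le> \<bar>\<psi> 0\<bar> + L * B" if "x \<in> space \<mu>" for x
  proof -
    have "L * \<bar>g x - 0\<bar> \<le> L * B" using assms(3)[OF that] assms(6) by (intro mult_left_mono) auto
    then show ?thesis using assms(5)[of "g x" 0] by linarith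
  qed
  then show ?thesis using measurable_compose[OF assms(2,4)] by (intro integrable_bounded) auto
qed

lemma mean_lipschitz_diff:
  fixes g g' :: "'a \<Rightarrow> real" and B L :: real
  assumes \<mu>: "prob_space \<mu>" and g: "g \<in> borel_measurable \<mu>" "\<And>x. x \<in> space \<mu> \<Longrightarrow> \<bar>g x\<bar> \<le> B"
    and g': "g' \<in> borel_measurable \<mu>" "\<And>x. x \<in> space \<mu> \<Longrightarrow> \<bar>g' x\<bar> \<le> B"
    and \<psi>: "\<psi> \<in> borel_measurable borel" "\<And>a b. \<bar>\<psi> a - \<psi> b\<bar> \<le> L * \<bar>a - b\<bar>" "0 \<le> L"
    and \<epsilon>: "\<And>x. x \<in> space \<mu> \<Longrightarrow> \<bar>g x - g' x\<bar> \<le> \<epsilon>"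
  shows "\<bar>(\<integral>x. \<psi> (g x) \<partial>\<mu>) - (\<integral>x. \<psi> (g' x) \<partial>\<mu>)\<bar> \<le> L * \<epsilon>"
proof -
  interpret prob_space \<mu> by fact
  have i: "integrable \<mu> (\<lambda>x. \<psi> (g x))" "integrable \<mu> (\<lambda>x. \<psi> (g' x))"
    by (rule integrable_lipschitz_image[where B = B and L = L]; use \<mu> g g' \<psi> in auto)+
  have "\<bar>\<psi> (g x) - \<psi> (g' x)\<bar> \<le> L * \<epsilon>" if "x \<in> space \<mu>" for x
    using \<psi>(2)[of "g x" "g' x"] mult_left_mono[OF \<epsilon>[OF that] \<psi>(3)] by linarith
  then have "\<bar>\<integral>x. \<psi> (g x) - \<psi> (g' x) \<partial>\<mu>\<bar> \<le> L * \<epsilon>"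
    using i by (intro abs_expectation_le) auto
  then show ?thesis using i by simp
qed

text \<open>No randomness is left here: \<open>D1\<close> and \<open>D2\<close> bound the deviations of the given samples over the net, and
  \<open>gs\<close> is a member of the class with small approximation error \<open>A\<close>.\<close>

lemma estimator_error:
  fixes C :: "('a \<Rightarrow> real) set" and n :: nat
  assumes \<mu>: "prob_space \<mu>" and \<nu>: "prob_space \<nu>" and p: "density_version \<mu> \<nu> p" and t: "0 < t"
    and C: "\<And>g. g \<in> C \<Longrightarrow> g \<in> borel_measurable \<nu>" "\<And>g x. g \<in> C \<Longrightarrow> x \<in> space \<nu> \<Longrightarrow> \<bar>g x\<bar> \<le> B"
    and G: "finite G" "G \<subseteq> C" "\<And>g. g \<in> C \<Longrightarrow> \<exists>g'\<in>G. \<forall>x\<in>space \<nu>. \<bar>g x - g' x\<bar> \<le> \<epsilon>"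
    and gs: "gs \<in> C" "hellinger2 \<mu> \<nu> - hellinger_functional \<mu> \<nu> (\<lambda>x. min (1 - t) (gs x)) \<le> A"
    and n: "1 \<le> n" and xy: "\<And>j. j < n \<Longrightarrow> x j \<in> space \<nu>" "\<And>j. j < n \<Longrightarrow> y j \<in> space \<nu>"
    and D1: "\<And>g. g \<in> G \<Longrightarrow> \<bar>\<Sum>j<n. clip_fst t (g (x j)) - (\<integral>z. clip_fst t (g z) \<partial>\<mu>)\<bar> \<le> D1"
    and D2: "\<And>g. g \<in> G \<Longrightarrow> \<bar>\<Sum>j<n. clip_snd t (g (y j)) - (\<integral>z. clip_snd t (g z) \<partial>\<nu>)\<bar> \<le> D2"
  shows "\<bar>hellinger2_est ((\<lambda>g x. min (1 - t) (g x)) ` C) n x y - hellinger2 \<mu> \<nu>\<bar>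
       \<le> \<bar>A\<bar> + (D1 + D2) / n + 2 * (1 + 1 / t\<^sup>2) * \<epsilon>"
proof -
  have se: "sets \<mu> = sets \<nu>" and sp: "space \<mu> = space \<nu>" using p by (auto simp: density_version_def)
  define J where "J g = (\<integral>z. clip_fst t (g z) \<partial>\<mu>) - (\<integral>z. clip_snd t (g z) \<partial>\<nu>)" for g
  define E where "E g = (\<Sum>j<n. clip_fst t (g (x j)) - clip_snd t (g (y j))) / n" for g
  define \<Delta> where "\<Delta> = (D1 + D2) / n + 2 * (1 + 1 / t\<^sup>2) * \<epsilon>"
  have J: "hellinger_functional \<mu> \<nu> (\<lambda>x. min (1 - t) (g x)) = J g" for g
    by (simp add: hellinger_functional_def J_def clip_fst_def clip_snd_def)
  have En: "E g * real n = (\<Sum>j<n. clip_fst t (g (x j)) - clip_snd t (g (y j)))" for g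
    unfolding E_def using n by simp
  have C\<mu>: "g \<in> borel_measurable \<mu>" if "g \<in> C" for g
    using C(1)[OF that] measurable_cong_sets[OF se refl] by blast
  have L0: "0 \<le> 1 / t\<^sup>2" by simp
  have dev: "\<bar>E g - J g\<bar> \<le> \<Delta>" if g: "g \<in> C" for g
  proof -
    obtain g' where g': "g' \<in> G" and close: "\<And>x. x \<in> space \<nu> \<Longrightarrow> \<bar>g x - g' x\<bar> \<le> \<epsilon>" using G(3)[OF g] by blast
    have g'C: "g' \<in> C" using g' G(2) by blast
    have "\<bar>(\<integral>z. clip_fst t (g z) \<partial>\<mu>) - (\<integral>z. clip_fst t (g' z) \<partial>\<mu>)\<bar> \<le> 1 * \<epsilon>"
      by (rule mean_lipschitz_diff[OF \<mu> C\<mu>[OF g] _ C\<mu>[OF g'C] _ clip_borel(1) clip_fst_lipschitz, of B])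
         (use C(2) g g'C close in \<open>auto simp: sp\<close>)
    moreover have "\<bar>(\<integral>z. clip_snd t (g z) \<partial>\<nu>) - (\<integral>z. clip_snd t (g' z) \<partial>\<nu>)\<bar> \<le> 1 / t\<^sup>2 * \<epsilon>"
      by (rule mean_lipschitz_diff[OF \<nu> C(1)[OF g] _ C(1)[OF g'C] _ clip_borel(2) clip_snd_lipschitz[OF t], of B])
         (use C(2) g g'C close in auto)
    ultimately have JJ: "\<bar>J g - J g'\<bar> \<le> (1 + 1 / t\<^sup>2) * \<epsilon>" unfolding J_def distrib_right by linarith
    have "\<bar>\<Sum>j<n. (clip_fst t (g (x j)) - clip_snd t (g (y j))) - (clip_fst t (g' (x j)) - clip_snd t (g' (y j)))\<bar>
        \<le> real n * ((1 + 1 / t\<^sup>2) * \<epsilon>)"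
    proof (rule abs_sum_lessThan_le)
      fix j assume j: "j < n"
      have "\<bar>clip_fst t (g (x j)) - clip_fst t (g' (x j))\<bar> \<le> 1 * \<epsilon>"
        by (rule order_trans[OF clip_fst_lipschitz]) (use close[OF xy(1)[OF j]] in simp)
      moreover have "\<bar>clip_snd t (g (y j)) - clip_snd t (g' (y j))\<bar> \<le> 1 / t\<^sup>2 * \<epsilon>"
        by (rule order_trans[OF clip_snd_lipschitz[OF t] mult_left_mono[OF close[OF xy(2)[OF j]] L0]])
      ultimately show "\<bar>(clip_fst t (g (x j)) - clip_snd t (g (y j))) - (clip_fst t (g' (x j)) - clip_snd t (g' (y j)))\<bar>
        \<le> (1 + 1 / t\<^sup>2) * \<epsilon>" unfolding distrib_right by linarith
    qed
    then have "\<bar>(E g - E g') * n\<bar> \<le> real n * ((1 + 1 / t\<^sup>2) * \<epsilon>)"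
      by (simp only: left_diff_distrib En sum_subtractf)
    then have EE: "\<bar>E g - E g'\<bar> \<le> (1 + 1 / t\<^sup>2) * \<epsilon>" using n by (simp add: abs_mult)
    have "(E g' - J g') * n = (\<Sum>j<n. clip_fst t (g' (x j)) - (\<integral>z. clip_fst t (g' z) \<partial>\<mu>))
        - (\<Sum>j<n. clip_snd t (g' (y j)) - (\<integral>z. clip_snd t (g' z) \<partial>\<nu>))"
      unfolding J_def left_diff_distrib En by (simp add: sum_subtractf algebra_simps)
    then have "\<bar>(E g' - J g') * n\<bar> \<le> D1 + D2" using D1[OF g'] D2[OF g'] by linarith
    then have "\<bar>E g' - J g'\<bar> * real n \<le> D1 + D2" by (simp only: abs_mult abs_of_nat)
    then have "\<bar>E g' - J g'\<bar> \<le> (D1 + D2) / n" using n by (simp add: pos_le_divide_eq)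
    then show ?thesis using JJ EE unfolding \<Delta>_def by linarith
  qed
  have JH: "J g \<le> hellinger2 \<mu> \<nu>" if g: "g \<in> C" for g
    unfolding J[symmetric]
  proof (rule hellinger_functional_le[OF \<mu> \<nu> p _ _ _ t, of _ "\<bar>1 - t\<bar> + B"])
    show "(\<lambda>x. min (1 - t) (g x)) \<in> borel_measurable \<nu>" using C(1)[OF g] by measurable
    show "\<bar>min (1 - t) (g x)\<bar> \<le> \<bar>1 - t\<bar> + B" if "x \<in> space \<nu>" for x
      using C(2)[OF g that] by (auto simp: min_def)
  qed auto
  have est: "hellinger2_est ((\<lambda>g x. min (1 - t) (g x)) ` C) n x y = (SUP g\<in>C. E g)"
    unfolding hellinger2_est_def image_image E_def clip_fst_def clip_snd_def ..
  have up: "E g \<le> hellinger2 \<mu> \<nu> + \<Delta>" if "g \<in> C" for g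
    using dev[OF that] JH[OF that] by linarith
  have "(SUP g\<in>C. E g) \<le> hellinger2 \<mu> \<nu> + \<Delta>"
    using gs(1) up by (intro cSUP_least) auto
  moreover have "E gs \<le> (SUP g\<in>C. E g)"
    using gs(1) up by (intro cSUP_upper) (auto intro!: bdd_aboveI2)
  moreover have "hellinger2 \<mu> \<nu> - A - \<Delta> \<le> E gs"
    using dev[OF gs(1)] gs(2) unfolding J by linarith
  ultimately show ?thesis unfolding est \<Delta>_def[symmetric] add.assoc by linarith
qed

section \<open>The risk bound\<close>

lemma nn_integral_prob_fst:
  assumes "prob_space A" "prob_space B" "f \<in> borel_measurable A"
  shows "(\<integral>\<^sup>+z. f (fst z) \<partial>(A \<Otimes>\<^sub>M B)) = (\<integral>\<^sup>+x. f x \<partial>A)"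
proof -
  interpret A: prob_space A by fact
  interpret B: prob_space B by fact
  show ?thesis
    using B.nn_integral_fst[of "\<lambda>z. f (fst z)" A] measurable_compose[OF measurable_fst[of A B] assms(3)]
    by (simp add: B.emeasure_space_1)
qed

lemma nn_integral_prob_snd:
  assumes "prob_space A" "prob_space B" "f \<in> borel_measurable B"
  shows "(\<integral>\<^sup>+z. f (snd z) \<partial>(A \<Otimes>\<^sub>M B)) = (\<integral>\<^sup>+x. f x \<partial>B)"
proof -
  interpret A: prob_space A by fact
  interpret B: prob_space B by fact
  show ?thesis
    using B.nn_integral_fst[of "\<lambda>z. f (snd z)" A] measurable_compose[OF measurable_snd[of A B] assms(3)]
    by (simp add: A.emeasure_space_1)
qed

text \<open>The mesh \<open>\<epsilon>\<close> of the net can be as small as the deviation bound itself, because that bound does not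
  depend on the size of the net.\<close>

lemma expected_error_le:
  fixes n :: nat
  assumes pq: "(\<mu>, \<nu>) \<in> prob_pairs d" and p: "density_version \<mu> \<nu> p" and n: "1 \<le> n" and k: "1 \<le> k" and d: "1 \<le> d"
    and a: "0 < a" and t: "0 < t"
    and gs: "gs \<in> nn_class d k 1 (2 * a / real k) a a relu"
      "hellinger2 \<mu> \<nu> - hellinger_functional \<mu> \<nu> (\<lambda>x. min (1 - t) (gs x)) \<le> A" and A: "0 \<le> A"
  shows "expected_error (nn_relu d k t a) n \<mu> \<nu> \<le> ennreal (A + 42 * (1 + 1 / t\<^sup>2) * a * (real d + 1) / sqrt n)"
proof -
  have \<mu>: "prob_space \<mu>" and \<nu>: "prob_space \<nu>" and s\<mu>: "sets \<mu> = sets (cube_borel d)" and s\<nu>: "sets \<nu> = sets (cube_borel d)"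
    using pq by (auto simp: prob_pairs_def)
  have sp\<mu>: "space \<mu> = cube d" and sp\<nu>: "space \<nu> = cube d"
    using sets_eq_imp_space_eq[OF s\<mu>] sets_eq_imp_space_eq[OF s\<nu>] space_cube_borel by auto
  let ?C = "nn_class d k 1 (2 * a / real k) a a relu"
  let ?M = "Pi\<^sub>M {..<n} (\<lambda>_. \<mu>)" and ?N = "Pi\<^sub>M {..<n} (\<lambda>_. \<nu>)"
  interpret M: prob_space ?M by (intro prob_space_PiM \<mu>)
  interpret N: prob_space ?N by (intro prob_space_PiM \<nu>)
  interpret MN: prob_space "?M \<Otimes>\<^sub>M ?N" by (intro prob_space_pair M.prob_space_axioms N.prob_space_axioms)
  define L where "L = 1 / t\<^sup>2"
  have L0: "0 \<le> L" by (simp add: L_def)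
  define R where "R = a * (real d + 1) / sqrt n"
  have R0: "0 < R" using a n by (simp add: R_def)
  define \<epsilon> where "\<epsilon> = R"
  define h where "h = \<epsilon> / (real k * (3 + 2 * a / real k * (real d + 1)) + real d + 1)"
  have den: "0 < real k * (3 + 2 * a / real k * (real d + 1)) + real d + 1"
    using a by (intro add_nonneg_pos add_nonneg_nonneg mult_nonneg_nonneg) auto
  have h0: "0 < h" using R0 den by (simp add: h_def \<epsilon>_def)
  define N where "N = nat \<lceil>(1 + a + 2 * a / real k) / h\<rceil>"
  have "(1 + a + 2 * a / real k) / h \<le> real N" unfolding N_def by linarith
  then have hN: "1 + a + 2 * a / real k \<le> h * real N" using h0 by (simp add: field_simps)
  have ak: "0 \<le> 2 * a / real k" using a by simp
  have N1: "1 \<le> h * real N" and N2: "2 * a / real k \<le> h * real N" and N3: "a \<le> h * real N"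
    using hN ak a by linarith+
  have "\<exists>G0. finite G0 \<and> G0 \<subseteq> ?C \<and> (\<forall>g\<in>?C. \<exists>g'\<in>G0. \<forall>x\<in>cube d.
      \<bar>g x - g' x\<bar> \<le> h * (real k * (3 + 2 * a / real k * (real d + 1)) + real d + 1))"
    by (rule nn_class_finite_net[OF activation_relu h0 order_refl N1 N2 N3 N3, of d k]) blast
  then obtain G0 where G0: "finite G0" "G0 \<subseteq> ?C"
    "\<And>g. g \<in> ?C \<Longrightarrow> \<exists>g'\<in>G0. \<forall>x\<in>cube d. \<bar>g x - g' x\<bar> \<le> h * (real k * (3 + 2 * a / real k * (real d + 1)) + real d + 1)"
    by blast
  have heps: "h * (real k * (3 + 2 * a / real k * (real d + 1)) + real d + 1) = \<epsilon>"
    using den by (simp add: h_def)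
  have z: "(\<lambda>_. 0) \<in> ?C"
    unfolding nn_class_iff using a
    by (intro exI[of _ "\<lambda>_. 0"] exI[of _ "\<lambda>_ _. 0"] exI[of _ 0]) (auto simp: l1_norm_def net_def dot_def fun_eq_iff)
  define G where "G = insert (\<lambda>_. 0) G0"
  have G: "finite G" "G \<subseteq> ?C" "(\<lambda>_. 0) \<in> G" using G0 z by (auto simp: G_def)
  have Gnet: "\<exists>g'\<in>G. \<forall>x\<in>space \<nu>. \<bar>g x - g' x\<bar> \<le> \<epsilon>" if "g \<in> ?C" for g
    using G0(3)[OF that] unfolding heps sp\<nu> G_def by blast
  define D1 where "D1 x = fmax G (\<lambda>g. \<bar>\<Sum>j<n. clip_fst t (g (x j)) - (\<integral>z. clip_fst t (g z) \<partial>\<mu>)\<bar>)" for x :: "nat \<Rightarrow> nat \<Rightarrow> real"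
  define D2 where "D2 y = fmax G (\<lambda>g. \<bar>\<Sum>j<n. clip_snd t (g (y j)) - (\<integral>z. clip_snd t (g z) \<partial>\<nu>)\<bar>)" for y :: "nat \<Rightarrow> nat \<Rightarrow> real"
  have a0: "0 \<le> a" using a by simp
  note dev1 = expected_net_deviation_le[OF \<mu> s\<mu> n k a0 G clip_borel(1)[of t] clip_fst_lipschitz[of t] zero_le_one, folded D1_def]
  note dev2 = expected_net_deviation_le[OF \<nu> s\<nu> n k a0 G clip_borel(2)[of t] clip_snd_lipschitz[OF t], folded D2_def L_def, OF L0]
  have D1: "(\<integral>x. D1 x \<partial>?M) \<le> 20 * 1 * a * (real d + 1) * sqrt n" "integrable ?M D1"
    using dev1 by (simp_all add: D1_def[abs_def])
  have D2: "(\<integral>x. D2 x \<partial>?N) \<le> 20 * L * a * (real d + 1) * sqrt n" "integrable ?N D2"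
    using dev2 by (simp_all add: D2_def[abs_def])
  have D0: "0 \<le> D1 x" "0 \<le> D2 x" for x
    unfolding D1_def D2_def by (intro order_trans[OF abs_ge_zero fmax_ge[OF G(1,3)]])+
  \<comment> \<open>In units of the mesh \<open>\<epsilon>\<close>, the first sample contributes 20, the second \<open>20 * L\<close>, and the mesh itself
    \<open>2 * (1 + L)\<close>.\<close>
  define K where "K = A + 2 * (1 + L) * \<epsilon>"
  have K0: "0 \<le> K" using A L0 R0 by (simp add: K_def \<epsilon>_def)
  have pt: "\<bar>hellinger2_est (nn_relu d k t a) n (fst z) (snd z) - hellinger2 \<mu> \<nu>\<bar> \<le> K + D1 (fst z) / n + D2 (snd z) / n"
    if z: "z \<in> space (?M \<Otimes>\<^sub>M ?N)" for z
  proof -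
    from z have "fst z \<in> space ?M" "snd z \<in> space ?N"
      unfolding space_pair_measure by (simp_all add: mem_Times_iff)
    then have zM: "fst z \<in> {..<n} \<rightarrow>\<^sub>E space \<nu>" and zN: "snd z \<in> {..<n} \<rightarrow>\<^sub>E space \<nu>"
      by (simp_all only: space_PiM sp\<mu> sp\<nu>)
    have xs: "fst z j \<in> space \<nu>" "snd z j \<in> space \<nu>" if "j < n" for j
      using PiE_mem[OF zM, of j] PiE_mem[OF zN, of j] that by simp_all
    have "\<bar>hellinger2_est ((\<lambda>g x. min (1 - t) (g x)) ` ?C) n (fst z) (snd z) - hellinger2 \<mu> \<nu>\<bar>
       \<le> \<bar>A\<bar> + (D1 (fst z) + D2 (snd z)) / n + 2 * (1 + 1 / t\<^sup>2) * \<epsilon>"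
    proof (rule estimator_error[OF \<mu> \<nu> p t _ _ G(1,2) Gnet gs n xs])
      show "g \<in> borel_measurable \<nu>" if "g \<in> ?C" for g
        by (rule nn_class_measurable[OF activation_relu s\<nu> that])
      show "\<bar>g x\<bar> \<le> real k * (2 * a / real k * (1 + 2 * 1)) + a + a" if "g \<in> ?C" "x \<in> space \<nu>" for g x
        using nn_class_bound[OF activation_relu that(1)] that(2) unfolding sp\<nu> by blast
      show "\<bar>\<Sum>j<n. clip_fst t (g (fst z j)) - (\<integral>z. clip_fst t (g z) \<partial>\<mu>)\<bar> \<le> D1 (fst z)" if "g \<in> G" for g
        unfolding D1_def by (rule fmax_ge[OF G(1) that])
      show "\<bar>\<Sum>j<n. clip_snd t (g (snd z j)) - (\<integral>z. clip_snd t (g z) \<partial>\<nu>)\<bar> \<le> D2 (snd z)" if "g \<in> G" for g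
        unfolding D2_def by (rule fmax_ge[OF G(1) that])
    qed
    then show ?thesis
      using A unfolding nn_relu_def clipped_nn_class_def K_def L_def by (simp add: add_divide_distrib)
  qed
  have mD: "D1 \<in> borel_measurable ?M" "D2 \<in> borel_measurable ?N" using D1(2) D2(2) by auto
  have mE1: "(\<lambda>x. ennreal (D1 x / n)) \<in> borel_measurable ?M" and mE2: "(\<lambda>x. ennreal (D2 x / n)) \<in> borel_measurable ?N"
    by (intro measurable_compose[OF _ measurable_ennreal] borel_measurable_divide borel_measurable_const mD)+
  have m1: "(\<lambda>z. ennreal (D1 (fst z) / n)) \<in> borel_measurable (?M \<Otimes>\<^sub>M ?N)"
    by (rule measurable_compose[OF measurable_fst mE1])
  have m2: "(\<lambda>z. ennreal (D2 (snd z) / n)) \<in> borel_measurable (?M \<Otimes>\<^sub>M ?N)"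
    by (rule measurable_compose[OF measurable_snd mE2])
  have "expected_error (nn_relu d k t a) n \<mu> \<nu> \<le> (\<integral>\<^sup>+z. (ennreal K + ennreal (D1 (fst z) / n)) + ennreal (D2 (snd z) / n) \<partial>(?M \<Otimes>\<^sub>M ?N))"
    unfolding expected_error_def
  proof (rule nn_integral_mono)
    fix z assume "z \<in> space (?M \<Otimes>\<^sub>M ?N)"
    from ennreal_leI[OF pt[OF this]]
    show "ennreal \<bar>hellinger2_est (nn_relu d k t a) n (fst z) (snd z) - hellinger2 \<mu> \<nu>\<bar>
       \<le> (ennreal K + ennreal (D1 (fst z) / n)) + ennreal (D2 (snd z) / n)"
      using K0 D0 by (simp add: ennreal_plus[symmetric] del: ennreal_plus)
  qed
  also have "\<dots> = (ennreal K + (\<integral>\<^sup>+z. ennreal (D1 (fst z) / n) \<partial>(?M \<Otimes>\<^sub>M ?N))) + (\<integral>\<^sup>+z. ennreal (D2 (snd z) / n) \<partial>(?M \<Otimes>\<^sub>M ?N))"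
    using m1 m2 by (simp add: nn_integral_add MN.emeasure_space_1)
  also have "(\<integral>\<^sup>+z. ennreal (D1 (fst z) / n) \<partial>(?M \<Otimes>\<^sub>M ?N)) = (\<integral>\<^sup>+x. ennreal (D1 x / n) \<partial>?M)"
    by (rule nn_integral_prob_fst[OF M.prob_space_axioms N.prob_space_axioms mE1])
  also have "\<dots> = ennreal (\<integral>x. D1 x / n \<partial>?M)"
    using D1(2) D0 by (intro nn_integral_eq_integral) auto
  also have "(\<integral>\<^sup>+z. ennreal (D2 (snd z) / n) \<partial>(?M \<Otimes>\<^sub>M ?N)) = (\<integral>\<^sup>+x. ennreal (D2 x / n) \<partial>?N)"
    by (rule nn_integral_prob_snd[OF M.prob_space_axioms N.prob_space_axioms mE2])
  also have "\<dots> = ennreal (\<integral>x. D2 x / n \<partial>?N)"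
    using D2(2) D0 by (intro nn_integral_eq_integral) auto
  finally have "expected_error (nn_relu d k t a) n \<mu> \<nu> \<le> ennreal (K + (\<integral>x. D1 x \<partial>?M) / n + (\<integral>x. D2 x \<partial>?N) / n)"
    using K0 D0 by (simp add: ennreal_plus[symmetric] integral_nonneg_AE del: ennreal_plus)
  also have "\<dots> \<le> ennreal (A + 42 * (1 + 1 / t\<^sup>2) * a * (real d + 1) / sqrt n)"
  proof (rule ennreal_leI)
    define r where "r = sqrt n"
    have r: "real n = r * r" "0 < r" using n by (auto simp: r_def)
    have "(\<integral>x. D1 x \<partial>?M) / n \<le> 20 * 1 * a * (real d + 1) * sqrt n / n" using D1(1) by (intro divide_right_mono) auto
    also have "\<dots> = 20 * R" unfolding R_def r_def[symmetric] r(1) using r(2) by (simp add: field_simps)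
    finally have 1: "(\<integral>x. D1 x \<partial>?M) / n \<le> 20 * R" .
    have "(\<integral>x. D2 x \<partial>?N) / n \<le> 20 * L * a * (real d + 1) * sqrt n / n" using D2(1) by (intro divide_right_mono) auto
    also have "\<dots> = 20 * L * R" unfolding R_def r_def[symmetric] r(1) using r(2) by (simp add: field_simps)
    finally have 2: "(\<integral>x. D2 x \<partial>?N) / n \<le> 20 * L * R" .
    have 3: "A + 42 * (1 + 1 / t\<^sup>2) * a * (real d + 1) / sqrt n = A + 42 * (1 + L) * R"
      by (simp add: R_def L_def)
    have "0 \<le> L * R" using L0 R0 by simp
    then show "K + (\<integral>x. D1 x \<partial>?M) / n + (\<integral>x. D2 x \<partial>?N) / n \<le> A + 42 * (1 + 1 / t\<^sup>2) * a * (real d + 1) / sqrt n"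
      using 1 2 R0 unfolding 3 K_def \<epsilon>_def by (simp add: algebra_simps)
  qed
  finally show ?thesis .
qed

lemma ess_sup_norm_AE:
  assumes "dominating \<eta> \<mu> \<nu>" "ess_sup_norm \<eta> p \<le> ereal M"
  shows "AE x in \<mu>. p x \<le> M"
proof -
  have "AE x in \<eta>. ereal \<bar>p x\<bar> \<le> ess_sup_norm \<eta> p" unfolding ess_sup_norm_def by (rule esssup_AE)
  then have "AE x in \<eta>. p x \<le> M"
  proof eventually_elim
    case (elim x)
    then have "ereal \<bar>p x\<bar> \<le> ereal M" using assms(2) by (rule order_trans)
    then show ?case by simp
  qed
  then show ?thesis
    using assms(1) by (auto simp: dominating_def intro: absolutely_continuous_AE)
qed

text \<open>If \<open>ln k\<close> is at least \<open>M + 2\<close>, the network from the Fourier representation fits into the class and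
  the clipping level lies above \<open>f_H2 p\<close>. For each of the finitely many other \<open>k\<close>, the zero network falls
  short of the maximum by at most 4, while \<open>k powr (-1/2) * ln k\<close> is bounded below in terms of \<open>M\<close>.\<close>

lemma risk_bound:
  fixes M :: real
  assumes M: "0 \<le> M"
  shows "\<exists>C::real. \<forall>d k n :: nat. 1 \<le> d \<longrightarrow> 2 \<le> k \<longrightarrow> 1 \<le> n \<longrightarrow>
            (SUP (\<mu>, \<nu>)\<in>prob_pairs_bounded M d.
               expected_error (nn_relu d k (1 / ln (real k)) (ln (real k))) n \<mu> \<nu>)
             \<le> ennreal (C * (real d powr (1/2) * real k powr (-1/2) * ln (real k)
                            + real d powr (3/2) * ln (real k) ^ 3 * real n powr (-1/2)))"
proof -
  define c where "c = M + 1"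
  \<comment> \<open>\<open>C1\<close> pays for the small \<open>k\<close>; \<open>C2\<close> comes from \<open>1 \<le> (ln k / ln 2)\<^sup>2\<close> and \<open>d + 1 \<le> 2 * d powr (3/2)\<close>.\<close>
  define C1 :: real where "C1 = 4 * exp ((M + 2) / 2) / ln 2"
  define C2 :: real where "C2 = 84 * (1 + 1 / (ln 2)\<^sup>2)"
  define C :: real where "C = (4 * c)\<^sup>2 + C1 + C2"
  have ln2: "0 < ln (2::real)" by simp
  have C1: "0 \<le> C1" unfolding C1_def by simp
  have C2: "0 \<le> C2" unfolding C2_def by simp
  show ?thesis
  proof (intro exI[of _ C] allI impI)
    fix d k n :: nat assume d: "1 \<le> d" and k: "2 \<le> k" and n: "1 \<le> n"
    define a where "a = ln (real k)"
    define t where "t = 1 / a"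
    have a2: "ln 2 \<le> a" unfolding a_def using k by simp
    then have a0: "0 < a" using ln2 by linarith
    have t0: "0 < t" using a0 by (simp add: t_def)
    have half: "1 / 2 \<le> ln (2::real)" by (subst ln_ge_iff) (use exp_half_le2 in auto)
    have t2: "t \<le> 2" unfolding t_def using a2 half a0 by (simp add: divide_le_eq)
    define q where "q = real d powr (1/2) * real k powr (-1/2) * a"
    define r where "r = real d powr (3/2) * a ^ 3 * real n powr (-1/2)"
    have q_ge: "real k powr (-1/2) * a \<le> q"
    proof -
      have "1 \<le> real d powr (1/2)" using d by (intro ge_one_powr_ge_zero) auto
      then have "1 * (real k powr (-1/2) * a) \<le> real d powr (1/2) * (real k powr (-1/2) * a)"
        using a0 by (intro mult_right_mono) auto
      then show ?thesis unfolding q_def by (simp add: ac_simps)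
    qed
    define A where "A = (if M + 2 \<le> a then (4 * c)\<^sup>2 / real k * a else 4)"
    have A0: "0 \<le> A" unfolding A_def using a0 by auto
    have A_le: "A \<le> ((4 * c)\<^sup>2 + C1) * q"
    proof (cases "M + 2 \<le> a")
      case True
      have "1 / real k = real k powr (-1)" using k by (simp add: powr_minus_divide)
      also have "\<dots> \<le> real k powr (-1/2)" using k by (intro powr_mono) auto
      finally have "(4 * c)\<^sup>2 * (1 / real k * a) \<le> (4 * c)\<^sup>2 * (real k powr (-1/2) * a)"
        using a0 by (intro mult_left_mono mult_right_mono) auto
      also have "\<dots> \<le> (4 * c)\<^sup>2 * q" by (intro mult_left_mono q_ge) simp
      also have "\<dots> \<le> ((4 * c)\<^sup>2 + C1) * q"
        using C1 order_trans[OF _ q_ge] a0 by (intro mult_right_mono) auto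
      finally show ?thesis using True by (simp add: A_def)
    next
      case False
      have "real k powr (-1/2) = exp (- a / 2)" using k by (simp add: powr_def a_def)
      then have "exp (- (M + 2) / 2) * ln 2 \<le> real k powr (-1/2) * a"
        using False a2 ln2 by (intro mult_mono) auto
      then have ge: "exp (- (M + 2) / 2) * ln 2 \<le> q" using q_ge by linarith
      have "C1 * (exp (- (M + 2) / 2) * ln 2) = 4"
      proof -
        have "exp ((M + 2) / 2) * exp (- (M + 2) / 2) = 1"
          unfolding mult_exp_exp by (simp add: field_simps)
        then show ?thesis unfolding C1_def using ln2 by (simp add: mult.assoc[symmetric])
      qed
      then have "4 \<le> C1 * q" using mult_left_mono[OF ge C1] by simp
      also have "\<dots> \<le> ((4 * c)\<^sup>2 + C1) * q"
        using order_trans[OF _ q_ge] a0 by (intro mult_right_mono) auto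
      finally show ?thesis using False by (simp add: A_def)
    qed
    have B_le: "42 * (1 + 1 / t\<^sup>2) * a * (real d + 1) / sqrt n \<le> C2 * r"
    proof -
      have "(ln 2)\<^sup>2 \<le> a\<^sup>2" using a2 ln2 by (intro power_mono) auto
      then have "1 \<le> a\<^sup>2 / (ln 2)\<^sup>2" by simp
      then have "1 + 1 / t\<^sup>2 \<le> (1 + 1 / (ln 2)\<^sup>2) * a\<^sup>2"
        unfolding t_def by (simp add: power_divide distrib_right)
      then have 1: "(1 + 1 / t\<^sup>2) * a \<le> (1 + 1 / (ln 2)\<^sup>2) * a ^ 3"
        using mult_right_mono[of "1 + 1 / t\<^sup>2" "(1 + 1 / (ln 2)\<^sup>2) * a\<^sup>2" a] a0
        by (simp add: power2_eq_square power3_eq_cube mult.assoc)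
      have "real d powr 1 \<le> real d powr (3/2)" using d by (intro powr_mono) auto
      then have 2: "real d + 1 \<le> 2 * real d powr (3/2)" using d by simp
      have 3: "1 / sqrt n = real n powr (-1/2)"
        using n by (simp add: powr_minus_divide powr_half_sqrt)
      have "42 * (1 + 1 / t\<^sup>2) * a * (real d + 1) / sqrt n = 42 * (((1 + 1 / t\<^sup>2) * a) * (real d + 1)) * (1 / sqrt n)"
        by simp
      also have "\<dots> \<le> 42 * (((1 + 1 / (ln 2)\<^sup>2) * a ^ 3) * (2 * real d powr (3/2))) * (1 / sqrt n)"
      proof -
        have "0 \<le> (1 + 1 / (ln 2)\<^sup>2) * a ^ 3"
          using a0 by (intro mult_nonneg_nonneg add_nonneg_nonneg) auto
        from mult_mono[OF 1 2 this] have "(1 + 1 / t\<^sup>2) * a * (real d + 1) \<le> (1 + 1 / (ln 2)\<^sup>2) * a ^ 3 * (2 * real d powr (3/2))"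
          by simp
        then show ?thesis by (intro mult_right_mono mult_left_mono) auto
      qed
      also have "\<dots> = C2 * r" unfolding 3 C2_def r_def by simp
      finally show ?thesis .
    qed
    have one: "expected_error (nn_relu d k t a) n \<mu> \<nu> \<le> ennreal (C * (q + r))"
      if in_class: "(\<mu>, \<nu>) \<in> prob_pairs_bounded M d" for \<mu> \<nu>
    proof -
      obtain p \<eta> where pq: "(\<mu>, \<nu>) \<in> prob_pairs d" and p: "density_version \<mu> \<nu> p"
        and dom: "dominating \<eta> \<mu> \<nu>" and kb: "kb_coeff d (cube d) (f_H2 p) \<le> ereal M" and es: "ess_sup_norm \<eta> p \<le> ereal M"
        using in_class unfolding prob_pairs_bounded_def by auto
      have \<mu>: "prob_space \<mu>" and \<nu>: "prob_space \<nu>" and s\<mu>: "sets \<mu> = sets (cube_borel d)" and s\<nu>: "sets \<nu> = sets (cube_borel d)"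
        using pq by (auto simp: prob_pairs_def)
      have sp\<mu>: "space \<mu> = cube d" and sp\<nu>: "space \<nu> = cube d"
        using sets_eq_imp_space_eq[OF s\<mu>] sets_eq_imp_space_eq[OF s\<nu>] space_cube_borel by auto
      have k1: "1 \<le> k" using k by simp
      let ?C = "nn_class d k 1 (2 * a / real k) a a relu"
      have "\<exists>gs\<in>?C. hellinger2 \<mu> \<nu> - hellinger_functional \<mu> \<nu> (\<lambda>x. min (1 - t) (gs x)) \<le> A"
      proof (cases "M + 2 \<le> a")
        case True
        obtain g where g: "g \<in> nn_class d k 1 (2 * c / real k) c c relu" "(\<integral>x. (g x - f_H2 p x)\<^sup>2 \<partial>\<mu>) \<le> (4 * c)\<^sup>2 / real k"
          using kb_network(1)[OF \<mu> s\<mu> k1 d kb M] unfolding c_def by blast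
        obtain F where F: "\<And>x. x \<in> cube d \<Longrightarrow> \<bar>f_H2 p x\<bar> \<le> F"
          using kb_network(2)[OF \<mu> s\<mu> k1 d kb M] by blast
        have ca: "c \<le> a" using True by (simp add: c_def)
        then have "2 * c / real k \<le> 2 * a / real k" by (intro divide_right_mono) auto
        then have gC: "g \<in> ?C" using g(1) nn_class_mono[of 1 1 "2 * c / real k" "2 * a / real k" c a c a d k relu] ca by auto
        have AEf: "AE x in \<mu>. f_H2 p x \<le> 1 - t"
          using ess_sup_norm_AE[OF dom es] AE_space
        proof eventually_elim
          case (elim x)
          have p0: "0 < p x" using p elim(2) unfolding density_version_def sp\<mu> sp\<nu>[symmetric] by auto
          have "p x \<le> a * a"
          proof -
            have "M * 1 \<le> a * a" using True M by (intro mult_mono) auto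
            then show ?thesis using elim(1) by simp
          qed
          then have "sqrt (p x) \<le> a" using a0 by (intro real_le_lsqrt) (auto simp: power2_eq_square)
          then have "1 / a \<le> 1 / sqrt (p x)" using p0 a0 by (intro divide_left_mono) auto
          then show ?case using p0 unfolding f_H2_def t_def by (simp add: powr_minus_divide powr_half_sqrt)
        qed
        have "hellinger2 \<mu> \<nu> - hellinger_functional \<mu> \<nu> (\<lambda>x. min (1 - t) (g x)) \<le> (\<integral>x. (g x - f_H2 p x)\<^sup>2 \<partial>\<mu>) / t"
        proof (rule hellinger_clipped_gap_le[OF \<mu> \<nu> p t0 nn_class_measurable[OF activation_relu s\<nu> gC] _ _ AEf])
          show "\<bar>g x\<bar> \<le> real k * (2 * a / real k * (1 + 2 * 1)) + a + a" if "x \<in> space \<nu>" for x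
            using nn_class_bound[OF activation_relu gC] that unfolding sp\<nu> by blast
          show "\<bar>f_H2 p x\<bar> \<le> F" if "x \<in> space \<nu>" for x using F that unfolding sp\<nu> by blast
        qed
        also have "\<dots> \<le> (4 * c)\<^sup>2 / real k / t" using g(2) t0 by (intro divide_right_mono) auto
        also have "\<dots> = A" using True by (simp add: A_def t_def)
        finally show ?thesis using gC by blast
      next
        case False
        have z: "(\<lambda>_. 0) \<in> ?C"
          unfolding nn_class_iff using a0
          by (intro exI[of _ "\<lambda>_. 0"] exI[of _ "\<lambda>_ _. 0"] exI[of _ 0]) (auto simp: l1_norm_def net_def dot_def fun_eq_iff)
        define m where "m = min (1 - t) 0"
        interpret \<mu>: prob_space \<mu> by fact
        interpret \<nu>: prob_space \<nu> by fact
        have "hellinger_functional \<mu> \<nu> (\<lambda>_. m) = m - m / (1 - m)"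
          by (simp add: hellinger_functional_def \<mu>.prob_space \<nu>.prob_space)
        moreover have "- 2 \<le> m - m / (1 - m)"
        proof -
          have m: "- 1 \<le> m" "m \<le> 0" using t2 by (auto simp: m_def)
          have "m / (1 - m) \<le> 0" using m by (intro divide_nonpos_pos) auto
          then show ?thesis using m by linarith
        qed
        ultimately have "hellinger2 \<mu> \<nu> - hellinger_functional \<mu> \<nu> (\<lambda>x. min (1 - t) ((\<lambda>_. 0) x)) \<le> 4"
          using hellinger2_density_version(5)[OF \<mu> \<nu> p] unfolding m_def by linarith
        then show ?thesis using z False by (auto simp: A_def)
      qed
      then obtain gs where gs: "gs \<in> ?C" "hellinger2 \<mu> \<nu> - hellinger_functional \<mu> \<nu> (\<lambda>x. min (1 - t) (gs x)) \<le> A" by blast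
      have "expected_error (nn_relu d k t a) n \<mu> \<nu> \<le> ennreal (A + 42 * (1 + 1 / t\<^sup>2) * a * (real d + 1) / sqrt n)"
        by (rule expected_error_le[OF pq p n k1 d a0 t0 gs A0])
      also have "\<dots> \<le> ennreal (C * (q + r))"
      proof (rule ennreal_leI)
        have q0: "0 \<le> q" "0 \<le> r" using a0 by (auto simp: q_def r_def)
        have "((4 * c)\<^sup>2 + C1) * q + C2 * r \<le> C * q + C * r"
        proof (rule add_mono)
          show "((4 * c)\<^sup>2 + C1) * q \<le> C * q" by (rule mult_right_mono) (use C2 q0 in \<open>simp_all add: C_def\<close>)
          show "C2 * r \<le> C * r" by (rule mult_right_mono) (use C1 q0 in \<open>simp_all add: C_def\<close>)
        qed
        then show "A + 42 * (1 + 1 / t\<^sup>2) * a * (real d + 1) / sqrt n \<le> C * (q + r)"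
          using A_le B_le unfolding distrib_left by linarith
      qed
      finally show ?thesis .
    qed
    show "(SUP (\<mu>, \<nu>)\<in>prob_pairs_bounded M d. expected_error (nn_relu d k (1 / ln (real k)) (ln (real k))) n \<mu> \<nu>)
        \<le> ennreal (C * (real d powr (1/2) * real k powr (-1/2) * ln (real k)
                            + real d powr (3/2) * ln (real k) ^ 3 * real n powr (-1/2)))"
      using one unfolding q_def r_def t_def a_def by (intro SUP_least) auto
  qed
qed

section \<open>Universal approximation with bounded weights\<close>

lemma sum_lessThan_add_nat:
  fixes f :: "nat \<Rightarrow> real"
  shows "(\<Sum>i<m + n. f i) = (\<Sum>i<m. f i) + (\<Sum>i<n. f (m + i))"
  by (induction n) (simp_all add: add.assoc)

text \<open>There is neither a bound on \<open>k\<close> nor an affine part. Repeating neurons makes up for the bound on the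
  outer weights, so the functions with this property form a linear space.\<close>

definition approximable :: "nat \<Rightarrow> (real \<Rightarrow> real) \<Rightarrow> ((nat \<Rightarrow> real) \<Rightarrow> real) \<Rightarrow> bool" where
  "approximable d \<phi> f \<longleftrightarrow> (\<forall>\<epsilon>>0. \<exists>k. \<exists>g\<in>nn_class d k 1 1 0 0 \<phi>. \<forall>x\<in>cube d. \<bar>g x - f x\<bar> \<le> \<epsilon>)"

lemma dot_eq_0_of_l1_norm: "l1_norm d w \<le> 0 \<Longrightarrow> dot d w x = 0"
proof -
  assume "l1_norm d w \<le> 0"
  with l1_norm_nonneg[of d w] have "l1_norm d w = 0" by linarith
  then have "(\<Sum>j<d. \<bar>w j\<bar>) = 0" by (simp add: l1_norm_def)
  then have "\<And>j. j < d \<Longrightarrow> w j = 0" by (simp add: sum_nonneg_eq_0_iff)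
  then show ?thesis by (simp add: dot_def)
qed

lemma nn_class_00_iff:
  "g \<in> nn_class d k 1 1 0 0 \<phi> \<longleftrightarrow> (\<exists>\<beta> w b.
     (\<forall>i<k. l1_norm d (w i) \<le> 1 \<and> \<bar>b i\<bar> \<le> 1 \<and> \<bar>\<beta> i\<bar> \<le> 1) \<and>
     g = (\<lambda>x. \<Sum>i<k. \<beta> i * \<phi> (dot d (w i) x + b i)))" (is "_ \<longleftrightarrow> ?R")
proof
  assume "g \<in> nn_class d k 1 1 0 0 \<phi>"
  then obtain \<beta> w b w0 b0 where
    h: "\<And>i. i < k \<Longrightarrow> l1_norm d (w i) \<le> 1 \<and> \<bar>b i\<bar> \<le> 1 \<and> \<bar>\<beta> i\<bar> \<le> 1"
    "\<bar>b0\<bar> \<le> 0" "l1_norm d w0 \<le> 0" "g = net d k \<phi> \<beta> w b w0 b0"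
    unfolding nn_class_iff by blast
  have "g = (\<lambda>x. \<Sum>i<k. \<beta> i * \<phi> (dot d (w i) x + b i))"
    using h(2) dot_eq_0_of_l1_norm[OF h(3)] by (simp add: h(4) net_def fun_eq_iff)
  then show ?R using h(1) by blast
next
  assume ?R
  then obtain \<beta> w b where
    h: "\<forall>i<k. l1_norm d (w i) \<le> 1 \<and> \<bar>b i\<bar> \<le> 1 \<and> \<bar>\<beta> i\<bar> \<le> 1"
    "g = (\<lambda>x. \<Sum>i<k. \<beta> i * \<phi> (dot d (w i) x + b i))" by blast
  show "g \<in> nn_class d k 1 1 0 0 \<phi>"
    unfolding nn_class_iff using h
    by (intro exI[of _ \<beta>] exI[of _ w] exI[of _ b] exI[of _ "\<lambda>_. 0"] exI[of _ 0])
       (auto simp: net_def fun_eq_iff l1_norm_def dot_def)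
qed

lemma approximable_add:
  assumes "approximable d \<phi> f" "approximable d \<phi> f'"
  shows "approximable d \<phi> (\<lambda>x. f x + f' x)"
  unfolding approximable_def
proof (intro allI impI)
  fix \<epsilon> :: real assume "0 < \<epsilon>"
  then have e: "0 < \<epsilon> / 2" by simp
  obtain k g where g: "g \<in> nn_class d k 1 1 0 0 \<phi>" "\<forall>x\<in>cube d. \<bar>g x - f x\<bar> \<le> \<epsilon> / 2"
    using assms(1) e unfolding approximable_def by blast
  obtain k' g' where g': "g' \<in> nn_class d k' 1 1 0 0 \<phi>" "\<forall>x\<in>cube d. \<bar>g' x - f' x\<bar> \<le> \<epsilon> / 2"
    using assms(2) e unfolding approximable_def by blast
  obtain \<beta> w b where p: "\<forall>i<k. l1_norm d (w i) \<le> 1 \<and> \<bar>b i\<bar> \<le> 1 \<and> \<bar>\<beta> i\<bar> \<le> 1"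
    "g = (\<lambda>x. \<Sum>i<k. \<beta> i * \<phi> (dot d (w i) x + b i))" using g(1) unfolding nn_class_00_iff by blast
  obtain \<beta>' w' b' where p': "\<forall>i<k'. l1_norm d (w' i) \<le> 1 \<and> \<bar>b' i\<bar> \<le> 1 \<and> \<bar>\<beta>' i\<bar> \<le> 1"
    "g' = (\<lambda>x. \<Sum>i<k'. \<beta>' i * \<phi> (dot d (w' i) x + b' i))" using g'(1) unfolding nn_class_00_iff by blast
  have "(\<lambda>x. g x + g' x) \<in> nn_class d (k + k') 1 1 0 0 \<phi>"
    unfolding nn_class_00_iff
  proof (intro exI conjI)
    show "\<forall>i<k + k'. l1_norm d (if i < k then w i else w' (i - k)) \<le> 1 \<and> \<bar>if i < k then b i else b' (i - k)\<bar> \<le> 1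
        \<and> \<bar>if i < k then \<beta> i else \<beta>' (i - k)\<bar> \<le> 1"
      using p(1) p'(1) by auto
    show "(\<lambda>x. g x + g' x) = (\<lambda>x. \<Sum>i<k + k'. (if i < k then \<beta> i else \<beta>' (i - k)) *
        \<phi> (dot d (if i < k then w i else w' (i - k)) x + (if i < k then b i else b' (i - k))))"
      unfolding p(2) p'(2) sum_lessThan_add_nat by simp
  qed
  moreover have "\<bar>(g x + g' x) - (f x + f' x)\<bar> \<le> \<epsilon>" if "x \<in> cube d" for x
  proof -
    have "\<bar>g x - f x\<bar> \<le> \<epsilon> / 2" "\<bar>g' x - f' x\<bar> \<le> \<epsilon> / 2" using g(2) g'(2) that by blast+
    then show ?thesis by linarith
  qed
  ultimately show "\<exists>k. \<exists>g\<in>nn_class d k 1 1 0 0 \<phi>. \<forall>x\<in>cube d. \<bar>g x - (f x + f' x)\<bar> \<le> \<epsilon>"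
    by (intro exI[of _ "k + k'"] bexI[of _ "\<lambda>x. g x + g' x"]) auto
qed

lemma approximable_shrink:
  assumes "approximable d \<phi> f" "\<bar>c\<bar> \<le> 1"
  shows "approximable d \<phi> (\<lambda>x. c * f x)"
  unfolding approximable_def
proof (intro allI impI)
  fix \<epsilon> :: real assume "0 < \<epsilon>"
  then obtain k g where g: "g \<in> nn_class d k 1 1 0 0 \<phi>" "\<forall>x\<in>cube d. \<bar>g x - f x\<bar> \<le> \<epsilon>"
    using assms(1) unfolding approximable_def by blast
  obtain \<beta> w b where p: "\<forall>i<k. l1_norm d (w i) \<le> 1 \<and> \<bar>b i\<bar> \<le> 1 \<and> \<bar>\<beta> i\<bar> \<le> 1"
    "g = (\<lambda>x. \<Sum>i<k. \<beta> i * \<phi> (dot d (w i) x + b i))" using g(1) unfolding nn_class_00_iff by blast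
  have "(\<lambda>x. c * g x) \<in> nn_class d k 1 1 0 0 \<phi>"
    unfolding nn_class_00_iff
  proof (intro exI conjI)
    show "\<forall>i<k. l1_norm d (w i) \<le> 1 \<and> \<bar>b i\<bar> \<le> 1 \<and> \<bar>c * \<beta> i\<bar> \<le> 1"
      using p(1) assms(2) by (auto simp: abs_mult intro: mult_le_one)
    show "(\<lambda>x. c * g x) = (\<lambda>x. \<Sum>i<k. (c * \<beta> i) * \<phi> (dot d (w i) x + b i))"
      unfolding p(2) by (simp add: sum_distrib_left mult.assoc)
  qed
  moreover have "\<bar>c * g x - c * f x\<bar> \<le> \<epsilon>" if "x \<in> cube d" for x
  proof -
    have "\<bar>c\<bar> * \<bar>g x - f x\<bar> \<le> 1 * \<epsilon>" using g(2) that assms(2) by (intro mult_mono) auto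
    then show ?thesis by (simp add: abs_mult[symmetric] right_diff_distrib)
  qed
  ultimately show "\<exists>k. \<exists>g\<in>nn_class d k 1 1 0 0 \<phi>. \<forall>x\<in>cube d. \<bar>g x - c * f x\<bar> \<le> \<epsilon>"
    by (intro exI[of _ k] bexI[of _ "\<lambda>x. c * g x"]) auto
qed

text \<open>A large multiple is a sum of copies of a small one.\<close>

lemma approximable_scale:
  assumes "approximable d \<phi> f"
  shows "approximable d \<phi> (\<lambda>x. c * f x)"
proof -
  define N where "N = Suc (nat \<lceil>\<bar>c\<bar>\<rceil>)"
  have N: "\<bar>c\<bar> \<le> real N" "0 < real N" unfolding N_def by linarith+
  then have "\<bar>c / real N\<bar> \<le> 1" by (simp add: abs_divide)
  then have 1: "approximable d \<phi> (\<lambda>x. c / real N * f x)" by (rule approximable_shrink[OF assms])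
  have "approximable d \<phi> (\<lambda>x. real n * (c / real N * f x))" for n
  proof (induction n)
    case 0
    then show ?case using approximable_shrink[OF assms, of 0] by simp
  next
    case (Suc n)
    then show ?case using approximable_add[OF 1 Suc.IH] by (simp only: of_nat_Suc distrib_right mult_1)
  qed
  from this[of N] show ?thesis using N(2) by simp
qed

lemma approximable_limit:
  assumes "\<And>\<epsilon>. 0 < \<epsilon> \<Longrightarrow> \<exists>h. approximable d \<phi> h \<and> (\<forall>x\<in>cube d. \<bar>h x - f x\<bar> \<le> \<epsilon>)"
  shows "approximable d \<phi> f"
  unfolding approximable_def
proof (intro allI impI)
  fix \<epsilon> :: real assume "0 < \<epsilon>"
  then have e: "0 < \<epsilon> / 2" by simp
  then obtain h where h: "approximable d \<phi> h" "\<forall>x\<in>cube d. \<bar>h x - f x\<bar> \<le> \<epsilon> / 2" using assms by blast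
  then obtain k g where g: "g \<in> nn_class d k 1 1 0 0 \<phi>" "\<forall>x\<in>cube d. \<bar>g x - h x\<bar> \<le> \<epsilon> / 2"
    using e unfolding approximable_def by blast
  have "\<forall>x\<in>cube d. \<bar>g x - f x\<bar> \<le> \<epsilon>"
  proof
    fix x assume "x \<in> cube d"
    then have "\<bar>h x - f x\<bar> \<le> \<epsilon> / 2" "\<bar>g x - h x\<bar> \<le> \<epsilon> / 2" using h(2) g(2) by blast+
    then show "\<bar>g x - f x\<bar> \<le> \<epsilon>" by linarith
  qed
  then show "\<exists>k. \<exists>g\<in>nn_class d k 1 1 0 0 \<phi>. \<forall>x\<in>cube d. \<bar>g x - f x\<bar> \<le> \<epsilon>" using g(1) by blast
qed

lemma approximable_cong: "approximable d \<phi> f \<Longrightarrow> (\<And>x. x \<in> cube d \<Longrightarrow> f x = f' x) \<Longrightarrow> approximable d \<phi> f'"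
  unfolding approximable_def by auto

lemma approximable_neuron:
  assumes "l1_norm d w \<le> 1" "\<bar>b\<bar> \<le> 1"
  shows "approximable d \<phi> (\<lambda>x. \<phi> (dot d w x + b))"
proof -
  have "(\<lambda>x. \<phi> (dot d w x + b)) \<in> nn_class d 1 1 1 0 0 \<phi>"
    unfolding nn_class_00_iff using assms
    by (intro exI[of _ "\<lambda>_. 1"] exI[of _ "\<lambda>_. w"] exI[of _ "\<lambda>_. b"]) auto
  then show ?thesis unfolding approximable_def by (intro allI impI exI[of _ 1] bexI) auto
qed

lemma approximable_diff:
  "approximable d \<phi> f \<Longrightarrow> approximable d \<phi> f' \<Longrightarrow> approximable d \<phi> (\<lambda>x. f x - f' x)"
  using approximable_add[OF _ approximable_scale[of d \<phi> f' "-1"], of f] by simp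

lemma approximable_sum:
  fixes n :: nat
  assumes "\<And>i. i < n \<Longrightarrow> approximable d \<phi> (f i)" "approximable d \<phi> h"
  shows "approximable d \<phi> (\<lambda>x. h x + (\<Sum>i<n. f i x))"
  using assms(1)
proof (induction n)
  case 0
  then show ?case using assms(2) by simp
next
  case (Suc n)
  then have "approximable d \<phi> (\<lambda>x. h x + (\<Sum>i<n. f i x))" "approximable d \<phi> (f n)" by auto
  then have "approximable d \<phi> (\<lambda>x. (h x + (\<Sum>i<n. f i x)) + f n x)" by (rule approximable_add)
  then show ?case by (simp add: add.assoc)
qed

lemma dot_scale: "dot d (\<lambda>j. c * w j) x = c * dot d w x"
  by (simp add: dot_def sum_distrib_left mult.assoc)

lemma l1_norm_scale: "l1_norm d (\<lambda>j. c * w j) = \<bar>c\<bar> * l1_norm d w"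
  by (simp add: l1_norm_def sum_distrib_left abs_mult)

subsection \<open>Rectifiers: piecewise linear interpolation\<close>

lemma relu_homogeneous: "0 \<le> c \<Longrightarrow> relu (c * z) = c * relu z"
  by (auto simp: relu_def max_def mult_nonneg_nonneg mult_le_0_iff zero_le_mult_iff not_le)

text \<open>To the left of a grid point the later hinges vanish, and to its right the earlier increments
  telescope.\<close>

lemma interpolation_error:
  fixes H :: "real \<Rightarrow> real" and h K u0 :: real
  assumes h: "0 < h" and K: "\<And>a b. u0 \<le> a \<Longrightarrow> a \<le> u0 + real N * h \<Longrightarrow> u0 \<le> b \<Longrightarrow> b \<le> u0 + real N * h \<Longrightarrow> \<bar>H a - H b\<bar> \<le> K * \<bar>a - b\<bar>"
    and K0: "0 \<le> K" and n: "n \<le> N" and z: "u0 \<le> z" "z \<le> u0 + real N * h"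
  defines "u \<equiv> \<lambda>j::nat. u0 + real j * h"
  defines "S \<equiv> \<lambda>n. \<Sum>j<n. (H (u (Suc j)) - H (u j)) * ((relu (z - u j) - relu (z - u (Suc j))) / h)"
  shows "(u n \<le> z \<longrightarrow> S n = H (u n) - H u0) \<and> (z \<le> u n \<longrightarrow> \<bar>H z - H u0 - S n\<bar> \<le> 2 * K * h)"
  using n
proof (induction n)
  case 0
  have "z = u0" if "z \<le> u0" using that z by simp
  then show ?case using K0 h by (auto simp: S_def u_def)
next
  case (Suc n)
  then have IH: "u n \<le> z \<Longrightarrow> S n = H (u n) - H u0" "z \<le> u n \<Longrightarrow> \<bar>H z - H u0 - S n\<bar> \<le> 2 * K * h" by auto
  have us: "u (Suc n) = u n + h" by (simp add: u_def algebra_simps)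
  have SS: "S (Suc n) = S n + (H (u (Suc n)) - H (u n)) * ((relu (z - u n) - relu (z - u (Suc n))) / h)"
    by (simp add: S_def)
  have rng: "u0 \<le> u j \<and> u j \<le> u0 + real N * h" if "j \<le> N" for j
    unfolding u_def using that h by (auto intro!: mult_right_mono)
  show ?case
  proof (intro conjI impI)
    assume z1: "u (Suc n) \<le> z"
    then have "(relu (z - u n) - relu (z - u (Suc n))) / h = 1" using h us by (simp add: relu_def)
    then show "S (Suc n) = H (u (Suc n)) - H u0" unfolding SS using IH(1) z1 us h by simp
  next
    assume z1: "z \<le> u (Suc n)"
    show "\<bar>H z - H u0 - S (Suc n)\<bar> \<le> 2 * K * h"
    proof (cases "z \<le> u n")
      case True
      then have "relu (z - u n) = 0" "relu (z - u (Suc n)) = 0" using us h by (auto simp: relu_def)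
      then show ?thesis unfolding SS using IH(2)[OF True] by simp
    next
      case False
      define r where "r = (z - u n) / h"
      have r: "0 \<le> r" "r \<le> 1" using False z1 us h by (auto simp: r_def divide_le_eq)
      have "(relu (z - u n) - relu (z - u (Suc n))) / h = r"
        using False z1 by (simp add: relu_def r_def)
      then have "H z - H u0 - S (Suc n) = (H z - H (u n)) - (H (u (Suc n)) - H (u n)) * r"
        unfolding SS using IH(1) False by simp
      moreover have "\<bar>H z - H (u n)\<bar> \<le> K * h"
      proof -
        have "\<bar>H z - H (u n)\<bar> \<le> K * \<bar>z - u n\<bar>" using K z rng[of n] Suc.prems by auto
        also have "\<dots> \<le> K * h" using False z1 us K0 by (intro mult_left_mono) auto
        finally show ?thesis .
      qed
      moreover have "\<bar>(H (u (Suc n)) - H (u n)) * r\<bar> \<le> K * h"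
      proof -
        have "\<bar>H (u (Suc n)) - H (u n)\<bar> \<le> K * \<bar>u (Suc n) - u n\<bar>" using K rng[of n] rng[of "Suc n"] Suc.prems by auto
        then have "\<bar>H (u (Suc n)) - H (u n)\<bar> * \<bar>r\<bar> \<le> (K * h) * 1" using r us h K0 by (intro mult_mono) auto
        then show ?thesis by (simp add: abs_mult)
      qed
      ultimately show ?thesis by linarith
    qed
  qed
qed

lemma exp_lipschitz_below:
  fixes a b c :: real
  assumes "a \<le> c" "b \<le> c"
  shows "\<bar>exp a - exp b\<bar> \<le> exp c * \<bar>a - b\<bar>"
proof -
  have *: "\<bar>exp a - exp b\<bar> \<le> exp c * \<bar>a - b\<bar>" if ab: "a < b" "b \<le> c" for a b
  proof -
    obtain z where "a < z" "z < b" "exp b - exp a = (b - a) * exp z"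
      using MVT2[OF ab(1), of exp exp] by auto
    then show ?thesis using ab by (simp add: abs_if mult.commute mult_right_mono)
  qed
  show ?thesis using *[of a b] *[of b a] assms by (cases a b rule: linorder_cases) (auto simp: abs_minus_commute)
qed

lemma approximable_relu_exp: "approximable d relu (\<lambda>x. exp (dot d w x))"
proof (rule approximable_limit)
  fix \<epsilon> :: real assume \<epsilon>: "0 < \<epsilon>"
  define c where "c = l1_norm d w + 1"
  have c: "0 < c" "l1_norm d w \<le> c" using l1_norm_nonneg[of d w] by (auto simp: c_def)
  define K where "K = exp c"
  have K0: "0 < K" by (simp add: K_def)
  define N where "N = Suc (nat \<lceil>4 * K * c / \<epsilon>\<rceil>)"
  have N0: "0 < real N" by (simp add: N_def)
  have "4 * K * c / \<epsilon> \<le> real N" unfolding N_def by linarith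
  then have N: "4 * K * c \<le> \<epsilon> * real N" using \<epsilon> by (simp add: divide_le_eq mult.commute)
  define h where "h = 2 * c / real N"
  have h0: "0 < h" using c N0 by (simp add: h_def)
  have Nh: "- c + real N * h = c" using N0 by (simp add: h_def)
  define u where "u j = - c + real j * h" for j :: nat
  define A where "A x = exp (- c) + (\<Sum>j<N. (exp (u (Suc j)) - exp (u j)) * ((relu (dot d w x - u j) - relu (dot d w x - u (Suc j))) / h))" for x
  have const: "approximable d relu (\<lambda>_. a)" for a
  proof -
    have "approximable d relu (\<lambda>x. relu (dot d (\<lambda>_. 0) x + 1))"
      by (rule approximable_neuron) (auto simp: l1_norm_def)
    from approximable_scale[OF this, of a] show ?thesis by (simp add: dot_def relu_def)
  qed
  have hinge: "approximable d relu (\<lambda>x. relu (dot d w x - v))" if v: "\<bar>v\<bar> \<le> c" for v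
  proof -
    have "approximable d relu (\<lambda>x. relu (dot d (\<lambda>j. (1 / c) * w j) x + - v / c))"
      using c v by (intro approximable_neuron) (auto simp only: l1_norm_scale, auto simp: abs_divide)
    from approximable_scale[OF this, of c] show ?thesis
    proof (rule approximable_cong)
      fix x
      have "c * relu (dot d (\<lambda>j. (1 / c) * w j) x + - v / c) = relu (c * (dot d (\<lambda>j. (1 / c) * w j) x + - v / c))"
        using c by (simp add: relu_homogeneous)
      also have "c * (dot d (\<lambda>j. (1 / c) * w j) x + - v / c) = dot d w x - v"
        unfolding dot_scale using c by (simp add: field_simps)
      finally show "c * relu (dot d (\<lambda>j. (1 / c) * w j) x + - v / c) = relu (dot d w x - v)" .
    qed
  qed
  have uc: "\<bar>u j\<bar> \<le> c" if "j \<le> N" for j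
  proof -
    have "real j * h \<le> real N * h" using that h0 by (intro mult_right_mono) auto
    moreover have "0 \<le> real j * h" using h0 by simp
    ultimately show ?thesis using Nh unfolding u_def by linarith
  qed
  have "approximable d relu A"
    unfolding A_def
  proof (rule approximable_sum[OF _ const])
    fix j assume "j < N"
    then have "approximable d relu (\<lambda>x. relu (dot d w x - u j) - relu (dot d w x - u (Suc j)))"
      by (intro approximable_diff hinge uc) auto
    from approximable_scale[OF this, of "(exp (u (Suc j)) - exp (u j)) / h"]
    show "approximable d relu (\<lambda>x. (exp (u (Suc j)) - exp (u j)) * ((relu (dot d w x - u j) - relu (dot d w x - u (Suc j))) / h))"
      by simp
  qed
  moreover have "\<bar>A x - exp (dot d w x)\<bar> \<le> \<epsilon>" if x: "x \<in> cube d" for x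
  proof -
    define z where "z = dot d w x"
    have z: "- c \<le> z" "z \<le> - c + real N * h" using abs_dot_cube_le[OF x, of w] c unfolding Nh z_def by auto
    have "z \<le> u N" using z by (simp add: u_def)
    have lip: "\<bar>exp a - exp b\<bar> \<le> K * \<bar>a - b\<bar>" if "- c \<le> a" "a \<le> - c + real N * h" "- c \<le> b" "b \<le> - c + real N * h" for a b
      using exp_lipschitz_below[of a c b] that unfolding Nh K_def by blast
    note ie = interpolation_error[of h "- c" N exp K N z, OF h0 _ _ order_refl z, THEN conjunct2, THEN mp]
    have "\<bar>exp z - exp (- c) - (\<Sum>j<N. (exp (u (Suc j)) - exp (u j)) * ((relu (z - u j) - relu (z - u (Suc j))) / h))\<bar> \<le> 2 * K * h"
      unfolding u_def by (rule ie) (use lip K0 \<open>z \<le> u N\<close> in \<open>auto simp: u_def\<close>)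
    also have "2 * K * h \<le> \<epsilon>" using N N0 by (simp add: h_def divide_le_eq)
    finally show ?thesis unfolding A_def z_def by linarith
  qed
  ultimately show "\<exists>h. approximable d relu h \<and> (\<forall>x\<in>cube d. \<bar>h x - exp (dot d w x)\<bar> \<le> \<epsilon>)" by blast
qed

subsection \<open>Sigmoids: differentiating in the weight\<close>

text \<open>Since the derivative of the sigmoid \<open>s\<close> is \<open>s - s\<^sup>2\<close>, its higher derivatives are polynomials in \<open>s\<close>.\<close>

fun sigmoid_poly :: "nat \<Rightarrow> real poly" where
  "sigmoid_poly 0 = [:0, 1:]"
| "sigmoid_poly (Suc m) = pderiv (sigmoid_poly m) * [:0, 1, -1:]"

definition sigmoid_deriv :: "nat \<Rightarrow> real \<Rightarrow> real" where
  "sigmoid_deriv m z = poly (sigmoid_poly m) (sigmoid z)"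

lemma sigmoid_range: "0 < sigmoid z" "sigmoid z < 1"
  using exp_gt_zero[of "- z"] unfolding sigmoid_def by (auto simp: divide_less_eq add_pos_pos)

lemma sigmoid_has_derivative: "(sigmoid has_real_derivative sigmoid z * (1 - sigmoid z)) (at z within S)"
proof -
  have pos: "1 + exp (- z) \<noteq> 0" using exp_gt_zero[of "- z"] by linarith
  have "(sigmoid has_real_derivative (exp (- z) / (1 + exp (- z))\<^sup>2)) (at z within S)"
    unfolding sigmoid_def[abs_def] using pos
    by (auto intro!: derivative_eq_intros simp: power2_eq_square)
  moreover have "exp (- z) / (1 + exp (- z))\<^sup>2 = sigmoid z * (1 - sigmoid z)"
    unfolding sigmoid_def using pos by (simp add: field_simps power2_eq_square)
  ultimately show ?thesis by simp
qed

lemma sigmoid_deriv_has_derivative: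
  "(sigmoid_deriv m has_real_derivative sigmoid_deriv (Suc m) z) (at z within S)"
proof -
  have "((\<lambda>z. poly (sigmoid_poly m) (sigmoid z)) has_real_derivative
      poly (pderiv (sigmoid_poly m)) (sigmoid z) * (sigmoid z * (1 - sigmoid z))) (at z within S)"
    by (rule DERIV_chain2[OF poly_DERIV sigmoid_has_derivative])
  then show ?thesis unfolding sigmoid_deriv_def[abs_def] by (simp add: algebra_simps)
qed

lemma activation_sigmoid: "activation sigmoid"
  unfolding activation_def
proof (intro conjI allI)
  show "\<bar>sigmoid 0\<bar> \<le> 1" using sigmoid_range[of 0] by simp
  have *: "\<bar>sigmoid a - sigmoid b\<bar> \<le> \<bar>a - b\<bar>" if ab: "a < b" for a b
  proof -
    obtain z where z: "sigmoid b - sigmoid a = (b - a) * (sigmoid z * (1 - sigmoid z))"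
      using MVT2[OF ab, of sigmoid "\<lambda>z. sigmoid z * (1 - sigmoid z)"] sigmoid_has_derivative by blast
    have "sigmoid z * (1 - sigmoid z) \<le> 1" "0 \<le> sigmoid z * (1 - sigmoid z)"
      using sigmoid_range[of z] by (auto intro: mult_le_one)
    then have "sigmoid b - sigmoid a \<le> (b - a) * 1" "0 \<le> sigmoid b - sigmoid a"
      unfolding z using ab mult_left_mono[of "sigmoid z * (1 - sigmoid z)" 1 "b - a"]
        mult_nonneg_nonneg[of "b - a" "sigmoid z * (1 - sigmoid z)"] by simp_all
    then show ?thesis using ab by (simp add: abs_if)
  qed
  show "\<bar>sigmoid a - sigmoid b\<bar> \<le> \<bar>a - b\<bar>" for a b
    using *[of a b] *[of b a] by (cases a b rule: linorder_cases) (auto simp: abs_minus_commute)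
qed

lemma sigmoid_deriv_bounded: "\<exists>K\<ge>0. \<forall>z. \<bar>sigmoid_deriv m z\<bar> \<le> K"
proof -
  have cpt: "compact ((\<lambda>s. poly (sigmoid_poly m) s) ` {0..1})"
    by (intro compact_continuous_image continuous_intros compact_Icc)
  obtain K where K: "\<forall>y\<in>(\<lambda>s. poly (sigmoid_poly m) s) ` {0..1}. norm y \<le> K"
    using compact_imp_bounded[OF cpt] unfolding bounded_iff ..
  have b: "\<bar>sigmoid_deriv m z\<bar> \<le> K" for z
  proof -
    have "sigmoid z \<in> {0..1}" using sigmoid_range[of z] by simp
    from bspec[OF K imageI[OF this, of "\<lambda>s. poly (sigmoid_poly m) s"]] show ?thesis
      by (simp add: sigmoid_deriv_def)
  qed
  moreover have "0 \<le> K" using b[of 0] by linarith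
  ultimately show ?thesis by blast
qed

lemma sigmoid_deriv_taylor:
  assumes K: "\<And>z. \<bar>sigmoid_deriv (Suc (Suc m)) z\<bar> \<le> K"
  shows "\<bar>sigmoid_deriv m (u + h) - sigmoid_deriv m u - h * sigmoid_deriv (Suc m) u\<bar> \<le> K * h\<^sup>2"
proof -
  have lip: "\<bar>sigmoid_deriv (Suc m) a - sigmoid_deriv (Suc m) b\<bar> \<le> K * \<bar>a - b\<bar>" for a b
  proof -
    have *: "\<bar>sigmoid_deriv (Suc m) a - sigmoid_deriv (Suc m) b\<bar> \<le> K * \<bar>a - b\<bar>" if ab: "a < b" for a b
    proof -
      obtain z where z: "sigmoid_deriv (Suc m) b - sigmoid_deriv (Suc m) a = (b - a) * sigmoid_deriv (Suc (Suc m)) z"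
        using MVT2[OF ab, of "sigmoid_deriv (Suc m)" "sigmoid_deriv (Suc (Suc m))"] sigmoid_deriv_has_derivative by blast
      have "\<bar>sigmoid_deriv (Suc m) b - sigmoid_deriv (Suc m) a\<bar> \<le> (b - a) * K"
        unfolding z abs_mult using ab K by (intro mult_mono) auto
      then show ?thesis using ab by (simp add: abs_minus_commute mult.commute)
    qed
    show ?thesis
      using *[of a b] *[of b a] by (cases a b rule: linorder_cases) (auto simp: abs_minus_commute)
  qed
  have K0: "0 \<le> K" using K[of 0] by linarith
  have main: "\<exists>\<xi>. \<bar>\<xi> - u\<bar> \<le> \<bar>h\<bar> \<and> sigmoid_deriv m (u + h) - sigmoid_deriv m u = h * sigmoid_deriv (Suc m) \<xi>"
  proof (cases h "0::real" rule: linorder_cases)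
    case equal
    then show ?thesis by (intro exI[of _ u]) simp
  next
    case greater
    then have "u < u + h" by simp
    from MVT2[OF this, of "sigmoid_deriv m" "sigmoid_deriv (Suc m)"] sigmoid_deriv_has_derivative
    obtain \<xi> where "u < \<xi>" "\<xi> < u + h" "sigmoid_deriv m (u + h) - sigmoid_deriv m u = (u + h - u) * sigmoid_deriv (Suc m) \<xi>"
      by blast
    then show ?thesis by (intro exI[of _ \<xi>]) auto
  next
    case less
    then have "u + h < u" by simp
    from MVT2[OF this, of "sigmoid_deriv m" "sigmoid_deriv (Suc m)"] sigmoid_deriv_has_derivative
    obtain \<xi> where "u + h < \<xi>" "\<xi> < u" "sigmoid_deriv m u - sigmoid_deriv m (u + h) = (u - (u + h)) * sigmoid_deriv (Suc m) \<xi>"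
      by blast
    then show ?thesis by (intro exI[of _ \<xi>]) auto
  qed
  then obtain \<xi> where \<xi>: "\<bar>\<xi> - u\<bar> \<le> \<bar>h\<bar>" "sigmoid_deriv m (u + h) - sigmoid_deriv m u = h * sigmoid_deriv (Suc m) \<xi>" by blast
  have "\<bar>sigmoid_deriv m (u + h) - sigmoid_deriv m u - h * sigmoid_deriv (Suc m) u\<bar> = \<bar>h\<bar> * \<bar>sigmoid_deriv (Suc m) \<xi> - sigmoid_deriv (Suc m) u\<bar>"
    unfolding \<xi>(2) abs_mult[symmetric] by (simp add: right_diff_distrib)
  also have "\<dots> \<le> \<bar>h\<bar> * (K * \<bar>h\<bar>)"
    using lip[of \<xi> u] mult_left_mono[OF \<xi>(1) K0] by (intro mult_left_mono) auto
  also have "\<dots> = K * h\<^sup>2" by (simp add: power2_eq_square abs_mult_self_eq ac_simps)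
  finally show ?thesis .
qed

text \<open>Difference quotients in the inner weight \<open>a\<close> are again networks, and each derivative in \<open>a\<close> produces
  another factor \<open>dot d w x\<close>.\<close>

lemma approximable_sigmoid_deriv:
  assumes w: "l1_norm d w \<le> 1" and b: "\<bar>b\<bar> \<le> 1" and a: "0 \<le> a" "a < 1"
  shows "approximable d sigmoid (\<lambda>x. dot d w x ^ m * sigmoid_deriv m (a * dot d w x + b))"
  using a
proof (induction m arbitrary: a)
  case 0
  have "l1_norm d (\<lambda>j. a * w j) \<le> 1"
    unfolding l1_norm_scale using 0 w l1_norm_nonneg[of d w] by (simp add: mult_le_one)
  from approximable_neuron[OF this b, of sigmoid] show ?case
    by (simp add: dot_scale sigmoid_deriv_def)
next
  case (Suc m)
  obtain K where K: "0 \<le> K" "\<And>z. \<bar>sigmoid_deriv (Suc (Suc m)) z\<bar> \<le> K"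
    using sigmoid_deriv_bounded[of "Suc (Suc m)"] by blast
  show ?case
  proof (rule approximable_limit)
    fix \<epsilon> :: real assume \<epsilon>: "0 < \<epsilon>"
    \<comment> \<open>The step must keep the weight below one and the Taylor error \<open>K * \<delta>\<close> below \<open>\<epsilon>\<close>.\<close>
    define \<delta> where "\<delta> = min ((1 - a) / 2) (\<epsilon> / (K + 1))"
    have "\<delta> \<le> (1 - a) / 2" unfolding \<delta>_def by (rule min.cobounded1)
    then have \<delta>: "0 < \<delta>" "a + \<delta> < 1" "\<delta> \<le> \<epsilon> / (K + 1)"
      using Suc.prems \<epsilon> K(1) by (simp_all add: \<delta>_def)
    have K\<delta>: "K * \<delta> \<le> \<epsilon>"
    proof -
      have "(K + 1) * \<delta> \<le> \<epsilon>" using \<delta>(3) K(1) by (simp add: le_divide_eq mult.commute)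
      then show ?thesis using \<delta>(1) by (simp add: distrib_right)
    qed
    define D where "D x = (1 / \<delta>) * (dot d w x ^ m * sigmoid_deriv m ((a + \<delta>) * dot d w x + b)
        - dot d w x ^ m * sigmoid_deriv m (a * dot d w x + b))" for x
    have "approximable d sigmoid D"
      unfolding D_def using Suc.prems \<delta> by (intro approximable_scale approximable_diff Suc.IH) auto
    moreover have "\<bar>D x - dot d w x ^ Suc m * sigmoid_deriv (Suc m) (a * dot d w x + b)\<bar> \<le> \<epsilon>" if x: "x \<in> cube d" for x
    proof -
      define z where "z = dot d w x"
      have z: "\<bar>z\<bar> \<le> 1" using abs_dot_cube_le[OF x, of w] w by (simp add: z_def)
      let ?u = "a * z + b"
      have "D x - z ^ Suc m * sigmoid_deriv (Suc m) ?u
        = z ^ m * ((sigmoid_deriv m (?u + \<delta> * z) - sigmoid_deriv m ?u - \<delta> * z * sigmoid_deriv (Suc m) ?u) / \<delta>)"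
        unfolding D_def z_def[symmetric] using \<delta>(1) by (simp add: field_simps)
      also have "\<bar>\<dots>\<bar> \<le> 1 * (K * (\<delta> * z)\<^sup>2 / \<delta>)"
        unfolding abs_mult abs_divide
        using sigmoid_deriv_taylor[OF K(2), of ?u "\<delta> * z"] z \<delta>(1)
        by (intro mult_mono) (auto simp: power_abs power_le_one intro!: divide_right_mono)
      also have "\<dots> = K * \<delta> * z\<^sup>2" using \<delta>(1) by (simp add: power2_eq_square)
      also have "\<dots> \<le> K * \<delta> * 1"
        using z K(1) \<delta>(1) by (intro mult_left_mono) (auto simp: abs_square_le_1)
      finally show ?thesis unfolding z_def[symmetric] using K\<delta> by linarith
    qed
    ultimately show "\<exists>h. approximable d sigmoid h \<and>
        (\<forall>x\<in>cube d. \<bar>h x - dot d w x ^ Suc m * sigmoid_deriv (Suc m) (a * dot d w x + b)\<bar> \<le> \<epsilon>)" by blast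
  qed
qed

lemma sigmoid_poly_degree: "degree (sigmoid_poly m) = Suc m"
proof (induction m)
  case (Suc m)
  then have "pderiv (sigmoid_poly m) \<noteq> 0" by (simp add: pderiv_eq_0_iff)
  then show ?case
    using Suc by (simp add: degree_mult_eq degree_pderiv del: mult_pCons_right mult_pCons_left)
qed simp

text \<open>The sigmoid is injective, and the polynomial has only finitely many roots.\<close>

lemma sigmoid_deriv_nonzero: "\<exists>b. \<bar>b\<bar> \<le> 1 \<and> sigmoid_deriv m b \<noteq> 0"
proof (rule ccontr)
  assume "\<not> ?thesis"
  then have "sigmoid ` {0..1} \<subseteq> {s. poly (sigmoid_poly m) s = 0}" by (auto simp: sigmoid_deriv_def)
  moreover have "sigmoid_poly m \<noteq> 0" using sigmoid_poly_degree[of m] by auto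
  then have "finite {s. poly (sigmoid_poly m) s = 0}" by (rule poly_roots_finite)
  ultimately have "finite (sigmoid ` {0..1})" by (rule finite_subset)
  moreover have "inj_on sigmoid {0..1}"
  proof (rule inj_onI)
    fix a b assume "sigmoid a = sigmoid b"
    then have "inverse (1 + exp (- a)) = inverse (1 + exp (- b))"
      by (simp add: sigmoid_def inverse_eq_divide)
    then have "1 + exp (- a) = 1 + exp (- b)" by (simp only: inverse_eq_iff_eq)
    then show "a = b" by simp
  qed
  ultimately have "finite {0..1::real}" by (rule finite_imageD)
  then show False using infinite_Icc[of "0::real" 1] by simp
qed

text \<open>At inner weight zero the derivative of order \<open>m\<close> is a multiple of the pure power.\<close>

lemma approximable_sigmoid_power: "approximable d sigmoid (\<lambda>x. dot d w x ^ m)"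
proof -
  define c where "c = l1_norm d w + 1"
  have c: "0 < c" using l1_norm_nonneg[of d w] by (simp add: c_def)
  have 1: "l1_norm d (\<lambda>j. (1 / c) * w j) \<le> 1"
    unfolding l1_norm_scale using c l1_norm_nonneg[of d w] by (simp add: c_def divide_le_eq)
  obtain b where b: "\<bar>b\<bar> \<le> 1" "sigmoid_deriv m b \<noteq> 0" using sigmoid_deriv_nonzero by blast
  have "approximable d sigmoid (\<lambda>x. dot d (\<lambda>j. (1 / c) * w j) x ^ m * sigmoid_deriv m (0 * dot d (\<lambda>j. (1 / c) * w j) x + b))"
    by (rule approximable_sigmoid_deriv[OF 1 b(1)]) auto
  from approximable_scale[OF this, of "c ^ m / sigmoid_deriv m b"] show ?thesis
    unfolding dot_scale using b(2) c by (simp add: power_divide)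
qed

lemma approximable_sigmoid_exp: "approximable d sigmoid (\<lambda>x. exp (dot d w x))"
proof (rule approximable_limit)
  fix \<epsilon> :: real assume \<epsilon>: "0 < \<epsilon>"
  define c where "c = l1_norm d w"
  have "uniform_limit (cube d) (\<lambda>n x. \<Sum>m<n. dot d w x ^ m /\<^sub>R fact m) (\<lambda>x. \<Sum>m. dot d w x ^ m /\<^sub>R fact m) sequentially"
  proof (rule Weierstrass_m_test)
    show "summable (\<lambda>m. c ^ m /\<^sub>R fact m)" by (rule summable_exp_generic)
    show "norm (dot d w x ^ m /\<^sub>R fact m) \<le> c ^ m /\<^sub>R fact m" if "x \<in> cube d" for m x
    proof -
      have "\<bar>dot d w x\<bar> ^ m * inverse (fact m) \<le> c ^ m * inverse (fact m)"
        unfolding c_def using abs_dot_cube_le[OF that, of w] by (intro mult_right_mono power_mono) auto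
      then show ?thesis by (simp add: abs_mult power_abs mult.commute)
    qed
  qed
  then have "\<forall>\<^sub>F n in sequentially. \<forall>x\<in>cube d. dist (\<Sum>m<n. dot d w x ^ m /\<^sub>R fact m) (exp (dot d w x)) < \<epsilon>"
    using \<epsilon> unfolding uniform_limit_iff exp_def by blast
  then obtain n where n: "\<And>x. x \<in> cube d \<Longrightarrow> \<bar>(\<Sum>m<n. dot d w x ^ m /\<^sub>R fact m) - exp (dot d w x)\<bar> < \<epsilon>"
    unfolding eventually_sequentially dist_real_def by blast
  have "approximable d sigmoid (\<lambda>x. 0 * dot d w x ^ 0 + (\<Sum>m<n. (1 / fact m) * dot d w x ^ m))"
    by (intro approximable_sum approximable_scale approximable_sigmoid_power)
  then have "approximable d sigmoid (\<lambda>x. \<Sum>m<n. dot d w x ^ m /\<^sub>R fact m)"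
    by (simp add: divide_inverse)
  then show "\<exists>h. approximable d sigmoid h \<and> (\<forall>x\<in>cube d. \<bar>h x - exp (dot d w x)\<bar> \<le> \<epsilon>)"
    using n by (intro exI[of _ "\<lambda>x. \<Sum>m<n. dot d w x ^ m /\<^sub>R fact m"]) (auto intro: less_imp_le)
qed

subsection \<open>Exponentials span a dense algebra\<close>

text \<open>The span of the exponentials of linear forms is closed under products, because exponents add.\<close>

inductive exp_sum :: "nat \<Rightarrow> ((nat \<Rightarrow> real) \<Rightarrow> real) \<Rightarrow> bool" for d where
  exp: "exp_sum d (\<lambda>x. c * exp (dot d w x))"
| add: "exp_sum d f \<Longrightarrow> exp_sum d g \<Longrightarrow> exp_sum d (\<lambda>x. f x + g x)"

lemma dot_add: "dot d (\<lambda>j. w j + w' j) x = dot d w x + dot d w' x"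
  by (simp add: dot_def distrib_right sum.distrib)

lemma exp_sum_mult:
  assumes "exp_sum d f" "exp_sum d g"
  shows "exp_sum d (\<lambda>x. f x * g x)"
  using assms(1)
proof induction
  case (exp c w)
  show ?case using assms(2)
  proof induction
    case (exp c' w')
    have "(\<lambda>x. c * exp (dot d w x) * (c' * exp (dot d w' x))) = (\<lambda>x. (c * c') * exp (dot d (\<lambda>j. w j + w' j) x))"
      by (simp add: dot_add exp_add ac_simps)
    then show ?case using exp_sum.exp[of d "c * c'" "\<lambda>j. w j + w' j"] by simp
  next
    case (add f g)
    then show ?case using exp_sum.add[OF add.IH] by (simp add: distrib_left)
  qed
next
  case (add f f')
  then show ?case using exp_sum.add[OF add.IH] by (simp add: distrib_right)
qed

lemma exp_sum_continuous: "exp_sum d f \<Longrightarrow> continuous_on S f"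
proof (induction rule: exp_sum.induct)
  case (exp c w)
  have "continuous_on S (\<lambda>x::nat \<Rightarrow> real. x j)" for j
    by (rule continuous_on_subset[OF continuous_on_product_coordinates]) simp
  then show ?case unfolding dot_def
    by (intro continuous_on_mult continuous_on_exp continuous_on_sum continuous_on_const)
qed (rule continuous_on_add)

lemma exp_sum_approximable:
  assumes \<phi>: "\<phi> \<in> {sigmoid, relu}" and f: "exp_sum d f"
  shows "approximable d \<phi> f"
  using f
proof induction
  case (exp c w)
  have "approximable d \<phi> (\<lambda>x. exp (dot d w x))"
    using \<phi> approximable_sigmoid_exp approximable_relu_exp by auto
  then show ?case by (rule approximable_scale)
next
  case (add f g)
  then show ?case by (intro approximable_add)
qed

lemma compact_cube: "compact (cube d)"
proof -
  have eq: "cube d = Pi\<^sub>E UNIV (\<lambda>j. if j < d then {0..1} else {undefined})"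
    (is "_ = Pi\<^sub>E UNIV ?F")
  proof (intro set_eqI iffI)
    fix x assume x: "x \<in> cube d"
    show "x \<in> Pi\<^sub>E UNIV ?F"
    proof (rule PiE_I)
      fix j show "x j \<in> ?F j"
        using cube_coord[OF x, of j] PiE_arb[of x "{..<d}" "\<lambda>_. {0..1}" j] x by (simp add: cube_def)
    qed simp
  next
    fix x assume "x \<in> Pi\<^sub>E UNIV ?F"
    then have h: "x j \<in> ?F j" for j by (rule PiE_mem) simp
    show "x \<in> cube d"
      unfolding cube_def
    proof (rule PiE_I)
      show "x j \<in> {0..1}" if "j \<in> {..<d}" for j using h[of j] that by simp
      show "x j = undefined" if "j \<notin> {..<d}" for j using h[of j] that by simp
    qed
  qed
  have "compactin (product_topology (\<lambda>_. euclidean) UNIV) (Pi\<^sub>E UNIV (\<lambda>j::nat. if j < d then {0..1::real} else {undefined}))"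
    by (subst compactin_PiE) auto
  then show ?thesis by (simp add: euclidean_product_topology eq)
qed

lemma universal_approximation:
  assumes \<phi>: "\<phi> \<in> {sigmoid, relu}" and f: "continuous_on (cube d) f"
  shows "approximable d \<phi> f"
proof (rule approximable_limit)
  fix \<epsilon> :: real assume \<epsilon>: "0 < \<epsilon>"
  have "\<exists>g. exp_sum d g \<and> (\<forall>x\<in>cube d. \<bar>f x - g x\<bar> < \<epsilon>)"
  proof (rule Stone_Weierstrass_HOL[where P = "exp_sum d", OF compact_cube _ _ _ _ _ f \<epsilon>])
    show "exp_sum d (\<lambda>x. c)" for c
      using exp_sum.exp[of d c "\<lambda>_. 0"] by (simp add: dot_def)
    show "\<exists>g. exp_sum d g \<and> g x \<noteq> g y" if xy: "x \<in> cube d \<and> y \<in> cube d \<and> x \<noteq> y" for x y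
    proof -
      obtain j where j: "j < d" "x j \<noteq> y j"
        using xy PiE_ext[of x "{..<d}" "\<lambda>_. {0..1}" y] unfolding cube_def by blast
      have dj: "dot d (\<lambda>i. if i = j then 1 else 0) z = z j" for z
        using j(1) unfolding dot_def by (simp add: if_distrib[of "\<lambda>c. c * _"] cong: if_cong)
      show ?thesis
        using exp_sum.exp[of d 1 "\<lambda>i. if i = j then 1 else 0"] j(2)
        by (intro exI[of _ "\<lambda>x. 1 * exp (dot d (\<lambda>i. if i = j then 1 else 0) x)"]) (simp add: dj)
    qed
  qed (auto intro: exp_sum_continuous exp_sum.add exp_sum_mult)
  then obtain g where g: "exp_sum d g" "\<And>x. x \<in> cube d \<Longrightarrow> \<bar>f x - g x\<bar> < \<epsilon>" by blast
  then show "\<exists>h. approximable d \<phi> h \<and> (\<forall>x\<in>cube d. \<bar>h x - f x\<bar> \<le> \<epsilon>)"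
    using exp_sum_approximable[OF \<phi> g(1)] by (intro exI[of _ g]) (auto simp: abs_minus_commute intro: less_imp_le)
qed

section \<open>Consistency\<close>

text \<open>The index set is arbitrary, so that this applies to either half of a family indexed by a sum type.\<close>

lemma hoeffding_deviation:
  fixes X :: "'i \<Rightarrow> 'w \<Rightarrow> 'a" and f :: "'a \<Rightarrow> real"
  assumes P: "prob_space P" and ind: "prob_space.indep_vars P M' X I" and I: "finite I" "I \<noteq> {}"
    and M': "\<And>i. i \<in> I \<Longrightarrow> M' i = \<mu>" and law: "\<And>i. i \<in> I \<Longrightarrow> distr P \<mu> (X i) = \<mu>"
    and f: "f \<in> borel_measurable \<mu>" "\<And>x. x \<in> space \<mu> \<Longrightarrow> \<bar>f x\<bar> \<le> b" and b: "0 < b" and \<epsilon>: "0 \<le> \<epsilon>"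
  shows "measure P {\<omega>\<in>space P. real (card I) * \<epsilon> \<le> \<bar>(\<Sum>i\<in>I. f (X i \<omega>)) - real (card I) * (\<integral>x. f x \<partial>\<mu>)\<bar>}
       \<le> 2 * exp (- (real (card I) * \<epsilon>\<^sup>2 / (2 * b\<^sup>2)))"
proof -
  interpret P: prob_space P by fact
  obtain i0 where i0: "i0 \<in> I" using I by blast
  have mX: "X i \<in> P \<rightarrow>\<^sub>M \<mu>" if "i \<in> I" for i
    using ind that M'[OF that] unfolding P.indep_vars_def by auto
  have mfX: "(\<lambda>\<omega>. f (X i \<omega>)) \<in> borel_measurable P" if "i \<in> I" for i
    by (rule measurable_compose[OF mX[OF that] f(1)])
  have law_f: "distr P borel (\<lambda>\<omega>. f (X i \<omega>)) = distr \<mu> borel f" if "i \<in> I" for i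
    using distr_distr[OF f(1) mX[OF that]] law[OF that] by (simp add: comp_def)
  have mean: "P.expectation (\<lambda>\<omega>. f (X i0 \<omega>)) = (\<integral>x. f x \<partial>\<mu>)"
    using integral_distr[OF mX[OF i0] f(1)] law[OF i0] by simp
  have "P.indep_vars (\<lambda>_. borel) (\<lambda>i \<omega>. f (X i \<omega>)) I"
    by (rule P.indep_vars_compose2[OF ind]) (use f(1) M' in auto)
  interpret H: Hoeffding_ineq_iid P I "\<lambda>i \<omega>. f (X i \<omega>)" "\<lambda>\<omega>. f (X i0 \<omega>)" "- b" b "P.expectation (\<lambda>\<omega>. f (X i0 \<omega>))"
  proof unfold_locales
    show "P.indep_vars (\<lambda>_. borel) (\<lambda>i \<omega>. f (X i \<omega>)) I" by fact
    show "distr P borel (\<lambda>\<omega>. f (X i \<omega>)) = distr P borel (\<lambda>\<omega>. f (X i0 \<omega>))" if "i \<in> I" for i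
      using law_f[OF that] law_f[OF i0] by simp
    show "(\<lambda>\<omega>. f (X i0 \<omega>)) \<in> borel_measurable P" by (rule mfX[OF i0])
    show "AE \<omega> in P. f (X i0 \<omega>) \<in> {- b..b}"
    proof (rule AE_I2)
      fix \<omega> assume "\<omega> \<in> space P"
      then have "X i0 \<omega> \<in> space \<mu>" using mX[OF i0] by (rule measurable_space[rotated])
      from f(2)[OF this] show "f (X i0 \<omega>) \<in> {- b..b}" by auto
    qed
  qed (rule I)
  have c0: "0 < real (card I)" using I by (simp add: card_gt_0_iff)
  have "measure P {\<omega>\<in>space P. real (card I) * \<epsilon> \<le> \<bar>(\<Sum>i\<in>I. f (X i \<omega>)) - real (card I) * P.expectation (\<lambda>\<omega>. f (X i0 \<omega>))\<bar>}
       \<le> 2 * exp (- 2 * (real (card I) * \<epsilon>)\<^sup>2 / (real (card I) * (b - - b)\<^sup>2))"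
    using H.Hoeffding_ineq_abs_ge[of "real (card I) * \<epsilon>"] \<epsilon> b I by simp
  also have "- 2 * (real (card I) * \<epsilon>)\<^sup>2 / (real (card I) * (b - - b)\<^sup>2) = - (real (card I) * \<epsilon>\<^sup>2 / (2 * b\<^sup>2))"
    using c0 b by (simp add: field_simps power2_eq_square)
  finally show ?thesis unfolding mean .
qed

text \<open>For \<open>k\<close> of order \<open>n powr s\<close> the exponent is \<open>n powr s * ln n - n powr (1 - 2 * s)\<close> up to constants, and
  \<open>1 - 2 * s\<close> exceeds \<open>s\<close> by \<open>\<rho>\<close> if \<open>s = (1 - \<rho>) / 3\<close>.\<close>

lemma summable_net_tail:
  fixes k :: "nat \<Rightarrow> nat" and \<rho> \<Gamma> \<gamma> D :: real
  assumes k: "filterlim k at_top sequentially" "(\<lambda>n. real (k n)) \<in> O(\<lambda>n. real n powr ((1 - \<rho>) / 3))"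
    and \<rho>: "0 < \<rho>" "\<rho> < 1" and c: "3 \<le> \<Gamma>" "0 < \<gamma>" "0 < D"
  shows "summable (\<lambda>n. (\<Gamma> * real (k n)) powr (real (k n) * D) * exp (- (\<gamma> * real n / (real (k n))\<^sup>2)))"
proof -
  define s where "s = (1 - \<rho>) / 3"
  have s: "0 < s" "1 - 2 * s = s + \<rho>" using \<rho> by (auto simp: s_def field_simps)
  obtain \<kappa>0 where \<kappa>0: "0 < \<kappa>0" "\<forall>\<^sub>F n in sequentially. norm (real (k n)) \<le> \<kappa>0 * norm (real n powr s)"
    using k(2) unfolding s_def[symmetric] by (elim landau_o.bigE) blast
  define c1 c2 c3 where "c1 = \<kappa>0 * D" and "c2 = \<Gamma> * \<kappa>0" and "c3 = \<gamma> / \<kappa>0\<^sup>2"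
  have cs: "0 < c1" "0 < c2" "0 < c3" using \<kappa>0 c by (auto simp: c1_def c2_def c3_def)
  have "filterlim (\<lambda>n::nat. real n powr s * (c1 * ln (c2 * real n powr s) - c3 * real n powr \<rho>) + 2 * ln (real n)) at_bot sequentially"
    using s(1) \<rho>(1) cs by real_asymp
  then have ev: "\<forall>\<^sub>F n in sequentially. real n powr s * (c1 * ln (c2 * real n powr s) - c3 * real n powr \<rho>) + 2 * ln (real n) \<le> 0"
    by (simp add: filterlim_at_bot)
  have k1: "\<forall>\<^sub>F n in sequentially. 1 \<le> k n" using k(1) by (simp add: filterlim_at_top)
  show ?thesis
  proof (rule summable_comparison_test_ev)
    show "summable (\<lambda>n. inverse ((real n)\<^sup>2))" by (rule inverse_power_summable) simp
    show "\<forall>\<^sub>F n in sequentially. norm ((\<Gamma> * real (k n)) powr (real (k n) * D) * exp (- (\<gamma> * real n / (real (k n))\<^sup>2))) \<le> inverse ((real n)\<^sup>2)"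
      using ev k1 \<kappa>0(2) eventually_gt_at_top[of 0]
    proof eventually_elim
      case (elim n)
      define m where "m = real (k n)"
      define K where "K = \<kappa>0 * real n powr s"
      have n0: "0 < real n" using elim by simp
      have m: "1 \<le> m" "m \<le> K" using elim by (auto simp: m_def K_def)
      have \<Gamma>m: "1 \<le> \<Gamma> * m" using mult_mono[of 1 \<Gamma> 1 m] c m by simp
      have "(\<Gamma> * m) powr (m * D) = exp (m * D * ln (\<Gamma> * m))" using \<Gamma>m m c by (auto simp: powr_def)
      also have "\<dots> \<le> exp (K * D * ln (\<Gamma> * K))"
      proof -
        have "ln (\<Gamma> * m) \<le> ln (\<Gamma> * K)" using \<Gamma>m m c by (intro ln_mono mult_left_mono) auto
        moreover have "0 \<le> ln (\<Gamma> * m)" using \<Gamma>m by simp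
        ultimately show ?thesis using m c unfolding exp_le_cancel_iff by (intro mult_mono) auto
      qed
      finally have 1: "(\<Gamma> * m) powr (m * D) \<le> exp (K * D * ln (\<Gamma> * K))" .
      have "m\<^sup>2 \<le> K\<^sup>2" using m by (intro power_mono) auto
      then have "\<gamma> * real n / K\<^sup>2 \<le> \<gamma> * real n / m\<^sup>2" using m c n0 by (intro divide_left_mono) auto
      then have "exp (- (\<gamma> * real n / m\<^sup>2)) \<le> exp (- (\<gamma> * real n / K\<^sup>2))" by simp
      then have "(\<Gamma> * m) powr (m * D) * exp (- (\<gamma> * real n / m\<^sup>2)) \<le> exp (K * D * ln (\<Gamma> * K)) * exp (- (\<gamma> * real n / K\<^sup>2))"
        using 1 by (intro mult_mono) auto
      also have "\<dots> = exp (K * D * ln (\<Gamma> * K) - \<gamma> * real n / K\<^sup>2)" by (simp add: mult_exp_exp)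
      also have "K * D * ln (\<Gamma> * K) - \<gamma> * real n / K\<^sup>2 = real n powr s * (c1 * ln (c2 * real n powr s) - c3 * real n powr \<rho>)"
      proof -
        have "real n / (real n powr s)\<^sup>2 = real n powr (1 - 2 * s)"
          using n0 by (simp add: powr_diff powr_add[symmetric] power2_eq_square)
        then have e1: "real n / (real n powr s)\<^sup>2 = real n powr s * real n powr \<rho>" by (simp add: s(2) powr_add)
        have "\<gamma> * real n / K\<^sup>2 = \<gamma> / \<kappa>0\<^sup>2 * (real n / (real n powr s)\<^sup>2)" by (simp add: K_def power_mult_distrib)
        also have "\<dots> = real n powr s * (c3 * real n powr \<rho>)"
          unfolding e1 c3_def using cs(1) by (simp add: field_simps)
        finally show ?thesis by (simp add: K_def c1_def c2_def right_diff_distrib ac_simps)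
      qed
      also have "exp \<dots> \<le> exp (- 2 * ln (real n))" using elim(1) by simp
      also have "\<dots> = inverse ((real n)\<^sup>2)"
        using n0 by (simp add: exp_minus exp_of_nat_mult[of 2, symmetric, simplified] power2_eq_square exp_add[symmetric] exp_double)
      finally show ?case unfolding m_def by simp
    qed
  qed
qed

text \<open>A union bound over the net and the Borel-Cantelli lemma. The case \<open>k n = 0\<close> is set aside because the
  envelope is proportional to \<open>k n\<close>; it occurs for finitely many \<open>n\<close> only.\<close>

lemma AE_eventually_deviation:
  fixes X :: "nat \<Rightarrow> 'w \<Rightarrow> 'a" and e :: real and G :: "nat \<Rightarrow> ('a \<Rightarrow> real) set" and S :: "nat \<Rightarrow> 's" and Z :: "'s \<Rightarrow> 'w \<Rightarrow> 'a"
  assumes P: "prob_space P" and ind: "prob_space.indep_vars P M' Z UNIV" and S: "inj S"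
    and M': "\<And>i. M' (S i) = \<mu>" and law: "\<And>i. distr P \<mu> (Z (S i)) = \<mu>"
    and G: "\<And>n. finite (G n)" "\<And>n. real (card (G n)) \<le> (\<Gamma> * real (k n)) powr (real (k n) * D) \<or> k n = 0"
    and f: "\<And>n g. g \<in> G n \<Longrightarrow> (\<lambda>x. \<psi> (g x)) \<in> borel_measurable \<mu>"
      "\<And>n g x. g \<in> G n \<Longrightarrow> x \<in> space \<mu> \<Longrightarrow> \<bar>\<psi> (g x)\<bar> \<le> \<beta> * real (k n) \<or> k n = 0"
    and \<beta>: "0 < \<beta>" and e: "0 < e"
    and k: "filterlim k at_top sequentially" "(\<lambda>n. real (k n)) \<in> O(\<lambda>n. real n powr ((1 - \<rho>) / 3))"
    and \<rho>: "0 < \<rho>" "\<rho> < 1" and c: "3 \<le> \<Gamma>" "0 < D"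
  shows "AE \<omega> in P. \<forall>\<^sub>F n in sequentially. \<forall>g\<in>G n. \<bar>\<Sum>j<n. \<psi> (g (Z (S j) \<omega>)) - (\<integral>x. \<psi> (g x) \<partial>\<mu>)\<bar> \<le> real n * e"
proof -
  interpret P: prob_space P by fact
  define E where "E n g = {\<omega>\<in>space P. real n * e \<le> \<bar>(\<Sum>j<n. \<psi> (g (Z (S j) \<omega>))) - real n * (\<integral>x. \<psi> (g x) \<partial>\<mu>)\<bar>}" for n g
  define A where "A n = (if n = 0 \<or> k n = 0 then {} else (\<Union>g\<in>G n. E n g))" for n
  have mZ: "Z (S i) \<in> P \<rightarrow>\<^sub>M \<mu>" for i
    using ind M'[of i] unfolding P.indep_vars_def by auto
  have mE: "E n g \<in> sets P" if "g \<in> G n" for n g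
  proof -
    have "(\<lambda>\<omega>. \<psi> (g (Z (S j) \<omega>))) \<in> borel_measurable P" for j
      using measurable_compose[OF mZ f(1)[OF that]] .
    then show ?thesis unfolding E_def by measurable
  qed
  have mA: "A n \<in> sets P" for n using G(1) mE by (auto simp: A_def)
  have PE: "measure P (E n g) \<le> 2 * exp (- (e\<^sup>2 / (2 * \<beta>\<^sup>2) * real n / (real (k n))\<^sup>2))"
    if g: "g \<in> G n" and n: "n \<noteq> 0" "k n \<noteq> 0" for n g
  proof -
    have inj: "inj_on S {..<n}" using S by (rule inj_on_subset) simp
    have card: "card (S ` {..<n}) = n" using card_image[OF inj] by simp
    have "measure P {\<omega>\<in>space P. real (card (S ` {..<n})) * e \<le> \<bar>(\<Sum>i\<in>S ` {..<n}. \<psi> (g (Z i \<omega>))) - real (card (S ` {..<n})) * (\<integral>x. \<psi> (g x) \<partial>\<mu>)\<bar>}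
       \<le> 2 * exp (- (real (card (S ` {..<n})) * e\<^sup>2 / (2 * (\<beta> * real (k n))\<^sup>2)))"
    proof (rule hoeffding_deviation[OF P P.indep_vars_subset[OF ind]])
      show "S ` {..<n} \<noteq> {}" using n by auto
      show "\<bar>\<psi> (g x)\<bar> \<le> \<beta> * real (k n)" if "x \<in> space \<mu>" for x using f(2)[OF g that] n by simp
    qed (use M' law f(1)[OF g] \<beta> n e in auto)
    then show ?thesis
      unfolding card sum.reindex[OF inj] E_def[symmetric] by (simp add: E_def power_mult_distrib field_simps)
  qed
  have PA: "measure P (A n) \<le> 2 * ((\<Gamma> * real (k n)) powr (real (k n) * D) * exp (- (e\<^sup>2 / (2 * \<beta>\<^sup>2) * real n / (real (k n))\<^sup>2)))" for n
  proof (cases "n = 0 \<or> k n = 0")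
    case False
    then have "measure P (A n) \<le> (\<Sum>g\<in>G n. measure P (E n g))"
      unfolding A_def using mE G(1) by (simp add: P.finite_measure_subadditive_finite image_subset_iff)
    also have "\<dots> \<le> real (card (G n)) * (2 * exp (- (e\<^sup>2 / (2 * \<beta>\<^sup>2) * real n / (real (k n))\<^sup>2)))"
      using PE False by (intro sum_bounded_above) auto
    also have "\<dots> \<le> (\<Gamma> * real (k n)) powr (real (k n) * D) * (2 * exp (- (e\<^sup>2 / (2 * \<beta>\<^sup>2) * real n / (real (k n))\<^sup>2)))"
      using G(2)[of n] False by (intro mult_right_mono) auto
    finally show ?thesis by simp
  qed (simp add: A_def)
  have "AE \<omega> in P. \<forall>\<^sub>F n in sequentially. \<omega> \<in> space P - A n"
  proof (rule borel_cantelli_AE1[OF mA])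
    show "emeasure P (A n) < \<infinity>" for n by (simp add: P.emeasure_eq_measure)
    have "summable (\<lambda>n. 2 * ((\<Gamma> * real (k n)) powr (real (k n) * D) * exp (- (e\<^sup>2 / (2 * \<beta>\<^sup>2) * real n / (real (k n))\<^sup>2))))"
      using \<beta> e by (intro summable_mult summable_net_tail[OF k \<rho> c(1) _ c(2)]) auto
    then show "summable (\<lambda>n. measure P (A n))"
      by (rule summable_comparison_test') (use PA in auto)
  qed
  then show ?thesis
  proof eventually_elim
    case (elim \<omega>)
    have k1: "\<forall>\<^sub>F n in sequentially. 1 \<le> k n" using k(1) by (simp add: filterlim_at_top)
    show ?case using elim k1 eventually_gt_at_top[of 0]
    proof eventually_elim
      case (elim n)
      show ?case
      proof
        fix g assume g: "g \<in> G n"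
        have "\<omega> \<notin> E n g" using elim g by (auto simp: A_def)
        then have "\<bar>(\<Sum>j<n. \<psi> (g (Z (S j) \<omega>))) - real n * (\<integral>x. \<psi> (g x) \<partial>\<mu>)\<bar> \<le> real n * e"
          using elim unfolding E_def by auto
        then show "\<bar>\<Sum>j<n. \<psi> (g (Z (S j) \<omega>)) - (\<integral>x. \<psi> (g x) \<partial>\<mu>)\<bar> \<le> real n * e"
          by (simp add: sum_subtractf)
      qed
    qed
  qed
qed

lemma nn_class_pad:
  assumes "K \<le> k"
  shows "nn_class d K 1 1 0 0 \<phi> \<subseteq> nn_class d k 1 1 1 0 \<phi>"
proof
  fix g assume "g \<in> nn_class d K 1 1 0 0 \<phi>"
  then obtain \<beta> w b where p: "\<forall>i<K. l1_norm d (w i) \<le> 1 \<and> \<bar>b i\<bar> \<le> 1 \<and> \<bar>\<beta> i\<bar> \<le> 1"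
    "g = (\<lambda>x. \<Sum>i<K. \<beta> i * \<phi> (dot d (w i) x + b i))" unfolding nn_class_00_iff by blast
  have "g \<in> nn_class d k 1 1 0 0 \<phi>"
    unfolding nn_class_00_iff
  proof (intro exI conjI)
    show "\<forall>i<k. l1_norm d (if i < K then w i else (\<lambda>_. 0)) \<le> 1 \<and> \<bar>if i < K then b i else 0\<bar> \<le> 1
        \<and> \<bar>if i < K then \<beta> i else 0\<bar> \<le> 1"
      using p(1) by (auto simp: l1_norm_def)
    show "g = (\<lambda>x. \<Sum>i<k. (if i < K then \<beta> i else 0) *
        \<phi> (dot d (if i < K then w i else (\<lambda>_. 0)) x + (if i < K then b i else 0)))"
      unfolding p(2) by (intro ext sum.mono_neutral_cong_left) (use assms in auto)
  qed
  then show "g \<in> nn_class d k 1 1 1 0 \<phi>" using nn_class_mono[of 1 1 1 1 0 1 0 0 d k \<phi>] by auto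
qed

text \<open>The tolerance \<open>e\<close> is spent in quarters: on the approximation of \<open>f_H2 p\<close>, on the deviations of each of
  the two samples, and on the mesh of the net.\<close>

lemma consistency_eventually:
  fixes k :: "nat \<Rightarrow> nat" and X Y :: "nat \<Rightarrow> 'w \<Rightarrow> nat \<Rightarrow> real" and M e :: real
  assumes pq: "(\<mu>, \<nu>) \<in> prob_pairs d" and p: "density_version \<mu> \<nu> p" and cont: "continuous_on (cube d) (f_H2 p)"
    and M: "0 < M" and AEp: "AE x in \<mu>. p x \<le> M" and \<phi>: "\<phi> \<in> {sigmoid, relu}" and \<rho>: "0 < \<rho>" "\<rho> < 1"
    and k: "filterlim k at_top sequentially" "(\<lambda>n. real (k n)) \<in> O(\<lambda>n. real n powr ((1 - \<rho>) / 3))"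
    and iid: "iid_samples P \<mu> \<nu> X Y" and e: "0 < e"
  shows "AE \<omega> in P. \<forall>\<^sub>F n in sequentially.
    \<bar>hellinger2_est (nn_star d (k n) (M powr (-1/2)) \<phi>) n (\<lambda>i. X i \<omega>) (\<lambda>i. Y i \<omega>) - hellinger2 \<mu> \<nu>\<bar> \<le> e"
proof -
  have \<mu>: "prob_space \<mu>" and \<nu>: "prob_space \<nu>" and s\<mu>: "sets \<mu> = sets (cube_borel d)" and s\<nu>: "sets \<nu> = sets (cube_borel d)"
    using pq by (auto simp: prob_pairs_def)
  have sp\<mu>: "space \<mu> = cube d" and sp\<nu>: "space \<nu> = cube d"
    using sets_eq_imp_space_eq[OF s\<mu>] sets_eq_imp_space_eq[OF s\<nu>] space_cube_borel by auto
  have act: "activation \<phi>" using \<phi> activation_relu activation_sigmoid by auto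
  have P: "prob_space P" and ind: "prob_space.indep_vars P (case_sum (\<lambda>_. \<mu>) (\<lambda>_. \<nu>)) (case_sum X Y) UNIV"
    and lawX: "\<And>i. distr P \<mu> (X i) = \<mu>" and lawY: "\<And>i. distr P \<nu> (Y i) = \<nu>"
    using iid by (auto simp: iid_samples_def)
  interpret P: prob_space P by fact
  have mX: "X i \<in> P \<rightarrow>\<^sub>M \<mu>" and mY: "Y i \<in> P \<rightarrow>\<^sub>M \<nu>" for i
  proof -
    have "case_sum X Y j \<in> P \<rightarrow>\<^sub>M case_sum (\<lambda>_. \<mu>) (\<lambda>_. \<nu>) j" for j
      using ind unfolding P.indep_vars_def by auto
    from this[of "Inl i"] this[of "Inr i"] show "X i \<in> P \<rightarrow>\<^sub>M \<mu>" "Y i \<in> P \<rightarrow>\<^sub>M \<nu>" by auto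
  qed
  define t where "t = M powr (-1/2)"
  define L where "L = 1 / t\<^sup>2"
  have t: "0 < t" using M by (simp add: t_def)
  have L: "0 < L" using t by (simp add: L_def)
  have "bounded (f_H2 p ` cube d)"
    by (rule compact_imp_bounded[OF compact_continuous_image[OF cont compact_cube]])
  then obtain F where "\<forall>y\<in>f_H2 p ` cube d. norm y \<le> F" unfolding bounded_iff ..
  then have F: "\<And>x. x \<in> cube d \<Longrightarrow> \<bar>f_H2 p x\<bar> \<le> F" by simp
  have AEf: "AE x in \<mu>. f_H2 p x \<le> 1 - t"
    using AEp AE_space
  proof eventually_elim
    case (elim x)
    then have "0 < p x" using p unfolding density_version_def sp\<mu> sp\<nu>[symmetric] by auto
    then have "M powr (-1/2) \<le> p x powr (-1/2)" using elim(1) by (intro powr_mono2') auto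
    then show ?case by (simp add: f_H2_def t_def)
  qed
  define \<delta> where "\<delta> = min 1 (t * e / 4)"
  have \<delta>: "0 < \<delta>" "\<delta> \<le> 1" "\<delta> \<le> t * e / 4" using t e by (auto simp: \<delta>_def)
  obtain K0 g0 where g0: "g0 \<in> nn_class d K0 1 1 0 0 \<phi>" "\<And>x. x \<in> cube d \<Longrightarrow> \<bar>g0 x - f_H2 p x\<bar> \<le> \<delta>"
    using universal_approximation[OF \<phi> cont] \<delta>(1) unfolding approximable_def by blast
  have gap: "hellinger2 \<mu> \<nu> - hellinger_functional \<mu> \<nu> (\<lambda>x. min (1 - t) (g0 x)) \<le> e / 4"
  proof -
    interpret \<mu>: prob_space \<mu> by fact
    have mg: "g0 \<in> borel_measurable \<mu>" by (rule nn_class_measurable[OF act s\<mu> g0(1)])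
    have mf: "f_H2 p \<in> borel_measurable \<mu>"
    proof -
      have "p \<in> borel_measurable \<nu>" using p by (simp add: density_version_def)
      then have "f_H2 p \<in> borel_measurable \<nu>" unfolding f_H2_def[abs_def] by measurable
      then show ?thesis using measurable_cong_sets[OF s\<mu>[folded s\<nu>] refl] by blast
    qed
    have "hellinger2 \<mu> \<nu> - hellinger_functional \<mu> \<nu> (\<lambda>x. min (1 - t) (g0 x)) \<le> (\<integral>x. (g0 x - f_H2 p x)\<^sup>2 \<partial>\<mu>) / t"
    proof (rule hellinger_clipped_gap_le[OF \<mu> \<nu> p t nn_class_measurable[OF act s\<nu> g0(1)] _ _ AEf])
      show "\<bar>g0 x\<bar> \<le> real K0 * (1 * (1 + 2 * 1)) + 0 + 0" if "x \<in> space \<nu>" for x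
        using nn_class_bound[OF act g0(1)] that unfolding sp\<nu> by blast
      show "\<bar>f_H2 p x\<bar> \<le> F" if "x \<in> space \<nu>" for x using F that unfolding sp\<nu> by blast
    qed
    also have "(\<integral>x. (g0 x - f_H2 p x)\<^sup>2 \<partial>\<mu>) \<le> \<delta>\<^sup>2"
    proof -
      have "\<bar>(g0 x - f_H2 p x)\<^sup>2\<bar> \<le> \<delta>\<^sup>2" if "x \<in> space \<mu>" for x
        using power_mono[OF g0(2)[of x], of 2] that unfolding sp\<mu> by (simp only: power2_abs abs_power2 abs_ge_zero)
      then have "\<bar>\<integral>x. (g0 x - f_H2 p x)\<^sup>2 \<partial>\<mu>\<bar> \<le> \<delta>\<^sup>2"
        using mg mf by (intro \<mu>.abs_expectation_le) auto
      then show ?thesis by simp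
    qed
    also have "\<delta>\<^sup>2 \<le> \<delta> * 1" unfolding power2_eq_square using \<delta> by (intro mult_left_mono) auto
    also have "\<delta> * 1 / t \<le> e / 4" using \<delta>(3) t by (simp add: divide_le_eq mult.commute)
    finally show ?thesis using t by (simp add: divide_right_mono)
  qed
  define \<epsilon> where "\<epsilon> = e / (8 * (1 + L))"
  have \<epsilon>: "0 < \<epsilon>" using e L by (simp add: \<epsilon>_def)
  define Q where "Q n = real (k n) * (3 + 1 * (real d + 1)) + real d + 1" for n
  have Q: "0 < Q n" for n by (simp add: Q_def add_nonneg_pos)
  define h where "h n = \<epsilon> / Q n" for n
  have h: "0 < h n" for n using \<epsilon> Q by (simp add: h_def)
  define N where "N n = nat \<lceil>1 / h n\<rceil>" for n
  have hN: "1 \<le> h n * real (N n)" for n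
  proof -
    have "1 / h n \<le> real (N n)" unfolding N_def by linarith
    then show ?thesis using h[of n] by (simp add: divide_le_eq mult.commute)
  qed
  let ?C = "\<lambda>n. nn_class d (k n) 1 1 1 0 \<phi>"
  define good where "good n G \<longleftrightarrow> finite G \<and> G \<subseteq> ?C n \<and> card G \<le> (2 * N n + 1) ^ (k n * (d + 2) + d + 1) \<and>
      (\<forall>g\<in>?C n. \<exists>g'\<in>G. \<forall>x\<in>cube d. \<bar>g x - g' x\<bar> \<le> h n * (real (k n) * (3 + 1 * (real d + 1)) + real d + 1))" for n G
  have h0N: "0 \<le> h n * real (N n)" for n using h[of n] by simp
  have "\<forall>n. \<exists>G. good n G"
  proof
    fix n show "\<exists>G. good n G"
      by (rule nn_class_finite_net[OF act h order_refl hN hN hN h0N, where d = d and k = "k n"])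
         (unfold good_def, blast)
  qed
  from choice[OF this] obtain G where good: "\<And>n. good n (G n)" by blast
  then have G: "\<And>n. finite (G n)" "\<And>n. G n \<subseteq> ?C n"
    "\<And>n. card (G n) \<le> (2 * N n + 1) ^ (k n * (d + 2) + d + 1)"
    "\<And>n g. g \<in> ?C n \<Longrightarrow> \<exists>g'\<in>G n. \<forall>x\<in>cube d. \<bar>g x - g' x\<bar> \<le> h n * (real (k n) * (3 + 1 * (real d + 1)) + real d + 1)"
    unfolding good_def by auto
  have net: "\<exists>g'\<in>G n. \<forall>x\<in>space \<nu>. \<bar>g x - g' x\<bar> \<le> \<epsilon>" if "g \<in> ?C n" for n g
    using G(4)[OF that] Q[of n] unfolding Q_def[symmetric] h_def sp\<nu> by simp
  define \<Gamma> where "\<Gamma> = 2 * (2 * real d + 5) / \<epsilon> + 3"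
  define D where "D = 2 * real d + 3"
  have \<Gamma>: "3 \<le> \<Gamma>" "0 < D" using \<epsilon> by (auto simp: \<Gamma>_def D_def)
  have card: "real (card (G n)) \<le> (\<Gamma> * real (k n)) powr (real (k n) * D) \<or> k n = 0" for n
  proof (cases "k n = 0")
    case False
    then have k1: "1 \<le> real (k n)" by simp
    have "real (N n) \<le> 1 / h n + 1" unfolding N_def using h[of n] by (simp add: le_of_int_ceiling)
    then have "real (2 * N n + 1) \<le> 2 * (Q n / \<epsilon>) + 3" using h_def \<epsilon> by simp
    also have "\<dots> \<le> 2 * (real (k n) * (2 * real d + 5) / \<epsilon>) + 3 * real (k n)"
    proof -
      have "real d * 1 \<le> real d * real (k n)" using k1 by (intro mult_left_mono) auto
      then have "Q n \<le> real (k n) * (2 * real d + 5)" using k1 by (simp add: Q_def algebra_simps)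
      then show ?thesis using k1 \<epsilon> by (intro add_mono mult_left_mono divide_right_mono) auto
    qed
    also have "\<dots> = \<Gamma> * real (k n)" by (simp add: \<Gamma>_def algebra_simps)
    finally have b: "real (2 * N n + 1) \<le> \<Gamma> * real (k n)" .
    have g1: "1 \<le> \<Gamma> * real (k n)" using b by linarith
    have "real (card (G n)) \<le> real ((2 * N n + 1) ^ (k n * (d + 2) + d + 1))"
      using G(3)[of n] by (simp only: of_nat_le_iff)
    also have "\<dots> \<le> (\<Gamma> * real (k n)) ^ (k n * (d + 2) + d + 1)"
      unfolding of_nat_power using b by (intro power_mono) auto
    also have "\<dots> = (\<Gamma> * real (k n)) powr real (k n * (d + 2) + d + 1)"
      using g1 by (subst powr_realpow) auto
    also have "\<dots> \<le> (\<Gamma> * real (k n)) powr (real (k n) * D)"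
    proof (rule powr_mono[OF _ g1])
      have "real d * 1 \<le> real d * real (k n)" using k1 by (intro mult_left_mono) auto
      then show "real (k n * (d + 2) + d + 1) \<le> real (k n) * D" using k1 by (simp add: D_def algebra_simps)
    qed
    finally show ?thesis by simp
  qed simp
  have mG: "g \<in> borel_measurable \<mu>" "g \<in> borel_measurable \<nu>" if "g \<in> ?C n" for g n
    using nn_class_measurable[OF act s\<mu> that] nn_class_measurable[OF act s\<nu> that] by auto
  have bG: "\<bar>g x\<bar> \<le> real (k n) * 3 + 1" if "g \<in> ?C n" "x \<in> cube d" for g n x
    using nn_class_bound[OF act that] by simp
  have bpsi: "\<bar>\<psi> (g x)\<bar> \<le> (\<bar>\<psi> 0\<bar> + 4 * l) * real (k n) \<or> k n = 0"
    if "g \<in> G n" "x \<in> cube d" "\<And>a b. \<bar>\<psi> a - \<psi> b\<bar> \<le> l * \<bar>a - b\<bar>" "0 \<le> l" for \<psi> :: "real \<Rightarrow> real" and g n x l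
  proof (cases "k n = 0")
    case False
    then have k1: "1 \<le> real (k n)" by simp
    have "\<bar>g x\<bar> \<le> 4 * real (k n)" using bG[of g n x] that(1,2) G(2) k1 by fastforce
    then have "l * \<bar>g x - 0\<bar> \<le> l * (4 * real (k n))" using that(4) by (intro mult_left_mono) auto
    moreover have "\<bar>\<psi> 0\<bar> * 1 \<le> \<bar>\<psi> 0\<bar> * real (k n)" using k1 by (intro mult_left_mono) auto
    ultimately have "\<bar>\<psi> (g x)\<bar> \<le> \<bar>\<psi> 0\<bar> * real (k n) + l * (4 * real (k n))" using that(3)[of "g x" 0] by linarith
    then show ?thesis by (simp add: algebra_simps)
  qed simp
  have e4: "0 < e / 4" using e by simp
  have AE1: "AE \<omega> in P. \<forall>\<^sub>F n in sequentially. \<forall>g\<in>G n. \<bar>\<Sum>j<n. clip_fst t (g (case_sum X Y (Inl j) \<omega>)) - (\<integral>x. clip_fst t (g x) \<partial>\<mu>)\<bar> \<le> real n * (e / 4)"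
  proof (rule AE_eventually_deviation[where \<psi> = "clip_fst t" and \<beta> = "\<bar>clip_fst t 0\<bar> + 4 * 1",
        OF P ind inj_Inl _ _ G(1) card _ _ _ e4 k \<rho> \<Gamma>])
    show "(\<lambda>x. clip_fst t (g x)) \<in> borel_measurable \<mu>" if "g \<in> G n" for g n
      using measurable_compose[OF mG(1) clip_borel(1)] that G(2) by blast
    show "\<bar>clip_fst t (g x)\<bar> \<le> (\<bar>clip_fst t 0\<bar> + 4 * 1) * real (k n) \<or> k n = 0" if "g \<in> G n" "x \<in> space \<mu>" for g n x
      by (rule bpsi[OF that(1) _ clip_fst_lipschitz]) (use that(2) sp\<mu> in auto)
  qed (use lawX in auto)
  have AE2: "AE \<omega> in P. \<forall>\<^sub>F n in sequentially. \<forall>g\<in>G n. \<bar>\<Sum>j<n. clip_snd t (g (case_sum X Y (Inr j) \<omega>)) - (\<integral>x. clip_snd t (g x) \<partial>\<nu>)\<bar> \<le> real n * (e / 4)"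
  proof (rule AE_eventually_deviation[where \<psi> = "clip_snd t" and \<beta> = "\<bar>clip_snd t 0\<bar> + 4 * (1 / t\<^sup>2)",
        OF P ind inj_Inr _ _ G(1) card _ _ _ e4 k \<rho> \<Gamma>])
    show "(\<lambda>x. clip_snd t (g x)) \<in> borel_measurable \<nu>" if "g \<in> G n" for g n
      using measurable_compose[OF mG(2) clip_borel(2)] that G(2) by blast
    show "\<bar>clip_snd t (g x)\<bar> \<le> (\<bar>clip_snd t 0\<bar> + 4 * (1 / t\<^sup>2)) * real (k n) \<or> k n = 0" if "g \<in> G n" "x \<in> space \<nu>" for g n x
      by (rule bpsi[OF that(1) _ clip_snd_lipschitz[OF t]]) (use that(2) sp\<nu> in auto)
    show "0 < \<bar>clip_snd t 0\<bar> + 4 * (1 / t\<^sup>2)" using t by (intro add_nonneg_pos) auto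
  qed (use lawY in auto)
  have kK: "\<forall>\<^sub>F n in sequentially. K0 \<le> k n" using k(1) by (simp add: filterlim_at_top)
  show ?thesis
    using AE1 AE2 AE_space
  proof eventually_elim
    case (elim \<omega>)
    show ?case
      using elim(1,2) kK eventually_gt_at_top[of 0]
    proof eventually_elim
      case (elim n)
      have n: "1 \<le> n" using elim by simp
      have "\<bar>hellinger2_est ((\<lambda>g x. min (1 - t) (g x)) ` ?C n) n (\<lambda>i. X i \<omega>) (\<lambda>i. Y i \<omega>) - hellinger2 \<mu> \<nu>\<bar>
         \<le> \<bar>e / 4\<bar> + (real n * (e / 4) + real n * (e / 4)) / real n + 2 * (1 + 1 / t\<^sup>2) * \<epsilon>"
      proof (rule estimator_error[OF \<mu> \<nu> p t mG(2) _ G(1) G(2) net _ gap n])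
        show "\<bar>g x\<bar> \<le> real (k n) * 3 + 1" if "g \<in> ?C n" "x \<in> space \<nu>" for g x using bG that unfolding sp\<nu> by blast
        show "g0 \<in> ?C n" using nn_class_pad[of K0 "k n" d \<phi>] elim(3) g0(1) by blast
        show "X j \<omega> \<in> space \<nu>" "Y j \<omega> \<in> space \<nu>" for j
          using measurable_space[OF mX \<open>\<omega> \<in> space P\<close>] measurable_space[OF mY \<open>\<omega> \<in> space P\<close>] unfolding sp\<mu> sp\<nu> by auto
      qed (use elim(1,2) in auto)
      also have "\<dots> = e"
      proof -
        have "2 * (1 + 1 / t\<^sup>2) * \<epsilon> = e / 4" unfolding \<epsilon>_def L_def[symmetric] using L by (simp add: field_simps)
        moreover have "(real n * (e / 4) + real n * (e / 4)) / real n = e / 2" using n by (simp add: field_simps)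
        ultimately show ?thesis using e by simp
      qed
      finally show ?case unfolding nn_star_def clipped_nn_class_def t_def .
    qed
  qed
qed

theorem theorem27:
  shows "(\<forall>(d::nat) \<mu> \<nu> p \<eta> (M::real) \<phi> (\<rho>::real) (k :: nat \<Rightarrow> nat) (P :: 'w measure) X Y.
            1 \<le> d \<longrightarrow> (\<mu>, \<nu>) \<in> prob_pairs d \<longrightarrow>
            density_version \<mu> \<nu> p \<longrightarrow> continuous_on (cube d) (f_H2 p) \<longrightarrow>
            0 < M \<longrightarrow> dominating \<eta> \<mu> \<nu> \<longrightarrow> ess_sup_norm \<eta> p \<le> ereal M \<longrightarrow>
            \<phi> \<in> {sigmoid, relu} \<longrightarrow> 0 < \<rho> \<longrightarrow> \<rho> < 1 \<longrightarrow>
            filterlim k at_top sequentially \<longrightarrow>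
            (\<lambda>n. real (k n)) \<in> O(\<lambda>n. real n powr ((1 - \<rho>) / 3)) \<longrightarrow>
            iid_samples P \<mu> \<nu> X Y \<longrightarrow>
            (AE \<omega> in P.
               (\<lambda>n. hellinger2_est (nn_star d (k n) (M powr (-1/2)) \<phi>) n (\<lambda>i. X i \<omega>) (\<lambda>i. Y i \<omega>))
                 \<longlonglongrightarrow> hellinger2 \<mu> \<nu>))
       \<and> (\<forall>M::real. 0 \<le> M \<longrightarrow> (\<exists>C::real. \<forall>d k n :: nat. 1 \<le> d \<longrightarrow> 2 \<le> k \<longrightarrow> 1 \<le> n \<longrightarrow>
            (SUP (\<mu>, \<nu>)\<in>prob_pairs_bounded M d.
               expected_error (nn_relu d k (1 / ln (real k)) (ln (real k))) n \<mu> \<nu>)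
             \<le> ennreal (C * (real d powr (1/2) * real k powr (-1/2) * ln (real k)
                            + real d powr (3/2) * ln (real k) ^ 3 * real n powr (-1/2)))))"
proof (intro conjI allI impI)
  fix d :: nat and \<mu> \<nu> p \<eta> and M :: real and \<phi> and \<rho> :: real and k :: "nat \<Rightarrow> nat" and P :: "'w measure" and X Y
  assume pq: "(\<mu>, \<nu>) \<in> prob_pairs d" and p: "density_version \<mu> \<nu> p" and cont: "continuous_on (cube d) (f_H2 p)"
    and M: "0 < M" and dom: "dominating \<eta> \<mu> \<nu>" and es: "ess_sup_norm \<eta> p \<le> ereal M"
    and \<phi>: "\<phi> \<in> {sigmoid, relu}" and \<rho>: "0 < \<rho>" "\<rho> < 1"
    and k: "filterlim k at_top sequentially" "(\<lambda>n. real (k n)) \<in> O(\<lambda>n. real n powr ((1 - \<rho>) / 3))"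
    and iid: "iid_samples P \<mu> \<nu> X Y"
  let ?H = "\<lambda>\<omega> n. hellinger2_est (nn_star d (k n) (M powr (-1/2)) \<phi>) n (\<lambda>i. X i \<omega>) (\<lambda>i. Y i \<omega>)"
  note ev = consistency_eventually[OF pq p cont M ess_sup_norm_AE[OF dom es] \<phi> \<rho> k iid]
  have "AE \<omega> in P. \<forall>m. \<forall>\<^sub>F n in sequentially. \<bar>?H \<omega> n - hellinger2 \<mu> \<nu>\<bar> \<le> 1 / real (Suc m)"
    unfolding AE_all_countable by (intro allI ev) simp
  then show "AE \<omega> in P. ?H \<omega> \<longlonglongrightarrow> hellinger2 \<mu> \<nu>"
  proof eventually_elim
    case (elim \<omega>)
    show ?case
    proof (rule tendstoI)
      fix r :: real assume "0 < r"
      then obtain m where "inverse (real (Suc m)) < r" using reals_Archimedean by blast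
      then have m: "1 / real (Suc m) < r" by (simp add: inverse_eq_divide)
      from elim have "\<forall>\<^sub>F n in sequentially. \<bar>?H \<omega> n - hellinger2 \<mu> \<nu>\<bar> \<le> 1 / real (Suc m)" by blast
      then show "\<forall>\<^sub>F n in sequentially. dist (?H \<omega> n) (hellinger2 \<mu> \<nu>) < r"
        by eventually_elim (use m in \<open>simp add: dist_real_def\<close>)
    qed
  qed
next
  fix M :: real assume "0 \<le> M"
  then show "\<exists>C::real. \<forall>d k n :: nat. 1 \<le> d \<longrightarrow> 2 \<le> k \<longrightarrow> 1 \<le> n \<longrightarrow>
            (SUP (\<mu>, \<nu>)\<in>prob_pairs_bounded M d.
               expected_error (nn_relu d k (1 / ln (real k)) (ln (real k))) n \<mu> \<nu>)
             \<le> ennreal (C * (real d powr (1/2) * real k powr (-1/2) * ln (real k)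
                            + real d powr (3/2) * ln (real k) ^ 3 * real n powr (-1/2)))"
    by (rule risk_bound)
qed

end
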